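(* Let $f$ be a polynomial of degree at least $2$ and let $A\subset\overline{\mathbb C}$ be a finite set with $\#A\ge 4$, such that the marked rational map $(f,A)$ is a CTP map whose regular set $E=A\setminus f^{-1}(V_f)$ is non-empty (i.e. $(f,A)$ is regular or mixing). Then $(f,A)$ satisfies McMullen's condition: there exist a Belyi map $s$ and a rational map $g$ such that $f=g\circ s$ and $\#(s(A)\cup V_s)=3$.
   Context: $V_h$ denotes the set of critical values of a rational map $h$. A marked rational map $(f,A)$ is a rational map $f$ with $\deg f\ge 2$ together with a finite set $A\subset\overline{\mathbb C}$, $\#A\ge3$; put $B=f(A)\cup V_f$ (assumed to have at least $3$ points). For a finite set $X\subset\overline{\mathbb C}$ with $\#X\ge 3$, $\mathrm{Teich}(\overline{\mathbb C},X)$ is the set of orientation-preserving homeomorphisms $\phi$ of $\overline{\mathbb C}$ modulo the relation: $\phi_1\sim\phi_2$ iff $\phi_2\circ\phi_1^{-1}$ is isotopic rel $\phi_1(X)$ to a Möbius transformation. For $[\phi_0]\in\mathrm{Teich}(\overline{\mathbb C},B)$ there exist a homeomorphism $\phi_1$ of $\overline{\mathbb C}$ and a rational map $g$ with $g\circ\phi_1=\phi_0\circ f$; the class $[\phi_1]\in\mathrm{Teich}(\overline{\mathbb C},A)$ is well defined, giving the Thurston pullback map $\sigma_{f,A,B}:[\phi_0]\mapsto[\phi_1]$. $(f,A)$ is a CTP map if $\sigma_{f,A,B}$ is constant; it is trivial if $\#A=3$. The regular set is $E=A\setminus f^{-1}(V_f)$; $(f,A)$ is regular if $E=A$, mixing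 if $\emptyset\neq E\neq A$. A Belyi map is a rational map $s$ with $\deg s\ge2$ and $\#V_s\le 3$. *)

theory Defs
  imports "HOL-Homology.Homology" "HOL-Computational_Algebra.Polynomial"
begin

text \<open>The Riemann sphere is modelled as the unit 2-sphere nsphere 2 (points are functions
  nat to real, supported on coordinates 0,1,2).  It is identified with complex option
  (None = infinity) through stereographic projection from the north pole.\<close>

abbreviation S2 :: "(nat \<Rightarrow> real) topology" where
  "S2 \<equiv> nsphere 2"

definition to_C :: "(nat \<Rightarrow> real) \<Rightarrow> complex option" where
  "to_C x = (if x 2 = 1 then None else Some (Complex (x 0) (x 1) / complex_of_real (1 - x 2)))"

definition from_C :: "complex option \<Rightarrow> (nat \<Rightarrow> real)" where
  "from_C w = (case w of
      None \<Rightarrow> (\<lambda>i. if i = 2 then 1 else 0)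
    | Some z \<Rightarrow> (\<lambda>i. if i = 0 then 2 * Re z / (1 + (cmod z)\<^sup>2)
                    else if i = 1 then 2 * Im z / (1 + (cmod z)\<^sup>2)
                    else if i = 2 then ((cmod z)\<^sup>2 - 1) / ((cmod z)\<^sup>2 + 1)
                    else 0))"

text \<open>The rational map p/q on complex option (q nonzero, p and q coprime).\<close>
definition rat_fun :: "complex poly \<Rightarrow> complex poly \<Rightarrow> complex option \<Rightarrow> complex option" where
  "rat_fun p q w = (case w of
      Some z \<Rightarrow> (if poly q z = 0 then None else Some (poly p z / poly q z))
    | None \<Rightarrow> (if degree p > degree q then None
               else if degree p = degree q then Some (lead_coeff p / lead_coeff q)
               else Some 0))"

definition rational_map :: "nat \<Rightarrow> ((nat \<Rightarrow> real) \<Rightarrow> (nat \<Rightarrow> real)) \<Rightarrow> bool" where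
  "rational_map d F \<longleftrightarrow>
     (\<exists>p q. q \<noteq> 0 \<and> coprime p q \<and> max (degree p) (degree q) = d \<and>
        (\<forall>x\<in>topspace S2. F x = from_C (rat_fun p q (to_C x))))"

definition is_rational :: "((nat \<Rightarrow> real) \<Rightarrow> (nat \<Rightarrow> real)) \<Rightarrow> bool" where
  "is_rational F \<longleftrightarrow> (\<exists>d. rational_map d F)"

definition mobius :: "((nat \<Rightarrow> real) \<Rightarrow> (nat \<Rightarrow> real)) \<Rightarrow> bool" where
  "mobius M \<longleftrightarrow> rational_map 1 M"

definition polynomial_map :: "((nat \<Rightarrow> real) \<Rightarrow> (nat \<Rightarrow> real)) \<Rightarrow> bool" where
  "polynomial_map F \<longleftrightarrow> (\<exists>p. \<forall>x\<in>topspace S2. F x = from_C (rat_fun p 1 (to_C x)))"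

text \<open>Critical points: points at which F is not locally injective (local degree > 1);
  critical values V_F: their images.\<close>
definition crit_points :: "((nat \<Rightarrow> real) \<Rightarrow> (nat \<Rightarrow> real)) \<Rightarrow> (nat \<Rightarrow> real) set" where
  "crit_points F = {z \<in> topspace S2. \<not> (\<exists>U. openin S2 U \<and> z \<in> U \<and> inj_on F U)}"

definition crit_values :: "((nat \<Rightarrow> real) \<Rightarrow> (nat \<Rightarrow> real)) \<Rightarrow> (nat \<Rightarrow> real) set" where
  "crit_values F = F ` crit_points F"

definition belyi_map :: "((nat \<Rightarrow> real) \<Rightarrow> (nat \<Rightarrow> real)) \<Rightarrow> bool" where
  "belyi_map s \<longleftrightarrow> (\<exists>d\<ge>2. rational_map d s) \<and> card (crit_values s) \<le> 3"

definition opres_homeo :: "((nat \<Rightarrow> real) \<Rightarrow> (nat \<Rightarrow> real)) \<Rightarrow> bool" where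
  "opres_homeo \<phi> \<longleftrightarrow> homeomorphic_map S2 S2 \<phi> \<and> Brouwer_degree2 2 \<phi> = 1"

text \<open>phi1 ~ phi2 in Teich(Chat, X): phi2 o phi1^-1 isotopic rel phi1(X) to a Moebius map.\<close>
definition teich_equiv ::
  "(nat \<Rightarrow> real) set \<Rightarrow> ((nat \<Rightarrow> real) \<Rightarrow> (nat \<Rightarrow> real)) \<Rightarrow> ((nat \<Rightarrow> real) \<Rightarrow> (nat \<Rightarrow> real)) \<Rightarrow> bool" where
  "teich_equiv X \<phi>1 \<phi>2 \<longleftrightarrow>
     (\<exists>M. mobius M \<and>
        homotopic_with
          (\<lambda>h. homeomorphic_map S2 S2 h \<and>
               (\<forall>y\<in>\<phi>1 ` X. h y = \<phi>2 (inv_into (topspace S2) \<phi>1 y)))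
          S2 S2 (\<phi>2 \<circ> inv_into (topspace S2) \<phi>1) M)"

definition pullback :: "((nat \<Rightarrow> real) \<Rightarrow> (nat \<Rightarrow> real)) \<Rightarrow> ((nat \<Rightarrow> real) \<Rightarrow> (nat \<Rightarrow> real))
    \<Rightarrow> ((nat \<Rightarrow> real) \<Rightarrow> (nat \<Rightarrow> real)) \<Rightarrow> bool" where
  "pullback f \<phi>0 \<phi>1 \<longleftrightarrow> opres_homeo \<phi>0 \<and> opres_homeo \<phi>1 \<and>
     (\<exists>g. is_rational g \<and> (\<forall>x\<in>topspace S2. g (\<phi>1 x) = \<phi>0 (f x)))"

text \<open>(f,A) is CTP: the Thurston pullback map sigma_{f,A,B} is constant, i.e. all pullbacks
  (of all points of Teich(Chat,B)) define the same point of Teich(Chat,A).\<close>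
definition CTP :: "((nat \<Rightarrow> real) \<Rightarrow> (nat \<Rightarrow> real)) \<Rightarrow> (nat \<Rightarrow> real) set \<Rightarrow> bool" where
  "CTP f A \<longleftrightarrow>
     (\<forall>\<phi>0 \<phi>1 \<psi>0 \<psi>1. pullback f \<phi>0 \<phi>1 \<and> pullback f \<psi>0 \<psi>1 \<longrightarrow> teich_equiv A \<phi>1 \<psi>1)"

end

theory Submission
  imports Defs "HOL-Complex_Analysis.Complex_Analysis"
    "HOL-Computational_Algebra.Fundamental_Theorem_Algebra"
begin

text \<open>
  Write f = p on the complex plane and let b = f(a) be a value with a regular preimage a in A.
  Pushing b to a nearby point t by a homeomorphism supported in a small disc lifts to a
  homeomorphism that moves every x in A over b along the local inverse branch of p and fixes the
  rest of A.  Constancy of the pullback map therefore yields, for every t, a Moebius map carrying the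
  moved points back to A; so all cross ratios of the branches and the fixed points are constant in t.

  Such relations persist under analytic continuation.  For a holomorphic function \<Phi> of tuples of
  branches, the product of X - \<Phi>(y) over all tuples y over t whose germ satisfies the relation is
  holomorphic in t off the critical values; if \<Phi> is bounded this product is constant, hence so is
  \<Phi> (a Liouville theorem for multivalued functions).  Near infinity the branches are
  asymptotically distinct d-th roots of t, with common centre the barycentre c of the fibres; applied
  to suitable \<Phi> this shows that the points of A over b are images of one another under rotations
  about c which are symmetries of p, and that the other points of A lie in {c, infinity}.  If n is the order
  of the group of such symmetries, then s(z) = (z - c)^n is the required Belyi map.
\<close>

section \<open>Local inverse branches of a polynomial\<close>

text \<open>Infinity is where a polynomial gives control: it is totally ramified, so all sheets meet
  there and any two points of a fibre have asymptotically the same modulus. Directions on a circle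
  turn one complex relation into two, the relation and its conjugate. What resists is that four
  points of a circle are not determined by their cross ratio, whereas three are determined up to
  rotation by their affine shape. Hence a cross ratio must first be improved to an affine ratio, and
  bounding that ratio near the critical points, where finite sheets collide, is the delicate
  estimate. A point of A off the fibre over b takes the place of a branch: infinity makes the
  relation affine at once, a single finite point disappears from it in the limit, and two finite
  points would force a symmetry with a finite pole. This is why the argument splits by the number of
  such points, and why four points of A suffice in each case. Locating the centre needs second-order
  information at infinity, which is where the barycentre enters.\<close>

lemma degree_diff_const:
  fixes p :: "complex poly"
  shows "degree (p - [:t:]) = degree p"
proof (cases "degree p = 0")
  case False
  then have "degree (p + [:-t:]) = degree p" by (intro degree_add_eq_left) auto
  moreover have "p + [:-t:] = p - [:t:]" by simp
  ultimately show ?thesis by metis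
qed (auto elim!: degree_eq_zeroE)

lemma holomorphic_on_poly [holomorphic_intros]: "poly p holomorphic_on S"
  by (meson field_differentiable_at_within field_differentiable_def holomorphic_on_def poly_DERIV)

definition regular_value :: "complex poly \<Rightarrow> complex \<Rightarrow> bool" where
  "regular_value p t \<longleftrightarrow> (\<forall>y. poly p y = t \<longrightarrow> poly (pderiv p) y \<noteq> 0)"

lemma finite_fibre:
  fixes p :: "complex poly"
  assumes "degree p > 0"
  shows "finite {y. poly p y = t}"
proof -
  have "p - [:t:] \<noteq> 0"
    using assms by (metis degree_pCons_0 eq_iff_diff_eq_0 less_irrefl)
  then have "finite {y. poly (p - [:t:]) y = 0}"
    using poly_roots_finite by blast
  then show ?thesis by simp
qed

lemma card_fibre_le:
  fixes p :: "complex poly"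
  assumes "degree p > 0"
  shows "card {y. poly p y = t} \<le> degree p"
proof -
  have "p - [:t:] \<noteq> 0"
    using assms by (metis degree_pCons_0 eq_iff_diff_eq_0 less_irrefl)
  moreover have "degree (p - [:t:]) = degree p"
    by (rule degree_diff_const)
  ultimately have "card {y. poly (p - [:t:]) y = 0} \<le> degree p"
    using card_poly_roots_bound[of "p - [:t:]"] by metis
  then show ?thesis by simp
qed

text \<open>Over a regular value \<open>p - [:t:]\<close> has only simple roots, so it is a constant
  times a product of distinct linear factors. The exact count ensures that the branches started at
  this fibre are numerous enough to exhaust the nearby ones.\<close>

lemma card_fibre_regular:
  fixes p :: "complex poly"
  assumes "degree p > 0" "regular_value p t"
  shows "card {y. poly p y = t} = degree p"
proof -
  let ?q = "p - [:t:]"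
  have deg: "degree ?q = degree p"
    by (rule degree_diff_const)
  have "rsquarefree ?q"
    using assms(2) by (auto simp: rsquarefree_roots regular_value_def pderiv_diff)
  then have eq: "Polynomial.smult (lead_coeff ?q) (\<Prod>z|poly ?q z = 0. [:-z, 1:]) = ?q"
    by (rule complex_poly_decompose_rsquarefree)
  define L where "L = lead_coeff ?q"
  have "L \<noteq> 0" using deg assms(1) by (metis L_def leading_coeff_0_iff degree_0 less_irrefl)
  then have "degree (Polynomial.smult L (\<Prod>z|poly ?q z = 0. [:-z, 1:])) = card {z. poly ?q z = 0}"
    by (simp add: degree_prod_eq_sum_degree)
  with eq[folded L_def] deg show ?thesis by simp
qed

lemma finite_critical_values:
  fixes p :: "complex poly"
  assumes "degree p > 0"
  shows "finite {t. \<not> regular_value p t}"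
proof -
  have "pderiv p \<noteq> 0" using assms pderiv_iszero by fastforce
  then have "finite (poly p ` {y. poly (pderiv p) y = 0})"
    using poly_roots_finite by blast
  moreover have "{t. \<not> regular_value p t} \<subseteq> poly p ` {y. poly (pderiv p) y = 0}"
    by (auto simp: regular_value_def)
  ultimately show ?thesis by (rule finite_subset[rotated])
qed

section \<open>Uniqueness of branches and evenly covered discs\<close>

lemma deriv_poly_eq: "deriv (poly p) z = poly (pderiv p) z" for z :: complex
  by (rule DERIV_imp_deriv[OF poly_DERIV])

lemma poly_locally_inj:
  fixes p :: "complex poly"
  assumes "poly (pderiv p) x \<noteq> 0"
  obtains e where "e > 0" "inj_on (poly p) (ball x e)"
proof -
  have "poly p holomorphic_on UNIV" "deriv (poly p) x \<noteq> 0"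
    using assms by (simp_all add: deriv_poly_eq holomorphic_on_poly)
  then show ?thesis
    using has_complex_derivative_locally_injective[of "poly p" UNIV x] that by blast
qed

definition branch :: "complex poly \<Rightarrow> complex set \<Rightarrow> (complex \<Rightarrow> complex) \<Rightarrow> bool" where
  "branch p S g \<longleftrightarrow> g holomorphic_on S \<and> (\<forall>s\<in>S. poly p (g s) = s)"

text \<open>By the chain rule p'(g(s)) g'(s) = 1, so neither factor vanishes.\<close>

lemma branch_deriv:
  assumes "branch p S g" "open S" "s \<in> S"
  shows "poly (pderiv p) (g s) \<noteq> 0"
proof
  assume z: "poly (pderiv p) (g s) = 0"
  have "(g has_field_derivative deriv g s) (at s)"
    using assms holomorphic_derivI unfolding branch_def by blast
  then have "((\<lambda>s. poly p (g s)) has_field_derivative (deriv g s * poly (pderiv p) (g s))) (at s)"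
    by (rule has_field_derivative_poly)
  then have "((\<lambda>s. poly p (g s)) has_field_derivative 0) (at s)" using z by (metis mult_zero_right)
  then have "((\<lambda>s. s) has_field_derivative 0) (at s)"
    by (rule has_field_derivative_transform_within_open[OF _ assms(2,3)])
       (use assms in \<open>auto simp: branch_def\<close>)
  then show False
    using DERIV_unique[OF _ DERIV_ident] by fastforce
qed

text \<open>Near g(s) the polynomial is injective, and by continuity both branches remain in that
  neighbourhood.\<close>

lemma branch_germ_unique:
  assumes "branch p S g" "branch p S h" "open S" "s \<in> S" "g s = h s"
  shows "\<exists>\<rho>>0. \<forall>w\<in>ball s \<rho>. w \<in> S \<and> g w = h w"
proof -
  obtain e where e: "e > 0" "inj_on (poly p) (ball (g s) e)"
    using poly_locally_inj branch_deriv[OF assms(1,3,4)] by blast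
  have "isCont g s" "isCont h s"
    using assms holomorphic_on_imp_continuous_on continuous_on_eq_continuous_at unfolding branch_def by blast+
  then have "\<forall>\<^sub>F w in nhds s. dist (g w) (g s) < e" "\<forall>\<^sub>F w in nhds s. dist (h w) (h s) < e"
    using e(1) by (auto simp: isCont_def tendsto_at_iff_tendsto_nhds dest!: tendstoD)
  moreover have "\<forall>\<^sub>F w in nhds s. w \<in> S" using assms eventually_nhds_in_open by blast
  ultimately have "\<forall>\<^sub>F w in nhds s. w \<in> S \<and> g w = h w"
  proof eventually_elim
    case (elim w)
    then have "poly p (g w) = poly p (h w)" using assms by (auto simp: branch_def)
    then show ?case using elim e(2) assms(5) by (auto simp: inj_on_def dist_commute)
  qed
  then show ?thesis
    unfolding eventually_nhds_metric by (auto simp: dist_commute)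
qed

text \<open>Holomorphic inverses on disjoint discs around the fibre points provide the branches.
  That nothing else lies over the disc follows by counting: over each \<open>s\<close> they give
  \<open>degree p\<close> distinct points, and no fibre has more.\<close>

lemma even_cover:
  fixes p :: "complex poly"
  assumes deg: "degree p > 0" and reg: "regular_value p t"
  obtains r br where "r > 0"
    "\<And>x. poly p x = t \<Longrightarrow> branch p (ball t r) (br x)"
    "\<And>x. poly p x = t \<Longrightarrow> br x t = x"
    "\<And>s y. s \<in> ball t r \<Longrightarrow> poly p y = s \<Longrightarrow> \<exists>x. poly p x = t \<and> y = br x s"
    "\<And>s x x'. s \<in> ball t r \<Longrightarrow> poly p x = t \<Longrightarrow> poly p x' = t \<Longrightarrow> br x s = br x' s \<Longrightarrow> x = x'"
proof -
  let ?F = "{y. poly p y = t}"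
  have fin: "finite ?F" using finite_fibre[OF deg] .
  have "\<exists>e>0. inj_on (poly p) (ball x e)" if "x \<in> ?F" for x
    using that reg poly_locally_inj[of p x] by (metis (mono_tags, lifting) mem_Collect_eq regular_value_def)
  then obtain e0 where e0: "\<And>x. x \<in> ?F \<Longrightarrow> e0 x > 0 \<and> inj_on (poly p) (ball x (e0 x))" by metis
  obtain \<delta> where \<delta>: "\<delta> > 0" "\<And>x y. x \<in> ?F \<Longrightarrow> y \<in> ?F \<Longrightarrow> x \<noteq> y \<Longrightarrow> \<delta> \<le> dist x y"
  proof -
    have "\<exists>d>0. \<forall>y\<in>?F. y \<noteq> x \<longrightarrow> d \<le> dist x y" for x
      using finite_set_avoid[OF fin] .
    then obtain dd where dd: "\<And>x. dd x > 0 \<and> (\<forall>y\<in>?F. y \<noteq> x \<longrightarrow> dd x \<le> dist x y)" by metis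
    have "finite (insert 1 (dd ` ?F))" using fin by simp
    then have M: "Min (insert 1 (dd ` ?F)) > 0" "\<And>x. x \<in> ?F \<Longrightarrow> Min (insert 1 (dd ` ?F)) \<le> dd x"
      using dd by (auto simp: Min_gr_iff)
    have "Min (insert 1 (dd ` ?F)) \<le> dist x y" if "x \<in> ?F" "y \<in> ?F" "x \<noteq> y" for x y
      using M(2)[OF that(1)] dd[of x] that by fastforce
    with M(1) show ?thesis by (rule that)
  qed
  \<comment> \<open>Half of a lower bound for the separation of the fibre points keeps the discs
    disjoint, and so the branches distinct.\<close>
  define e where "e x = min (e0 x) (\<delta>/2)" for x
  have e: "e x > 0" "inj_on (poly p) (ball x (e x))" "e x \<le> \<delta>/2" if "x \<in> ?F" for x
  proof -
    show "e x > 0" "e x \<le> \<delta>/2" using e0[OF that] \<delta>(1) by (auto simp: e_def)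
    have "ball x (e x) \<subseteq> ball x (e0 x)" by (auto simp: e_def)
    then show "inj_on (poly p) (ball x (e x))" using e0[OF that] inj_on_subset by blast
  qed
  have disj: "x = x'" if "x \<in> ?F" "x' \<in> ?F" "w \<in> ball x (e x)" "w \<in> ball x' (e x')" for x x' w
  proof (rule ccontr)
    assume "x \<noteq> x'"
    then have "\<delta> \<le> dist x x'" using \<delta>(2) that by blast
    also have "\<dots> \<le> dist x w + dist x' w" by (rule dist_triangle2)
    also have "\<dots> < \<delta>" using that e(3)[OF that(1)] e(3)[OF that(2)] by simp
    finally show False by simp
  qed
  have "\<exists>g. g holomorphic_on (poly p ` ball x (e x)) \<and> (\<forall>z\<in>ball x (e x). g (poly p z) = z)"
    if "x \<in> ?F" for x
    by (rule holomorphic_has_inverse[OF holomorphic_on_poly open_ball e(2)[OF that]]) blast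
  then obtain br where br: "\<And>x. x \<in> ?F \<Longrightarrow> br x holomorphic_on (poly p ` ball x (e x)) \<and> (\<forall>z\<in>ball x (e x). br x (poly p z) = z)"
    by metis
  have "\<exists>r>0. ball t r \<subseteq> poly p ` ball x (e x)" if "x \<in> ?F" for x
  proof -
    have "open (poly p ` ball x (e x))"
      by (intro open_mapping_thm3 e that) (auto intro!: holomorphic_intros)
    moreover have "t \<in> poly p ` ball x (e x)" using that e(1)[OF that] by force
    ultimately show ?thesis using open_contains_ball by blast
  qed
  then obtain r0 where r0: "\<And>x. x \<in> ?F \<Longrightarrow> r0 x > 0 \<and> ball t (r0 x) \<subseteq> poly p ` ball x (e x)" by metis
  define r where "r = Min (insert 1 (r0 ` ?F))"
  have r: "r > 0" "\<And>x. x \<in> ?F \<Longrightarrow> r \<le> r0 x"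
    using fin r0 by (auto simp: r_def Min_gr_iff)
  have sub: "ball t r \<subseteq> poly p ` ball x (e x)" if "x \<in> ?F" for x
    using r0[OF that] r(2)[OF that] by (meson order.trans subset_ball)
  have mem: "br x s \<in> ball x (e x)" "poly p (br x s) = s" if "x \<in> ?F" "s \<in> ball t r" for x s
    using sub[OF that(1)] br[OF that(1)] that(2) by force+
  have inj: "x = x'" if "s \<in> ball t r" "x \<in> ?F" "x' \<in> ?F" "br x s = br x' s" for s x x'
    using disj[of x x' "br x s"] mem[of x s] mem[of x' s] that by metis
  show ?thesis
  proof (rule that[of r br])
    show "r > 0" by fact
    show "branch p (ball t r) (br x)" if "poly p x = t" for x
      using br[of x] sub[of x] mem[of x] that by (auto simp: branch_def intro: holomorphic_on_subset)
    show "br x t = x" if "poly p x = t" for x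
      using br[of x] that e(1)[of x] by auto
    show "\<exists>x. poly p x = t \<and> y = br x s" if s: "s \<in> ball t r" "poly p y = s" for s y
    proof -
      let ?I = "(\<lambda>x. br x s) ` ?F"
      have "inj_on (\<lambda>x. br x s) ?F" using inj s(1) by (auto simp: inj_on_def)
      then have "card ?I = degree p"
        using card_image card_fibre_regular[OF deg reg] by metis
      moreover have sb: "?I \<subseteq> {y. poly p y = s}" using mem s by auto
      ultimately have "?I = {y. poly p y = s}"
        using card_fibre_le[OF deg, of s] finite_fibre[OF deg, of s] card_seteq by metis
      then show ?thesis using s by auto
    qed
    show "x = x'" if "s \<in> ball t r" "poly p x = t" "poly p x' = t" "br x s = br x' s" for s x x'
      using inj that by auto
  qed
qed

section \<open>A Liouville theorem for tuples of branches\<close>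

text \<open>The exceptional points are removable; filling them one at a time yields a bounded entire
  function. The induction generalises over \<open>f\<close> and \<open>B\<close> because filling a
  point changes the function and may raise the bound.\<close>

lemma bounded_holomorphic_cofinite_constant:
  assumes "finite V" "f holomorphic_on - V" "\<And>z. z \<notin> V \<Longrightarrow> norm (f z) \<le> B"
  shows "\<exists>c. \<forall>z. z \<notin> V \<longrightarrow> f z = c"
proof -
  have "\<exists>g C. g holomorphic_on UNIV \<and> (\<forall>z. z \<notin> V \<longrightarrow> g z = f z) \<and> (\<forall>z. norm (g z) \<le> C)"
    using assms
  proof (induction V arbitrary: f B rule: finite_induct)
    case empty
    then show ?case by auto
  next
    case (insert a V)
    have cl: "open (- V)" using insert.hyps by (simp add: finite_imp_closed open_Compl)
    have "- insert a V = - V - {a}" by auto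
    then have hol: "f holomorphic_on (- V - {a})" using insert.prems by simp
    have int: "a \<in> interior (- V)" using cl insert.hyps by (simp add: interior_open)
    have "\<forall>\<^sub>F z in at a. z \<in> - V" using cl insert.hyps eventually_at_topological by blast
    then have "\<forall>\<^sub>F z in at a. z \<in> - V \<and> z \<noteq> a" by (simp add: eventually_conj eventually_neq_at_within)
    then have "\<forall>\<^sub>F z in at a. norm (f z) \<le> B"
      by eventually_elim (use insert.prems(2) in auto)
    then obtain g where g: "g holomorphic_on - V" "\<forall>z\<in>- V - {a}. g z = f z"
      using holomorphic_on_extend_bounded[OF hol int] by blast
    have "norm (g z) \<le> max B (norm (g a))" if "z \<notin> V" for z
      using g(2) insert.prems(2)[of z] that by (cases "z = a") (auto simp: le_max_iff_disj)
    from insert.IH[OF g(1) this] obtain h C where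
      "h holomorphic_on UNIV" "\<forall>z. z \<notin> V \<longrightarrow> h z = g z" "\<forall>z. norm (h z) \<le> C" by blast
    then show ?case using g(2) by (intro exI[of _ h] exI[of _ C]) auto
  qed
  then obtain g C where g: "g holomorphic_on UNIV" "\<And>z. z \<notin> V \<Longrightarrow> g z = f z" "\<And>z. norm (g z) \<le> C" by blast
  then have "bounded (range g)" by (auto simp: bounded_iff)
  then have "g constant_on UNIV" using g(1) Liouville_theorem by blast
  then obtain c where "\<And>z. g z = c" by (auto simp: constant_on_def)
  then show ?thesis using g(2) by metis
qed

text \<open>The germ condition, rather than R = 0 at t alone, makes the number of tuples locally constant.\<close>

definition germ_tuples ::
    "complex poly \<Rightarrow> (('i::finite \<Rightarrow> complex) \<Rightarrow> complex) \<Rightarrow> complex \<Rightarrow> ('i \<Rightarrow> complex) set" where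
  "germ_tuples p R t = {y. inj y \<and>
     (\<exists>\<rho>>0. \<exists>g. (\<forall>i. branch p (ball t \<rho>) (g i) \<and> g i t = y i) \<and> (\<forall>s\<in>ball t \<rho>. R (\<lambda>i. g i s) = 0))}"

text \<open>Only tuples with pairwise distinct entries are tested, so that quotients with
  denominators such as \<open>y 1 - y 2\<close> qualify.\<close>

definition holomorphic_rel :: "(('i \<Rightarrow> complex) \<Rightarrow> complex) \<Rightarrow> bool" where
  "holomorphic_rel R \<longleftrightarrow> (\<forall>S g. open S \<longrightarrow> (\<forall>i. g i holomorphic_on S) \<longrightarrow>
      (\<forall>s\<in>S. inj (\<lambda>i. g i s)) \<longrightarrow> (\<lambda>s. R (\<lambda>i. g i s)) holomorphic_on S)"

lemma holomorphic_relD: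
  assumes "holomorphic_rel R" "open S" "\<And>i. branch p S (g i)" "\<And>s. s \<in> S \<Longrightarrow> inj (\<lambda>i. g i s)"
  shows "(\<lambda>s. R (\<lambda>i. g i s)) holomorphic_on S"
  using assms unfolding holomorphic_rel_def branch_def by simp

lemma branch_subset: "branch p S g \<Longrightarrow> T \<subseteq> S \<Longrightarrow> branch p T g"
  by (auto simp: branch_def intro: holomorphic_on_subset)

text \<open>If a relation holds along some branches near one point of an evenly covered disc, the
  identity theorem spreads it over the whole disc. Hence one finite family \<open>I\<close> of
  tuples of sheets parametrises the germ tuples over every \<open>s\<close> at once.\<close>

lemma germ_tuples_local:
  fixes R :: "('i::finite \<Rightarrow> complex) \<Rightarrow> complex"
  assumes deg: "degree p > 0" and reg: "regular_value p t" and hol: "holomorphic_rel R"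
  obtains r I where "r > 0" "finite I" "\<And>h i. h \<in> I \<Longrightarrow> branch p (ball t r) (h i)"
    "\<And>h s. h \<in> I \<Longrightarrow> s \<in> ball t r \<Longrightarrow> inj (\<lambda>i. h i s)"
    "\<And>s. s \<in> ball t r \<Longrightarrow> bij_betw (\<lambda>h i. h i s) I (germ_tuples p R s)"
proof -
  obtain r br where r: "r > 0"
    and br: "\<And>x. poly p x = t \<Longrightarrow> branch p (ball t r) (br x)"
    and "\<And>x. poly p x = t \<Longrightarrow> br x t = x"
    and surj: "\<And>s y. s \<in> ball t r \<Longrightarrow> poly p y = s \<Longrightarrow> \<exists>x. poly p x = t \<and> y = br x s"
    and inj: "\<And>s x x'. s \<in> ball t r \<Longrightarrow> poly p x = t \<Longrightarrow> poly p x' = t \<Longrightarrow> br x s = br x' s \<Longrightarrow> x = x'"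
    by (rule even_cover[OF deg reg]) (rule that; assumption)
  define X where "X = {x::'i \<Rightarrow> complex. inj x \<and> (\<forall>i. poly p (x i) = t) \<and> (\<forall>s\<in>ball t r. R (\<lambda>i. br (x i) s) = 0)}"
  define I where "I = (\<lambda>x i. br (x i)) ` X"
  have "X \<subseteq> PiE UNIV (\<lambda>_. {y. poly p y = t})" by (auto simp: X_def)
  then have "finite X"
    by (rule finite_subset) (intro finite_PiE finite_fibre[OF deg] finite)
  then have fin: "finite I" by (simp add: I_def)
  have injx: "inj (\<lambda>i. br (x i) s)" if "inj x" "\<forall>i. poly p (x i) = t" "s \<in> ball t r" for x :: "'i \<Rightarrow> complex" and s
    using inj[OF that(3)] that by (meson injD injI)
  have bij: "bij_betw (\<lambda>h i. h i s) I (germ_tuples p R s)" if s: "s \<in> ball t r" for s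
  proof (rule bij_betw_imageI)
    show "inj_on (\<lambda>h i. h i s) I"
    proof (rule inj_onI)
      fix h h' assume "h \<in> I" "h' \<in> I" and eq: "(\<lambda>i. h i s) = (\<lambda>i. h' i s)"
      then obtain x x' where x: "x \<in> X" "h = (\<lambda>i. br (x i))" "x' \<in> X" "h' = (\<lambda>i. br (x' i))"
        by (auto simp: I_def)
      have "x i = x' i" for i
        using inj[OF s, of "x i" "x' i"] x fun_cong[OF eq, of i] by (auto simp: X_def)
      then show "h = h'" using x by simp
    qed
    show "(\<lambda>h i. h i s) ` I = germ_tuples p R s"
    proof (intro equalityI subsetI)
      fix y assume "y \<in> (\<lambda>h i. h i s) ` I"
      then obtain x where x: "x \<in> X" "y = (\<lambda>i. br (x i) s)" by (auto simp: I_def)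
      obtain \<rho> where \<rho>: "\<rho> > 0" "ball s \<rho> \<subseteq> ball t r" using s open_contains_ball[of "ball t r"] by (meson open_ball)
      have "branch p (ball s \<rho>) (br (x i))" for i
        using br[of "x i"] x(1) branch_subset[OF _ \<rho>(2)] by (auto simp: X_def)
      then show "y \<in> germ_tuples p R s"
        using x \<rho> injx[OF _ _ s, of x] unfolding germ_tuples_def X_def
        by (intro CollectI conjI exI[of _ \<rho>] exI[of _ "\<lambda>i. br (x i)"]) auto
    next
      fix y assume y: "y \<in> germ_tuples p R s"
      then obtain \<rho> g where \<rho>: "\<rho> > 0" and g: "\<And>i. branch p (ball s \<rho>) (g i)" "\<And>i. g i s = y i"
        and R: "\<And>w. w \<in> ball s \<rho> \<Longrightarrow> R (\<lambda>i. g i w) = 0" and "inj y"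
        unfolding germ_tuples_def by blast
      have "\<exists>x. poly p x = t \<and> y i = br x s" for i
        using surj[OF s, of "y i"] g(1)[of i] g(2)[of i] \<rho> by (metis branch_def centre_in_ball)
      then obtain x where x: "\<And>i. poly p (x i) = t" "\<And>i. y i = br (x i) s" by metis
      have "inj x" using \<open>inj y\<close> x(2) by (metis injD injI)
      have "\<exists>\<epsilon>>0. \<forall>w\<in>ball s \<epsilon>. w \<in> ball t r \<inter> ball s \<rho> \<and> g i w = br (x i) w" for i
      proof (rule branch_germ_unique)
        show "branch p (ball t r \<inter> ball s \<rho>) (g i)" by (rule branch_subset[OF g(1)]) auto
        show "branch p (ball t r \<inter> ball s \<rho>) (br (x i))" by (rule branch_subset[OF br[OF x(1)]]) auto
        show "open (ball t r \<inter> ball s \<rho>)" "s \<in> ball t r \<inter> ball s \<rho>" using s \<rho> by auto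
        show "g i s = br (x i) s" using x g(2) by simp
      qed
      then obtain \<epsilon> where \<epsilon>: "\<And>i. \<epsilon> i > 0"
        "\<And>i w. w \<in> ball s (\<epsilon> i) \<Longrightarrow> w \<in> ball t r \<inter> ball s \<rho> \<and> g i w = br (x i) w" by metis
      \<comment> \<open>Finiteness of the index type gives one radius on which every
        \<open>g i\<close> coincides with its sheet; the vanishing of \<open>R\<close> on that small
        disc then propagates to \<open>ball t r\<close>.\<close>
      define e where "e = Min (range \<epsilon>)"
      have e: "e > 0" "\<And>i. e \<le> \<epsilon> i" using \<epsilon>(1) by (auto simp: e_def)
      have ew: "w \<in> ball t r \<inter> ball s \<rho> \<and> (\<forall>i. g i w = br (x i) w)" if "w \<in> ball s e" for w
        using \<epsilon>(2) e(2) that by (meson less_le_trans mem_ball)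
      have "R (\<lambda>i. br (x i) w) = 0" if "w \<in> ball t r" for w
      proof (rule analytic_continuation_open[of "ball s e" "ball t r" "\<lambda>w. R (\<lambda>i. br (x i) w)" "\<lambda>_. 0"])
        show "(\<lambda>w. R (\<lambda>i. br (x i) w)) holomorphic_on ball t r"
          by (rule holomorphic_relD[OF hol open_ball br[OF x(1)] injx[OF \<open>inj x\<close>]]) (use x in auto)
        show "R (\<lambda>i. br (x i) z) = 0" if "z \<in> ball s e" for z
          using R[of z] ew[OF that] by simp
        show "ball s e \<noteq> {}" using e(1) by simp
      qed (use ew that in auto)
      then have "x \<in> X" using \<open>inj x\<close> x by (auto simp: X_def)
      moreover have "y = (\<lambda>i. br (x i) s)" using x by auto
      ultimately show "y \<in> (\<lambda>h i. h i s) ` I" by (auto simp: I_def)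
    qed
  qed
  show ?thesis
    by (rule that[OF r fin]) (use br injx bij in \<open>auto simp: I_def X_def\<close>)
qed

lemma germ_tuplesD:
  assumes "y \<in> germ_tuples p R t"
  shows "inj y" "poly p (y i) = t" "R y = 0"
proof -
  obtain \<rho> g where \<rho>: "\<rho> > 0" and g: "\<And>i. branch p (ball t \<rho>) (g i)" "\<And>i. g i t = y i"
    and R: "\<And>w. w \<in> ball t \<rho> \<Longrightarrow> R (\<lambda>i. g i w) = 0" and "inj y"
    using assms unfolding germ_tuples_def by blast
  show "inj y" by fact
  show "poly p (y i) = t" using g(1)[of i] g(2)[of i] \<rho> by (metis branch_def centre_in_ball)
  show "R y = 0" using R[of t] g(2) \<rho> by simp
qed

text \<open>The bound does not depend on \<open>t\<close>, so products over the tuples are bounded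
  uniformly once their factors are.\<close>

lemma germ_tuples_card:
  fixes R :: "('i::finite \<Rightarrow> complex) \<Rightarrow> complex"
  assumes "degree p > 0"
  shows "finite (germ_tuples p R t)" "card (germ_tuples p R t) \<le> degree p ^ CARD('i)"
proof -
  let ?P = "PiE (UNIV::'i set) (\<lambda>_. {y. poly p y = t})"
  have sub: "germ_tuples p R t \<subseteq> ?P" using germ_tuplesD(2) by fastforce
  have fin: "finite ?P" using finite_fibre[OF assms] by (intro finite_PiE) auto
  then show "finite (germ_tuples p R t)" using sub finite_subset by blast
  have "card (germ_tuples p R t) \<le> card ?P" by (rule card_mono[OF fin sub])
  also have "\<dots> = card {y. poly p y = t} ^ CARD('i)" by (simp add: card_PiE)
  also have "\<dots> \<le> degree p ^ CARD('i)" using card_fibre_le[OF assms] by (intro power_mono) auto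
  finally show "card (germ_tuples p R t) \<le> degree p ^ CARD('i)" .
qed

text \<open>The product of X - \<Phi>(y) over the germ tuples y is a single-valued bounded holomorphic function
  of t; choosing X as a value of \<Phi> at one point shows that X is a value of \<Phi> over every t.\<close>

theorem branch_tuple_Liouville:
  fixes R \<Phi> :: "('i::finite \<Rightarrow> complex) \<Rightarrow> complex"
  assumes deg: "degree p > 0" and hR: "holomorphic_rel R" and h\<Phi>: "holomorphic_rel \<Phi>"
    and bd: "\<And>t y. regular_value p t \<Longrightarrow> inj y \<Longrightarrow> (\<And>i. poly p (y i) = t) \<Longrightarrow> R y = 0 \<Longrightarrow> norm (\<Phi> y) \<le> C"
    and r: "r > 0" and reg: "\<And>s. s \<in> ball b r \<Longrightarrow> regular_value p s"
    and g: "\<And>i. branch p (ball b r) (g i)"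
    and ginj: "\<And>s. s \<in> ball b r \<Longrightarrow> inj (\<lambda>i. g i s)"
    and gR: "\<And>s. s \<in> ball b r \<Longrightarrow> R (\<lambda>i. g i s) = 0"
  shows "\<exists>X. (\<forall>s\<in>ball b r. \<Phi> (\<lambda>i. g i s) = X) \<and>
    (\<forall>t. regular_value p t \<longrightarrow> (\<exists>y. inj y \<and> (\<forall>i. poly p (y i) = t) \<and> R y = 0 \<and> \<Phi> y = X))"
proof -
  define V where "V = {t. \<not> regular_value p t}"
  have finV: "finite V" using finite_critical_values[OF deg] by (simp add: V_def)
  define P where "P X t = (\<Prod>y\<in>germ_tuples p R t. X - \<Phi> y)" for X t
  have holP: "P X holomorphic_on - V" for X
  proof -
    have "P X field_differentiable at t" if "t \<notin> V" for t
    proof -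
      have "regular_value p t" using that by (simp add: V_def)
      then obtain \<rho> I where \<rho>: "\<rho> > 0" and I: "finite I" "\<And>h i. h \<in> I \<Longrightarrow> branch p (ball t \<rho>) (h i)"
        "\<And>h s. h \<in> I \<Longrightarrow> s \<in> ball t \<rho> \<Longrightarrow> inj (\<lambda>i. h i s)"
        "\<And>s. s \<in> ball t \<rho> \<Longrightarrow> bij_betw (\<lambda>h i. h i s) I (germ_tuples p R s)"
        using germ_tuples_local[OF deg _ hR] by metis
      have "(\<lambda>s. \<Prod>h\<in>I. X - \<Phi> (\<lambda>i. h i s)) holomorphic_on ball t \<rho>"
      proof (intro holomorphic_on_prod holomorphic_on_diff holomorphic_on_const)
        fix h assume h: "h \<in> I"
        show "(\<lambda>s. \<Phi> (\<lambda>i. h i s)) holomorphic_on ball t \<rho>"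
          by (rule holomorphic_relD[OF h\<Phi> open_ball I(2)[OF h] I(3)[OF h]])
      qed
      moreover have "(\<Prod>h\<in>I. X - \<Phi> (\<lambda>i. h i s)) = P X s" if "s \<in> ball t \<rho>" for s
        unfolding P_def by (rule prod.reindex_bij_betw[OF I(4)[OF that]])
      ultimately have "P X holomorphic_on ball t \<rho>" by (rule holomorphic_transform)
      then show ?thesis using \<rho> holomorphic_on_imp_differentiable_at[of "P X" "ball t \<rho>"] by auto
    qed
    then show ?thesis by (auto simp: holomorphic_on_def field_differentiable_at_within)
  qed
  have constP: "\<exists>c. \<forall>t. t \<notin> V \<longrightarrow> P X t = c" for X
  proof (rule bounded_holomorphic_cofinite_constant[OF finV holP])
    fix t assume "t \<notin> V"
    then have t: "regular_value p t" by (simp add: V_def)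
    \<comment> \<open>The summand 1 makes \<open>M\<close> at least 1, so the number of factors can
      be replaced by its uniform bound in the exponent.\<close>
    define M where "M = 1 + norm X + \<bar>C\<bar>"
    have "norm (P X t) = (\<Prod>y\<in>germ_tuples p R t. norm (X - \<Phi> y))" by (simp add: P_def prod_norm)
    also have "\<dots> \<le> (\<Prod>y\<in>germ_tuples p R t. M)"
    proof (rule prod_mono, intro conjI)
      fix y assume "y \<in> germ_tuples p R t"
      then have "norm (\<Phi> y) \<le> C" using bd[OF t] germ_tuplesD by blast
      then show "norm (X - \<Phi> y) \<le> M" using norm_triangle_ineq4[of X "\<Phi> y"] by (simp add: M_def)
    qed simp
    also have "\<dots> = M ^ card (germ_tuples p R t)" by simp
    also have "\<dots> \<le> M ^ (degree p ^ CARD('i))"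
      by (intro power_increasing germ_tuples_card(2)[OF deg]) (simp add: M_def)
    finally show "norm (P X t) \<le> (1 + norm X + \<bar>C\<bar>) ^ (degree p ^ CARD('i))" by (simp add: M_def)
  qed
  have transport: "\<exists>y\<in>germ_tuples p R t. \<Phi> y = X"
    if "regular_value p t0" "y0 \<in> germ_tuples p R t0" "\<Phi> y0 = X" "regular_value p t" for t0 y0 X t
  proof -
    have "P X t0 = 0" unfolding P_def using germ_tuples_card(1)[OF deg] that by (subst prod_zero_iff) auto
    then have "P X t = 0" using constP[of X] that by (auto simp: V_def)
    then show ?thesis unfolding P_def using germ_tuples_card(1)[OF deg] by (subst (asm) prod_zero_iff) auto
  qed
  have gT: "(\<lambda>i. g i s) \<in> germ_tuples p R s" if s: "s \<in> ball b r" for s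
  proof -
    obtain \<rho> where \<rho>: "\<rho> > 0" "ball s \<rho> \<subseteq> ball b r" using s open_contains_ball[of "ball b r"] by (meson open_ball)
    have "branch p (ball s \<rho>) (g i)" for i using g[of i] branch_subset[OF _ \<rho>(2)] by auto
    then show ?thesis unfolding germ_tuples_def using \<rho> ginj[OF s] gR
      by (intro CollectI conjI exI[of _ \<rho>] exI[of _ g]) auto
  qed
  have b: "b \<in> ball b r" using r by simp
  \<comment> \<open>Transport back to \<open>b\<close> confines the values of \<open>\<Phi>\<close>
    along \<open>g\<close> to a finite set, and a continuous function with finitely many values on a
    connected disc is constant.\<close>
  have "(\<lambda>s. \<Phi> (\<lambda>i. g i s)) ` ball b r \<subseteq> \<Phi> ` germ_tuples p R b"
  proof (rule image_subsetI)
    fix s assume s: "s \<in> ball b r"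
    show "\<Phi> (\<lambda>i. g i s) \<in> \<Phi> ` germ_tuples p R b"
      using transport[OF reg[OF s] gT[OF s] refl reg[OF b]] by (metis imageI)
  qed
  then have "finite ((\<lambda>s. \<Phi> (\<lambda>i. g i s)) ` ball b r)"
    using germ_tuples_card(1)[OF deg] by (meson finite_imageI finite_subset)
  moreover have "(\<lambda>s. \<Phi> (\<lambda>i. g i s)) holomorphic_on ball b r"
    by (rule holomorphic_relD[OF h\<Phi> open_ball g ginj])
  ultimately have "(\<lambda>s. \<Phi> (\<lambda>i. g i s)) constant_on ball b r"
    by (intro continuous_finite_range_constant holomorphic_on_imp_continuous_on) auto
  then obtain X where X: "\<And>s. s \<in> ball b r \<Longrightarrow> \<Phi> (\<lambda>i. g i s) = X" by (auto simp: constant_on_def)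
  have "\<exists>y. inj y \<and> (\<forall>i. poly p (y i) = t) \<and> R y = 0 \<and> \<Phi> y = X" if "regular_value p t" for t
    using transport[OF reg[OF b] gT[OF b] X[OF b] that] germ_tuplesD by (metis (no_types, lifting))
  with X show ?thesis by blast
qed

section \<open>Fibres near infinity and near a point\<close>

text \<open>With u = Y/X each difference a j (X^j - Y^j) contains the factor (1 - u) X^m, eventually
  nonzero because X and Y differ. After cancelling it, only the dominant exponent m survives in the
  limit. At infinity m is the degree, at a finite point the lowest exponent present.\<close>

lemma dominant_ratio:
  fixes X Y :: "nat \<Rightarrow> complex"
  assumes J: "finite J" "m \<in> J" and a: "a m \<noteq> 0"
    and X0: "\<forall>\<^sub>F n in sequentially. X n \<noteq> 0"
    and dom: "\<And>j. j \<in> J \<Longrightarrow> (\<lambda>n. X n ^ j / X n ^ m) \<longlonglongrightarrow> (if j = m then 1 else 0)"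
    and eq: "\<And>n. (\<Sum>j\<in>J. a j * X n ^ j) = (\<Sum>j\<in>J. a j * Y n ^ j)"
    and ne: "\<And>n. X n \<noteq> Y n" and lim: "(\<lambda>n. Y n / X n) \<longlonglongrightarrow> \<zeta>"
  shows "(\<Sum>k<m. \<zeta> ^ k) = 0"
proof -
  define u where "u = (\<lambda>n. Y n / X n)"
  have u: "u \<longlonglongrightarrow> \<zeta>" using lim by (simp add: u_def)
  have T: "(\<lambda>n. \<Sum>j\<in>J. a j * (X n ^ j / X n ^ m) * (\<Sum>k<j. u n ^ k))
      \<longlonglongrightarrow> (\<Sum>j\<in>J. a j * (if j = m then 1 else 0) * (\<Sum>k<j. \<zeta> ^ k))"
    by (intro tendsto_intros dom u)
  have V: "(\<Sum>j\<in>J. a j * (if j = m then 1 else 0) * (\<Sum>k<j. \<zeta> ^ k)) = a m * (\<Sum>k<m. \<zeta> ^ k)"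
  proof -
    have "(\<Sum>j\<in>J. a j * (if j = m then 1 else 0) * (\<Sum>k<j. \<zeta> ^ k)) = (\<Sum>j\<in>J. if j = m then a m * (\<Sum>k<m. \<zeta> ^ k) else 0)"
      by (intro sum.cong) auto
    then show ?thesis using J by simp
  qed
  have Z: "\<forall>\<^sub>F n in sequentially. (\<Sum>j\<in>J. a j * (X n ^ j / X n ^ m) * (\<Sum>k<j. u n ^ k)) = 0"
    using X0
  proof eventually_elim
    case (elim n)
    have Y: "Y n = u n * X n" using elim by (simp add: u_def)
    have u1: "1 - u n \<noteq> 0" using ne[of n] elim by (auto simp: u_def)
    have "a j * X n ^ j - a j * Y n ^ j = (1 - u n) * X n ^ m * (a j * (X n ^ j / X n ^ m) * (\<Sum>k<j. u n ^ k))" for j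
    proof -
      have "a j * X n ^ j - a j * Y n ^ j = a j * X n ^ j * (1 - u n ^ j)"
        by (simp add: Y power_mult_distrib algebra_simps)
      also have "\<dots> = a j * X n ^ j * ((1 - u n) * (\<Sum>k<j. u n ^ k))" by (simp add: one_diff_power_eq)
      finally show ?thesis using elim by simp
    qed
    then have "(\<Sum>j\<in>J. a j * X n ^ j - a j * Y n ^ j) =
        (1 - u n) * X n ^ m * (\<Sum>j\<in>J. a j * (X n ^ j / X n ^ m) * (\<Sum>k<j. u n ^ k))"
      by (simp add: sum_distrib_left)
    then show ?case using eq[of n] u1 elim by (simp add: sum_subtractf)
  qed
  have "a m * (\<Sum>k<m. \<zeta> ^ k) = 0"
    using LIMSEQ_unique[OF T tendsto_eventually[OF Z]] V by simp
  then show ?thesis using a by simp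
qed

text \<open>The common value divided by X^m and by Y^m tends to \<open>a m\<close> in both cases.
  The quotient of the two gives (Y/X)^m -> 1, and passing to moduli allows a real m-th root.\<close>

lemma dominant_norm:
  fixes X Y :: "nat \<Rightarrow> complex"
  assumes J: "finite J" "m \<in> J" and a: "a m \<noteq> 0" and m: "m > 0"
    and X0: "\<forall>\<^sub>F n in sequentially. X n \<noteq> 0" and Y0: "\<forall>\<^sub>F n in sequentially. Y n \<noteq> 0"
    and dX: "\<And>j. j \<in> J \<Longrightarrow> (\<lambda>n. X n ^ j / X n ^ m) \<longlonglongrightarrow> (if j = m then 1 else 0)"
    and dY: "\<And>j. j \<in> J \<Longrightarrow> (\<lambda>n. Y n ^ j / Y n ^ m) \<longlonglongrightarrow> (if j = m then 1 else 0)"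
    and eq: "\<And>n. (\<Sum>j\<in>J. a j * X n ^ j) = (\<Sum>j\<in>J. a j * Y n ^ j)"
  shows "(\<lambda>n. norm (Y n / X n)) \<longlonglongrightarrow> 1"
proof -
  have lim: "(\<lambda>n. (\<Sum>j\<in>J. a j * Z n ^ j) / Z n ^ m) \<longlonglongrightarrow> a m"
    if "\<And>j. j \<in> J \<Longrightarrow> (\<lambda>n. Z n ^ j / Z n ^ m) \<longlonglongrightarrow> (if j = m then 1 else 0)" for Z :: "nat \<Rightarrow> complex"
  proof -
    have "(\<lambda>n. \<Sum>j\<in>J. a j * (Z n ^ j / Z n ^ m)) \<longlonglongrightarrow> (\<Sum>j\<in>J. a j * (if j = m then 1 else 0))"
      by (intro tendsto_intros that)
    moreover have "(\<Sum>j\<in>J. a j * (if j = m then 1 else 0)) = (\<Sum>j\<in>J. if j = m then a m else 0)"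
      by (intro sum.cong) auto
    ultimately show ?thesis using J by (simp add: sum_divide_distrib)
  qed
  define S where "S n = (\<Sum>j\<in>J. a j * X n ^ j)" for n
  have SX: "(\<lambda>n. S n / X n ^ m) \<longlonglongrightarrow> a m" using lim[OF dX] by (simp add: S_def)
  have SY: "(\<lambda>n. S n / Y n ^ m) \<longlonglongrightarrow> a m" using lim[OF dY] eq by (simp add: S_def)
  have "(\<lambda>n. (S n / X n ^ m) / (S n / Y n ^ m)) \<longlonglongrightarrow> a m / a m"
    by (intro tendsto_divide SX SY a)
  moreover have "\<forall>\<^sub>F n in sequentially. S n / X n ^ m \<noteq> 0"
    using tendsto_imp_eventually_ne[OF SX a] .
  then have "\<forall>\<^sub>F n in sequentially. (S n / X n ^ m) / (S n / Y n ^ m) = (Y n / X n) ^ m"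
    using X0 Y0 by eventually_elim (simp add: field_simps)
  ultimately have "(\<lambda>n. (Y n / X n) ^ m) \<longlonglongrightarrow> 1"
    using a by (simp add: tendsto_cong)
  then have "(\<lambda>n. norm (Y n / X n) ^ m) \<longlonglongrightarrow> 1"
    using tendsto_norm by (fastforce simp: norm_power)
  then have "(\<lambda>n. root m (norm (Y n / X n) ^ m)) \<longlonglongrightarrow> root m 1"
    by (rule tendsto_real_root)
  then show ?thesis using m by (simp add: real_root_power_cancel)
qed

lemma sum_powers_eq_0:
  fixes \<zeta> :: complex
  assumes "(\<Sum>k<m. \<zeta> ^ k) = 0" "m > 0"
  shows "\<zeta> ^ m = 1" "\<zeta> \<noteq> 1" "norm \<zeta> = 1"
proof -
  have "1 - \<zeta> ^ m = 0" using assms(1) by (simp add: one_diff_power_eq)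
  then show *: "\<zeta> ^ m = 1" by simp
  show "\<zeta> \<noteq> 1" using assms by auto
  show "norm \<zeta> = 1" using * assms(2) by (metis norm_one norm_power power_eq_1_iff norm_ge_zero neq0_conv)
qed

lemma power_quotient_at_infinity:
  fixes X :: "nat \<Rightarrow> complex"
  assumes "filterlim X at_infinity sequentially" "j \<le> m"
  shows "(\<lambda>n. X n ^ j / X n ^ m) \<longlonglongrightarrow> (if j = m then 1 else 0)"
proof -
  have "(\<lambda>n. inverse (X n)) \<longlonglongrightarrow> 0" using assms(1) tendsto_inverse_0 filterlim_compose by blast
  then have "(\<lambda>n. inverse (X n) ^ (m - j)) \<longlonglongrightarrow> 0 ^ (m - j)" by (intro tendsto_intros)
  moreover have "\<forall>\<^sub>F n in sequentially. X n \<noteq> 0"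
    using assms(1) by (metis filterlim_at_infinity_imp_eventually_ne)
  then have "\<forall>\<^sub>F n in sequentially. inverse (X n) ^ (m - j) = X n ^ j / X n ^ m"
    by eventually_elim (use assms(2) in \<open>simp add: power_diff field_simps\<close>)
  ultimately have "(\<lambda>n. X n ^ j / X n ^ m) \<longlonglongrightarrow> 0 ^ (m - j)" by (simp add: tendsto_cong)
  then show ?thesis using assms(2) by (cases "j = m") (auto simp: power_0_left)
qed

lemma power_quotient_at_0:
  fixes X :: "nat \<Rightarrow> complex"
  assumes "X \<longlonglongrightarrow> 0" "\<forall>\<^sub>F n in sequentially. X n \<noteq> 0" "m \<le> j"
  shows "(\<lambda>n. X n ^ j / X n ^ m) \<longlonglongrightarrow> (if j = m then 1 else 0)"
proof -
  have "(\<lambda>n. X n ^ (j - m)) \<longlonglongrightarrow> 0 ^ (j - m)" using assms(1) by (intro tendsto_intros)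
  moreover have "\<forall>\<^sub>F n in sequentially. X n ^ (j - m) = X n ^ j / X n ^ m"
    using assms(2) by eventually_elim (use assms(3) in \<open>simp add: power_diff\<close>)
  ultimately have "(\<lambda>n. X n ^ j / X n ^ m) \<longlonglongrightarrow> 0 ^ (j - m)" by (simp add: tendsto_cong)
  then show ?thesis using assms(3) by (cases "j = m") (auto simp: power_0_left)
qed

lemma poly_bounded_on_cball:
  fixes p :: "complex poly"
  obtains M where "\<And>z. cmod z \<le> B \<Longrightarrow> cmod (poly p z) \<le> M"
proof -
  have "bounded (poly p ` cball 0 B)"
    by (intro compact_imp_bounded compact_continuous_image continuous_intros compact_cball)
  then obtain M where "\<forall>w\<in>poly p ` cball 0 B. cmod w \<le> M" unfolding bounded_iff by blast
  then show ?thesis by (intro that[of M]) simp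
qed

lemma poly_at_infinity_imp:
  fixes p :: "complex poly"
  assumes "filterlim (\<lambda>n. poly p (x n)) at_infinity F"
  shows "filterlim x at_infinity F"
  unfolding filterlim_at_infinity[OF order_refl]
proof (intro allI impI)
  fix B :: real assume "B > 0"
  obtain M where M: "\<And>z. cmod z \<le> B \<Longrightarrow> cmod (poly p z) \<le> M" by (rule poly_bounded_on_cball) blast
  have "\<forall>\<^sub>F n in F. norm (poly p (x n)) \<ge> \<bar>M\<bar> + 1"
    using assms[unfolded filterlim_at_infinity[OF order_refl]] by simp
  then show "\<forall>\<^sub>F n in F. B \<le> norm (x n)"
  proof eventually_elim
    case (elim n)
    then have "\<not> norm (poly p (x n)) \<le> M" by auto
    then show ?case using M[of "x n"] by linarith
  qed
qed

lemma poly_unbounded_preimage: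
  fixes p :: "complex poly"
  assumes deg: "degree p > 0" and x: "filterlim x at_infinity F"
    and eq: "\<And>n. poly p (x n) = poly p (y n)"
  shows "filterlim y at_infinity F"
  using filterlim_compose[OF filterlim_poly_at_infinity[OF deg] x] poly_at_infinity_imp[of p y F] by (simp add: eq)

text \<open>The barycentre of every fibre: translating it to 0 removes the subleading coefficient.\<close>

definition poly_center :: "complex poly \<Rightarrow> complex" where
  "poly_center p = - poly.coeff p (degree p - 1) / (of_nat (degree p) * lead_coeff p)"

definition shift_poly :: "complex \<Rightarrow> complex poly \<Rightarrow> complex poly" where
  "shift_poly c p = pcompose p [:c, 1:]"

lemma poly_shift_poly [simp]: "poly (shift_poly c p) z = poly p (c + z)"
  by (simp add: shift_poly_def poly_pcompose)

lemma degree_shift_poly [simp]: "degree (shift_poly c p) = degree p"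
  by (simp add: shift_poly_def degree_pcompose)

lemma coeff_linear_power:
  "poly.coeff ([:c, 1:] ^ n) i = of_nat (n choose i) * c ^ (n - i)" for c :: complex
  by (cases "i \<le> n") (auto simp: coeff_linear_poly_power coeff_eq_0 degree_linear_power binomial_eq_0)

lemma coeff_shift_poly_center:
  assumes "degree p > 0"
  shows "poly.coeff (shift_poly (poly_center p) p) (degree p - 1) = 0"
proof -
  let ?c = "poly_center p" and ?d = "degree p"
  have "shift_poly ?c p = (\<Sum>i\<le>?d. Polynomial.smult (poly.coeff p i) ([:?c, 1:] ^ i))"
    unfolding poly_eq_poly_eq_iff[symmetric] by (auto simp: fun_eq_iff poly_sum poly_altdef[of p])
  then have "poly.coeff (shift_poly ?c p) (?d - 1) = (\<Sum>i\<le>?d. poly.coeff p i * (of_nat (i choose (?d - 1)) * ?c ^ (i - (?d - 1))))"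
    by (simp add: coeff_sum coeff_linear_power)
  also have "\<dots> = (\<Sum>i\<in>{?d - 1, ?d}. poly.coeff p i * (of_nat (i choose (?d - 1)) * ?c ^ (i - (?d - 1))))"
    by (rule sum.mono_neutral_right) (auto simp: binomial_eq_0)
  also have "\<dots> = poly.coeff p (?d - 1) + poly.coeff p ?d * (of_nat ?d * ?c)"
    using assms binomial_symmetric[of "?d - 1" "?d"] by simp
  also have "\<dots> = 0" using assms by (auto simp: poly_center_def field_simps)
  finally show ?thesis .
qed

lemma filterlim_shift_at_infinity:
  fixes x :: "nat \<Rightarrow> complex"
  assumes "filterlim x at_infinity F"
  shows "filterlim (\<lambda>n. x n - c) at_infinity F"
  using tendsto_add_filterlim_at_infinity[OF tendsto_const[of "-c"] assms] by simp

text \<open>The centre \<open>c\<close> is arbitrary: to first order the behaviour at infinity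
  depends only on the leading term. The barycentre matters for the next order, in
  \<open>fibre_linear_at_infinity\<close>.\<close>

lemma
  fixes p :: "complex poly" and x y :: "nat \<Rightarrow> complex"
  assumes deg: "degree p > 0" and x: "filterlim x at_infinity sequentially"
    and eq: "\<And>n. poly p (x n) = poly p (y n)"
  shows fibre_norm_ratio_at_infinity: "(\<lambda>n. norm ((y n - c) / (x n - c))) \<longlonglongrightarrow> 1"
    and fibre_ratio_at_infinity:
      "(\<And>n. x n \<noteq> y n) \<Longrightarrow> (\<lambda>n. (y n - c) / (x n - c)) \<longlonglongrightarrow> \<zeta> \<Longrightarrow> (\<Sum>k<degree p. \<zeta> ^ k) = 0"
proof -
  define q where "q = shift_poly c p"
  define X Y where "X n = x n - c" and "Y n = y n - c" for n
  have X: "filterlim X at_infinity sequentially" unfolding X_def by (rule filterlim_shift_at_infinity[OF x])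
  have Y: "filterlim Y at_infinity sequentially"
    unfolding Y_def by (intro filterlim_shift_at_infinity poly_unbounded_preimage[OF deg x eq])
  have q: "degree q = degree p" "poly.coeff q (degree p) \<noteq> 0"
  proof -
    show "degree q = degree p" by (simp add: q_def)
    then show "poly.coeff q (degree p) \<noteq> 0"
      using deg by (metis degree_0 leading_coeff_0_iff less_numeral_extra(3))
  qed
  have "(\<Sum>j\<in>{..degree p}. poly.coeff q j * X n ^ j) = poly p (x n)"
    "(\<Sum>j\<in>{..degree p}. poly.coeff q j * Y n ^ j) = poly p (y n)" for n
    using poly_altdef[of q "X n"] poly_altdef[of q "Y n"] by (auto simp: q_def X_def Y_def)
  then have e: "(\<Sum>j\<in>{..degree p}. poly.coeff q j * X n ^ j) = (\<Sum>j\<in>{..degree p}. poly.coeff q j * Y n ^ j)" for n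
    using eq by simp
  have X0: "\<forall>\<^sub>F n in sequentially. X n \<noteq> 0" using X by (metis filterlim_at_infinity_imp_eventually_ne)
  have Y0: "\<forall>\<^sub>F n in sequentially. Y n \<noteq> 0" using Y by (metis filterlim_at_infinity_imp_eventually_ne)
  have "(\<lambda>n. norm (Y n / X n)) \<longlonglongrightarrow> 1"
    by (rule dominant_norm[where a = "poly.coeff q" and J = "{..degree p}" and m = "degree p"])
      (use q deg X0 Y0 e power_quotient_at_infinity[OF X] power_quotient_at_infinity[OF Y] in auto)
  then show "(\<lambda>n. norm ((y n - c) / (x n - c))) \<longlonglongrightarrow> 1" by (simp add: X_def Y_def)
  assume "\<And>n. x n \<noteq> y n" "(\<lambda>n. (y n - c) / (x n - c)) \<longlonglongrightarrow> \<zeta>"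
  then show "(\<Sum>k<degree p. \<zeta> ^ k) = 0"
    by (intro dominant_ratio[where a = "poly.coeff q" and J = "{..degree p}" and X = X and Y = Y])
      (use q deg X0 e power_quotient_at_infinity[OF X] in \<open>auto simp: X_def Y_def\<close>)
qed

text \<open>The dominant exponent is now the local degree of p at c, the least positive exponent of
  the expansion there. The constant term is dropped, since it cancels from p(x) = p(y).\<close>

lemma
  fixes p :: "complex poly" and x y :: "nat \<Rightarrow> complex"
  assumes deg: "degree p > 0" and x: "x \<longlonglongrightarrow> c" "\<And>n. x n \<noteq> c" and y: "y \<longlonglongrightarrow> c" "\<And>n. y n \<noteq> c"
    and eq: "\<And>n. poly p (x n) = poly p (y n)"
  shows fibre_norm_ratio_local: "(\<lambda>n. norm ((y n - c) / (x n - c))) \<longlonglongrightarrow> 1"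
    and fibre_ratio_local:
      "(\<And>n. x n \<noteq> y n) \<Longrightarrow> (\<lambda>n. (y n - c) / (x n - c)) \<longlonglongrightarrow> \<omega> \<Longrightarrow> \<omega> \<noteq> 1 \<and> norm \<omega> = 1"
proof -
  define q where "q = shift_poly c p"
  define X Y where "X n = x n - c" and "Y n = y n - c" for n
  have X: "X \<longlonglongrightarrow> 0" "\<And>n. X n \<noteq> 0" using x LIM_zero[OF x(1)] by (auto simp: X_def[abs_def])
  have Y: "Y \<longlonglongrightarrow> 0" "\<And>n. Y n \<noteq> 0" using y LIM_zero[OF y(1)] by (auto simp: Y_def[abs_def])
  define J where "J = {j\<in>{1..degree p}. poly.coeff q j \<noteq> 0}"
  have q: "degree q = degree p" by (simp add: q_def)
  then have "degree p \<in> J" using deg by (auto simp: J_def) (metis degree_0 leading_coeff_0_iff less_numeral_extra(3))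
  then have Jne: "J \<noteq> {}" "finite J" by (auto simp: J_def)
  define m where "m = Min J"
  have m: "m \<in> J" "\<And>j. j \<in> J \<Longrightarrow> m \<le> j" using Jne by (auto simp: m_def)
  have m0: "m > 0" "poly.coeff q m \<noteq> 0" using m(1) by (auto simp: J_def)
  have S: "(\<Sum>j\<in>J. poly.coeff q j * z ^ j) = poly p (c + z) - poly.coeff q 0" for z
  proof -
    have "poly p (c + z) = (\<Sum>j\<le>degree p. poly.coeff q j * z ^ j)"
      using poly_altdef[of q z] by (simp add: q_def)
    also have "\<dots> = (\<Sum>j\<in>insert 0 J. poly.coeff q j * z ^ j)"
      by (rule sum.mono_neutral_right) (auto simp: J_def)
    also have "\<dots> = poly.coeff q 0 + (\<Sum>j\<in>J. poly.coeff q j * z ^ j)"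
      using Jne by (subst sum.insert) (auto simp: J_def)
    finally show ?thesis by simp
  qed
  have e: "(\<Sum>j\<in>J. poly.coeff q j * X n ^ j) = (\<Sum>j\<in>J. poly.coeff q j * Y n ^ j)" for n
    using eq by (simp add: S X_def Y_def)
  have dX: "(\<lambda>n. X n ^ j / X n ^ m) \<longlonglongrightarrow> (if j = m then 1 else 0)" if "j \<in> J" for j
    by (rule power_quotient_at_0[OF X(1) _ m(2)[OF that]]) (use X in auto)
  have dY: "(\<lambda>n. Y n ^ j / Y n ^ m) \<longlonglongrightarrow> (if j = m then 1 else 0)" if "j \<in> J" for j
    by (rule power_quotient_at_0[OF Y(1) _ m(2)[OF that]]) (use Y in auto)
  have "(\<lambda>n. norm (Y n / X n)) \<longlonglongrightarrow> 1"
    by (rule dominant_norm[where a = "poly.coeff q" and J = J and m = m])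
      (use m m0 Jne X Y e dX dY in auto)
  then show "(\<lambda>n. norm ((y n - c) / (x n - c))) \<longlonglongrightarrow> 1" by (simp add: X_def Y_def)
  assume "\<And>n. x n \<noteq> y n" "(\<lambda>n. (y n - c) / (x n - c)) \<longlonglongrightarrow> \<omega>"
  then have "(\<Sum>k<m. \<omega> ^ k) = 0"
    by (intro dominant_ratio[where a = "poly.coeff q" and J = J and X = X and Y = Y])
      (use m m0 Jne X e dX in \<open>auto simp: X_def Y_def\<close>)
  then show "\<omega> \<noteq> 1 \<and> norm \<omega> = 1" using sum_powers_eq_0 m0(1) by blast
qed

text \<open>Isolating the leading terms of p(x) = p(y) expresses Y - \<zeta> X, up to a factor with
  nonzero limit, as a sum over j < d of terms X^(j+1) / X^d with bounded factors. Only j = d - 1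
  fails to decay, and centring at the barycentre makes its coefficient zero.\<close>

lemma fibre_linear_at_infinity:
  fixes p :: "complex poly" and x y :: "nat \<Rightarrow> complex"
  assumes deg: "degree p > 0" and x: "filterlim x at_infinity sequentially"
    and eq: "\<And>n. poly p (x n) = poly p (y n)"
    and c: "c = poly_center p" and lim: "(\<lambda>n. (y n - c) / (x n - c)) \<longlonglongrightarrow> \<zeta>" and \<zeta>: "\<zeta> ^ degree p = 1"
  shows "(\<lambda>n. (y n - c) - \<zeta> * (x n - c)) \<longlonglongrightarrow> 0"
proof -
  let ?d = "degree p"
  define q where "q = shift_poly c p"
  define X Y where "X n = x n - c" and "Y n = y n - c" for n
  define u where "u n = Y n / X n" for n
  have X: "filterlim X at_infinity sequentially" unfolding X_def by (rule filterlim_shift_at_infinity[OF x])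
  have X0: "\<forall>\<^sub>F n in sequentially. X n \<noteq> 0" using X by (metis filterlim_at_infinity_imp_eventually_ne)
  have q: "degree q = ?d" by (simp add: q_def)
  then have ad: "poly.coeff q ?d \<noteq> 0" using deg by (metis degree_0 leading_coeff_0_iff less_numeral_extra(3))
  have cd: "poly.coeff q (?d - 1) = 0" using coeff_shift_poly_center[OF deg] by (simp add: q_def c)
  have u: "u \<longlonglongrightarrow> \<zeta>" using lim by (simp add: u_def[abs_def] X_def Y_def)
  \<comment> \<open>\<open>W n\<close> is the quotient of u^d - \<zeta>^d by u - \<zeta>; its limit
    is the derivative d \<zeta>^(d-1), which is nonzero.\<close>
  define W where "W n = (\<Sum>i<?d. \<zeta> ^ (?d - Suc i) * u n ^ i)" for n
  have "W \<longlonglongrightarrow> (\<Sum>i<?d. \<zeta> ^ (?d - Suc i) * \<zeta> ^ i)" unfolding W_def by (intro tendsto_intros u)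
  moreover have "(\<Sum>i<?d. \<zeta> ^ (?d - Suc i) * \<zeta> ^ i) = (\<Sum>i<?d. \<zeta> ^ (?d - 1))"
    by (intro sum.cong) (auto simp: power_add[symmetric])
  ultimately have W: "W \<longlonglongrightarrow> of_nat ?d * \<zeta> ^ (?d - 1)" by simp
  have \<zeta>0: "\<zeta> \<noteq> 0" using \<zeta> deg by (metis power_0_left less_numeral_extra(3) zero_neq_one)
  then have W0: "of_nat ?d * \<zeta> ^ (?d - 1) \<noteq> 0" using deg by simp
  have "(\<lambda>n. \<Sum>j<?d. poly.coeff q j * (X n ^ Suc j / X n ^ ?d) * (1 - u n ^ j))
      \<longlonglongrightarrow> (\<Sum>j<?d. poly.coeff q j * (if Suc j = ?d then 1 else 0) * (1 - \<zeta> ^ j))"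
    by (intro tendsto_intros u power_quotient_at_infinity[OF X]) auto
  moreover have "(\<Sum>j<?d. poly.coeff q j * (if Suc j = ?d then 1 else 0) * (1 - \<zeta> ^ j)) = 0"
  proof (intro sum.neutral ballI)
    fix j show "poly.coeff q j * (if Suc j = ?d then 1 else 0) * (1 - \<zeta> ^ j) = 0"
      using cd by (metis diff_Suc_1 mult_zero_left mult_zero_right)
  qed
  ultimately have "(\<lambda>n. (\<Sum>j<?d. poly.coeff q j * (X n ^ Suc j / X n ^ ?d) * (1 - u n ^ j)) / (poly.coeff q ?d * W n)) \<longlonglongrightarrow> 0 / (poly.coeff q ?d * (of_nat ?d * \<zeta> ^ (?d - 1)))"
    using ad W0 by (intro tendsto_intros W) auto
  moreover have "\<forall>\<^sub>F n in sequentially. (\<Sum>j<?d. poly.coeff q j * (X n ^ Suc j / X n ^ ?d) * (1 - u n ^ j)) / (poly.coeff q ?d * W n) = Y n - \<zeta> * X n"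
    using X0 tendsto_imp_eventually_ne[OF W W0]
  proof eventually_elim
    case (elim n)
    have Y: "Y n = u n * X n" using elim by (simp add: u_def)
    have "poly q (X n) = poly q (Y n)" using eq[of n] by (simp add: q_def X_def Y_def)
    then have "(\<Sum>j\<le>?d. poly.coeff q j * X n ^ j - poly.coeff q j * Y n ^ j) = 0"
      using q by (simp add: poly_altdef sum_subtractf)
    then have "(\<Sum>j<?d. poly.coeff q j * X n ^ j * (1 - u n ^ j)) = poly.coeff q ?d * X n ^ ?d * (u n ^ ?d - 1)"
      by (simp add: Y power_mult_distrib lessThan_Suc_atMost[symmetric] algebra_simps)
    moreover have "(\<Sum>j<?d. poly.coeff q j * (X n ^ Suc j / X n ^ ?d) * (1 - u n ^ j)) = (\<Sum>j<?d. poly.coeff q j * X n ^ j * (1 - u n ^ j)) * (X n / X n ^ ?d)"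
      unfolding sum_distrib_right by (intro sum.cong) (simp_all add: field_simps)
    ultimately have "(\<Sum>j<?d. poly.coeff q j * (X n ^ Suc j / X n ^ ?d) * (1 - u n ^ j)) = poly.coeff q ?d * X n * (u n ^ ?d - \<zeta> ^ ?d)"
      using elim \<zeta> by simp
    also have "\<dots> = poly.coeff q ?d * X n * ((u n - \<zeta>) * W n)"
      unfolding W_def power_diff_sumr2 ..
    also have "\<dots> = (Y n - \<zeta> * X n) * (poly.coeff q ?d * W n)" by (simp add: Y algebra_simps)
    finally show ?case using elim ad by simp
  qed
  ultimately have "(\<lambda>n. Y n - \<zeta> * X n) \<longlonglongrightarrow> 0" by (simp add: tendsto_cong)
  then show ?thesis by (simp add: X_def Y_def)
qed

section \<open>Subsequences along which the directions of a tuple converge\<close>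

lemma finite_index_subsequence:
  fixes u :: "nat \<Rightarrow> 'i::finite \<Rightarrow> complex"
  assumes "\<And>n i. norm (u n i) \<le> B"
  obtains \<phi> l where "strict_mono (\<phi> :: nat \<Rightarrow> nat)" "\<And>i. (\<lambda>n. u (\<phi> n) i) \<longlonglongrightarrow> l i"
proof -
  define v :: "nat \<Rightarrow> complex ^ 'i" where "v n = (\<chi> i. u n i)" for n
  have "norm (v n) \<le> of_nat CARD('i) * B" for n
  proof -
    have "norm (v n) \<le> (\<Sum>i\<in>UNIV. norm (v n $ i))" unfolding norm_vec_def by (rule L2_set_le_sum) simp
    also have "\<dots> \<le> (\<Sum>i\<in>(UNIV::'i set). B)" using assms by (intro sum_mono) (simp add: v_def)
    finally show ?thesis by simp
  qed
  then have "bounded (range v)" by (auto simp: bounded_iff)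
  then obtain l \<phi> where "strict_mono \<phi>" "(v \<circ> \<phi>) \<longlonglongrightarrow> l"
    using bounded_imp_convergent_subsequence by blast
  then have "(\<lambda>n. (v \<circ> \<phi>) n $ i) \<longlonglongrightarrow> l $ i" for i by (intro tendsto_vec_nth)
  then show ?thesis using that[of \<phi> "\<lambda>i. l $ i"] \<open>strict_mono \<phi>\<close> by (simp add: v_def)
qed

text \<open>Equal limits at two indices would make their mutual ratio tend to 1, which
  \<open>dist\<close> rules out. That hypothesis ranges over all subsequences because the extracted
  one is not known beforehand. The lemma serves both at infinity and at a collision point.\<close>

lemma ratio_subsequence:
  fixes y :: "nat \<Rightarrow> 'i::finite \<Rightarrow> complex"
  assumes k: "k \<in> J" and ne: "\<And>i. i \<in> J \<Longrightarrow> \<forall>\<^sub>F n in sequentially. y n i \<noteq> c"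
    and nr: "\<And>i. i \<in> J \<Longrightarrow> (\<lambda>n. norm ((y n i - c) / (y n k - c))) \<longlonglongrightarrow> 1"
    and dist: "\<And>i j \<phi> \<omega>. i \<in> J \<Longrightarrow> j \<in> J \<Longrightarrow> i \<noteq> j \<Longrightarrow> strict_mono \<phi> \<Longrightarrow>
      (\<lambda>n. (y (\<phi> n) j - c) / (y (\<phi> n) i - c)) \<longlonglongrightarrow> \<omega> \<Longrightarrow> \<omega> \<noteq> 1"
  obtains \<phi> \<omega> where "strict_mono (\<phi> :: nat \<Rightarrow> nat)" "inj_on \<omega> J" "\<omega> k = 1" "\<And>i. i \<in> J \<Longrightarrow> norm (\<omega> i) = 1"
    "\<And>i. i \<in> J \<Longrightarrow> (\<lambda>n. (y (\<phi> n) i - c) / (y (\<phi> n) k - c)) \<longlonglongrightarrow> \<omega> i"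
proof -
  \<comment> \<open>The value 0 outside \<open>J\<close> keeps the family bounded on the whole index
    type; limits at those indices are ignored.\<close>
  define u where "u n i = (if i \<in> J then (y n i - c) / (y n k - c) else 0)" for n i
  have "\<exists>B. \<forall>n. norm (u n i) \<le> B" for i
  proof (cases "i \<in> J")
    case True
    then have "Bseq (\<lambda>n. norm ((y n i - c) / (y n k - c)))"
      using nr convergent_imp_Bseq convergentI by blast
    then show ?thesis using True by (auto simp: Bseq_def u_def)
  qed (auto simp: u_def)
  then obtain B where B: "\<And>i n. norm (u n i) \<le> B i" by metis
  have bd: "norm (u n i) \<le> Max (range B)" for n i
    using B[of n i] Max_ge[of "range B" "B i"] by (simp add: order_trans)
  obtain \<phi> \<omega> where \<phi>: "strict_mono (\<phi> :: nat \<Rightarrow> nat)" and \<omega>: "\<And>i. (\<lambda>n. u (\<phi> n) i) \<longlonglongrightarrow> \<omega> i"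
    using finite_index_subsequence[of u, OF bd] by blast
  have sub: "filterlim \<phi> sequentially sequentially" using \<phi> by (rule filterlim_subseq)
  have lim: "(\<lambda>n. (y (\<phi> n) i - c) / (y (\<phi> n) k - c)) \<longlonglongrightarrow> \<omega> i" if "i \<in> J" for i
    using \<omega>[of i] that by (simp add: u_def)
  have norm1: "norm (\<omega> i) = 1" if "i \<in> J" for i
    using LIMSEQ_unique[OF tendsto_norm[OF lim[OF that]] filterlim_compose[OF nr[OF that] sub]] .
  have "\<forall>\<^sub>F n in sequentially. (y (\<phi> n) k - c) / (y (\<phi> n) k - c) = 1"
    using eventually_compose_filterlim[OF ne[OF k] sub] by eventually_elim auto
  then have \<omega>k: "\<omega> k = 1" using LIMSEQ_unique[OF lim[OF k] tendsto_eventually] by blast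
  have "inj_on \<omega> J"
  proof (rule inj_onI, rule ccontr)
    fix i j assume ij: "i \<in> J" "j \<in> J" "\<omega> i = \<omega> j" "i \<noteq> j"
    have i0: "\<omega> i \<noteq> 0" using norm1[OF ij(1)] by auto
    have "(\<lambda>n. ((y (\<phi> n) j - c) / (y (\<phi> n) k - c)) / ((y (\<phi> n) i - c) / (y (\<phi> n) k - c))) \<longlonglongrightarrow> \<omega> j / \<omega> i"
      by (intro tendsto_divide lim ij i0)
    moreover have "\<forall>\<^sub>F n in sequentially. ((y (\<phi> n) j - c) / (y (\<phi> n) k - c)) / ((y (\<phi> n) i - c) / (y (\<phi> n) k - c))
        = (y (\<phi> n) j - c) / (y (\<phi> n) i - c)"
      using eventually_compose_filterlim[OF ne[OF k] sub] by eventually_elim auto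
    ultimately have "(\<lambda>n. (y (\<phi> n) j - c) / (y (\<phi> n) i - c)) \<longlonglongrightarrow> \<omega> j / \<omega> i"
      by (rule Lim_transform_eventually)
    then have "\<omega> j / \<omega> i \<noteq> 1" using dist[OF ij(1,2,4) \<phi>] by blast
    then show False using ij(3) i0 by simp
  qed
  with \<phi> \<omega>k norm1 lim show ?thesis using that by blast
qed

lemma tuple_limit_at_infinity:
  fixes y :: "nat \<Rightarrow> 'i::finite \<Rightarrow> complex"
  assumes deg: "degree p > 0" and inj: "\<And>n. inj (y n)" and eq: "\<And>n i j. poly p (y n i) = poly p (y n j)"
    and inf: "filterlim (\<lambda>n. y n k) at_infinity sequentially"
  obtains \<phi> \<zeta> where "strict_mono (\<phi> :: nat \<Rightarrow> nat)" "inj \<zeta>" "\<zeta> k = 1" "\<And>i. norm (\<zeta> i) = 1"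
    "\<And>i. \<zeta> i ^ degree p = 1"
    "\<And>i. (\<lambda>n. (y (\<phi> n) i - c) / (y (\<phi> n) k - c)) \<longlonglongrightarrow> \<zeta> i"
proof -
  have infi: "filterlim (\<lambda>n. y n i) at_infinity sequentially" for i
    by (rule poly_unbounded_preimage[OF deg inf eq])
  have *: "(\<Sum>k<degree p. \<omega> ^ k) = 0"
    if "i \<noteq> j" "strict_mono \<phi>" "(\<lambda>n. (y (\<phi> n) j - c) / (y (\<phi> n) i - c)) \<longlonglongrightarrow> \<omega>" for i j \<phi> \<omega>
  proof (rule fibre_ratio_at_infinity[OF deg _ _ _ that(3)])
    show "filterlim (\<lambda>n. y (\<phi> n) i) at_infinity sequentially"
      using filterlim_compose[OF infi filterlim_subseq[OF that(2)]] .
    show "y (\<phi> n) i \<noteq> y (\<phi> n) j" for n using inj[of "\<phi> n"] that(1) by (auto dest: injD)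
  qed (rule eq)
  obtain \<phi> \<zeta> where \<phi>: "strict_mono (\<phi> :: nat \<Rightarrow> nat)" "inj \<zeta>" "\<zeta> k = 1" "\<And>i. norm (\<zeta> i) = 1"
    "\<And>i. (\<lambda>n. (y (\<phi> n) i - c) / (y (\<phi> n) k - c)) \<longlonglongrightarrow> \<zeta> i"
  proof (rule ratio_subsequence[where J = UNIV and k = k and y = y and c = c])
    show "\<forall>\<^sub>F n in sequentially. y n i \<noteq> c" for i
      using infi by (metis filterlim_at_infinity_imp_eventually_ne)
    show "(\<lambda>n. norm ((y n i - c) / (y n k - c))) \<longlonglongrightarrow> 1" for i
      by (rule fibre_norm_ratio_at_infinity[OF deg inf eq])
    show "\<omega> \<noteq> 1" if "i \<noteq> j" "strict_mono \<phi>" "(\<lambda>n. (y (\<phi> n) j - c) / (y (\<phi> n) i - c)) \<longlonglongrightarrow> \<omega>" for i j \<phi> \<omega>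
      using *[OF that] sum_powers_eq_0(2) deg by blast
  qed (use that in auto)
  have "\<zeta> i ^ degree p = 1" for i
    using *[of k i \<phi> "\<zeta> i"] \<phi>(1,5) sum_powers_eq_0(1) deg \<phi>(3) by (cases "i = k") auto
  with \<phi> show ?thesis using that by blast
qed

text \<open>\<open>J\<close> collects the entries that collide at \<open>c\<close>; the remaining
  ones may stay away from it.\<close>

lemma tuple_limit_local:
  fixes y :: "nat \<Rightarrow> 'i::finite \<Rightarrow> complex"
  assumes deg: "degree p > 0" and inj: "\<And>n. inj (y n)" and eq: "\<And>n i j. poly p (y n i) = poly p (y n j)"
    and k: "k \<in> J" and lim: "\<And>i. i \<in> J \<Longrightarrow> (\<lambda>n. y n i) \<longlonglongrightarrow> c" and ne: "\<And>n i. y n i \<noteq> c"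
  obtains \<phi> \<omega> where "strict_mono (\<phi> :: nat \<Rightarrow> nat)" "inj_on \<omega> J" "\<omega> k = 1" "\<And>i. i \<in> J \<Longrightarrow> norm (\<omega> i) = 1"
    "\<And>i. i \<in> J \<Longrightarrow> (\<lambda>n. (y (\<phi> n) i - c) / (y (\<phi> n) k - c)) \<longlonglongrightarrow> \<omega> i"
proof (rule ratio_subsequence[where J = J and k = k and y = y and c = c])
  show "\<forall>\<^sub>F n in sequentially. y n i \<noteq> c" for i using ne by simp
  show "(\<lambda>n. norm ((y n i - c) / (y n k - c))) \<longlonglongrightarrow> 1" if "i \<in> J" for i
    by (rule fibre_norm_ratio_local[OF deg lim[OF k] ne lim[OF that] ne eq])
  show "\<omega> \<noteq> 1" if "i \<in> J" "j \<in> J" "i \<noteq> j" "strict_mono \<phi>"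
    "(\<lambda>n. (y (\<phi> n) j - c) / (y (\<phi> n) i - c)) \<longlonglongrightarrow> \<omega>" for i j \<phi> \<omega>
  proof -
    have "\<omega> \<noteq> 1 \<and> norm \<omega> = 1"
    proof (rule fibre_ratio_local[OF deg _ _ _ _ _ _ that(5)])
      show "(\<lambda>n. y (\<phi> n) i) \<longlonglongrightarrow> c" "(\<lambda>n. y (\<phi> n) j) \<longlonglongrightarrow> c"
        using filterlim_compose[OF lim filterlim_subseq[OF that(4)]] that by auto
      show "y (\<phi> n) i \<noteq> y (\<phi> n) j" for n using inj[of "\<phi> n"] that(3) by (auto dest: injD)
    qed (use ne eq in auto)
    then show ?thesis by simp
  qed
qed (use k that in auto)

section \<open>Relations among three and four branches\<close>

lemma fibre_bounded:
  fixes p :: "complex poly"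
  assumes deg: "degree p > 0"
  shows "\<exists>M. \<forall>x x'. norm x \<le> B \<and> poly p x = poly p x' \<longrightarrow> norm x' \<le> M"
proof (rule ccontr)
  assume "\<not> ?thesis"
  then have "\<forall>n::nat. \<exists>x x'. norm x \<le> B \<and> poly p x' = poly p x \<and> norm x' > of_nat n"
    by (metis not_less)
  then obtain x x' :: "nat \<Rightarrow> complex" where x: "\<And>n. norm (x n) \<le> B" "\<And>n. poly p (x' n) = poly p (x n)" "\<And>n. norm (x' n) > of_nat n"
    by metis
  have "filterlim (\<lambda>n. norm (x' n)) at_top sequentially"
    by (rule filterlim_at_top_mono[OF filterlim_real_sequentially]) (use x(3) in \<open>simp add: less_imp_le\<close>)
  then have "filterlim x' at_infinity sequentially" by (simp add: filterlim_at_infinity_conv_norm_at_top)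
  then have "filterlim x at_infinity sequentially" using poly_unbounded_preimage[where x = x' and y = x, OF deg] x(2) by blast
  then have "\<forall>\<^sub>F n in sequentially. norm (x n) \<ge> \<bar>B\<bar> + 1"
    unfolding filterlim_at_infinity[OF order_refl] by simp
  then have "\<forall>\<^sub>F n::nat in sequentially. False"
  proof eventually_elim
    case (elim n)
    then show ?case using x(1)[of n] by linarith
  qed
  then show False by simp
qed

lemma regular_values_unbounded:
  assumes "degree p > 0"
  obtains t where "\<And>n::nat. regular_value p (t n)" "filterlim t at_infinity sequentially"
proof -
  have "\<exists>t. regular_value p t \<and> norm t \<ge> of_nat n" for n :: nat
  proof (rule ccontr)
    assume "\<not> ?thesis"
    then have "(\<lambda>m. of_nat m :: complex) ` {n..} \<subseteq> {t. \<not> regular_value p t}" by auto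
    moreover have "infinite ((\<lambda>m. of_nat m :: complex) ` {n..})"
      by (subst finite_image_iff) (auto simp: inj_on_def infinite_Ici)
    ultimately show False using finite_critical_values[OF assms] finite_subset by blast
  qed
  then obtain t where t: "\<And>n::nat. regular_value p (t n) \<and> norm (t n) \<ge> of_nat n" by metis
  have "filterlim (\<lambda>n. norm (t n)) at_top sequentially"
    by (rule filterlim_at_top_mono[OF filterlim_real_sequentially]) (use t in simp)
  then have "filterlim t at_infinity sequentially" by (simp add: filterlim_at_infinity_conv_norm_at_top)
  then show ?thesis using that t by blast
qed

text \<open>A triangle inscribed in the unit circle with one vertex at 1 is determined by its shape
  \<mu>. Algebraically, conjugation inverts unit numbers, so the relation and its conjugate can be
  solved for \<zeta>2.\<close>

lemma unit_ratio:
  fixes \<mu> \<zeta>2 \<zeta>3 :: complex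
  assumes n: "norm \<zeta>2 = 1" "norm \<zeta>3 = 1" and eq: "1 - \<zeta>3 = \<mu> * (1 - \<zeta>2)" and d: "\<zeta>2 \<noteq> 1" "\<zeta>3 \<noteq> 1" "\<zeta>2 \<noteq> \<zeta>3"
  shows "\<zeta>2 = (1 - \<mu>) * cnj \<mu> / (\<mu> * (1 - cnj \<mu>))"
proof -
  have c: "\<zeta>2 * cnj \<zeta>2 = 1" "\<zeta>3 * cnj \<zeta>3 = 1" using n by (simp_all add: complex_norm_square[symmetric])
  have \<mu>: "\<mu> \<noteq> 0" "\<mu> \<noteq> 1" using eq d by auto
  then have \<mu>': "1 - cnj \<mu> \<noteq> 0" by (metis cnj.simps complex_cnj_cnj complex_cnj_one right_minus_eq)
  have "1 - cnj \<zeta>3 = cnj \<mu> * (1 - cnj \<zeta>2)" using arg_cong[OF eq, of cnj] by simp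
  then have "\<zeta>2 * (\<zeta>3 * (1 - cnj \<zeta>3)) = \<zeta>3 * cnj \<mu> * (\<zeta>2 * (1 - cnj \<zeta>2))" by simp
  then have "\<zeta>2 * (\<zeta>3 - 1) = \<zeta>3 * cnj \<mu> * (\<zeta>2 - 1)" using c by (simp add: right_diff_distrib)
  then have "\<zeta>2 * (1 - \<zeta>3) = \<zeta>3 * cnj \<mu> * (1 - \<zeta>2)" by (simp add: algebra_simps)
  then have "\<zeta>2 * \<mu> = \<zeta>3 * cnj \<mu>" using eq d(1) by simp
  moreover have "\<zeta>3 = 1 - \<mu> + \<mu> * \<zeta>2" using eq by (simp add: algebra_simps)
  ultimately have "\<zeta>2 * (\<mu> * (1 - cnj \<mu>)) = (1 - \<mu>) * cnj \<mu>" by (simp add: algebra_simps)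
  then show ?thesis using \<mu> \<mu>' by (simp add: field_simps)
qed

text \<open>At infinity the shape \<mu> of the triangle of directions determines the ratio z of two of them, since
  the directions lie on the unit circle; so the second branch minus z times the first, measured from
  the centre, is bounded and tends to 0 at infinity.\<close>

lemma three_branches:
  fixes g :: "3 \<Rightarrow> complex \<Rightarrow> complex" and R :: "(3 \<Rightarrow> complex) \<Rightarrow> complex"
  assumes deg: "degree p > 0" and hR: "holomorphic_rel R"
    and r: "r > 0" and reg: "\<And>s. s \<in> ball b r \<Longrightarrow> regular_value p s"
    and g: "\<And>i. branch p (ball b r) (g i)"
    and ginj: "\<And>s. s \<in> ball b r \<Longrightarrow> inj (\<lambda>i. g i s)"
    and gR: "\<And>s. s \<in> ball b r \<Longrightarrow> R (\<lambda>i. g i s) = 0"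
    and R_lim: "\<And>y c \<zeta>. (\<And>n. R (y n) = 0) \<Longrightarrow> filterlim (\<lambda>n. y n 1) at_infinity sequentially \<Longrightarrow>
      (\<And>i. (\<lambda>n. (y n i - c) / (y n 1 - c)) \<longlonglongrightarrow> \<zeta> i) \<Longrightarrow> inj \<zeta> \<Longrightarrow> (\<And>i. norm (\<zeta> i) = 1) \<Longrightarrow> \<zeta> 1 = 1 \<Longrightarrow>
      1 - \<zeta> 3 = \<mu> * (1 - \<zeta> 2)"
  defines "c \<equiv> poly_center p" and "z \<equiv> (1 - \<mu>) * cnj \<mu> / (\<mu> * (1 - cnj \<mu>))"
  assumes s: "s \<in> ball b r"
  shows "g 2 s - c = z * (g 1 s - c)"
proof -
  define \<Phi> where "\<Phi> y = (y 2 - c) - z * (y 1 - c)" for y :: "3 \<Rightarrow> complex"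
  have \<Phi>_lim: "\<exists>\<phi>. strict_mono (\<phi> :: nat \<Rightarrow> nat) \<and> (\<lambda>n. \<Phi> (y (\<phi> n))) \<longlonglongrightarrow> 0"
    if y: "\<And>n. inj (y n)" "\<And>n i j. poly p (y n i) = poly p (y n j)" "\<And>n. R (y n) = 0"
      and inf: "filterlim (\<lambda>n. y n 1) at_infinity sequentially" for y :: "nat \<Rightarrow> 3 \<Rightarrow> complex"
  proof -
    obtain \<phi> \<zeta> where \<phi>: "strict_mono (\<phi> :: nat \<Rightarrow> nat)" "inj \<zeta>" "\<zeta> 1 = 1" "\<And>i. norm (\<zeta> i) = 1"
      "\<And>i. \<zeta> i ^ degree p = 1" "\<And>i. (\<lambda>n. (y (\<phi> n) i - c) / (y (\<phi> n) 1 - c)) \<longlonglongrightarrow> \<zeta> i"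
      by (rule tuple_limit_at_infinity[OF deg y(1,2) inf, of c]) blast
    have inf': "filterlim (\<lambda>n. y (\<phi> n) 1) at_infinity sequentially"
      using filterlim_compose[OF inf filterlim_subseq[OF \<phi>(1)]] .
    have "1 - \<zeta> 3 = \<mu> * (1 - \<zeta> 2)"
      using R_lim[of "\<lambda>n. y (\<phi> n)" c \<zeta>] y(3) inf' \<phi> by blast
    moreover have "(1::3) \<noteq> 2" "(1::3) \<noteq> 3" "(2::3) \<noteq> 3" by simp_all
    then have "\<zeta> 2 \<noteq> 1" "\<zeta> 3 \<noteq> 1" "\<zeta> 2 \<noteq> \<zeta> 3" using \<phi>(2,3) by (metis injD)+
    ultimately have "\<zeta> 2 = z" using unit_ratio[of "\<zeta> 2" "\<zeta> 3" \<mu>] \<phi>(4) by (simp add: z_def)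
    moreover have "(\<lambda>n. (y (\<phi> n) 2 - c) - \<zeta> 2 * (y (\<phi> n) 1 - c)) \<longlonglongrightarrow> 0"
      by (rule fibre_linear_at_infinity[OF deg inf' y(2) _ \<phi>(6,5)]) (simp add: c_def)
    ultimately show ?thesis using \<phi>(1) by (auto simp: \<Phi>_def)
  qed
  \<comment> \<open>A sequence along which \<open>\<Phi>\<close> is unbounded must leave every disc,
    because one bounded entry bounds the whole fibre; but at infinity \<open>\<Phi>_lim\<close>
    supplies a subsequence tending to 0.\<close>
  have "\<exists>C. \<forall>y. inj y \<and> (\<forall>i j. poly p (y i) = poly p (y j)) \<and> R y = 0 \<longrightarrow> norm (\<Phi> y) \<le> C"
  proof (rule ccontr)
    assume "\<not> ?thesis"
    then have "\<forall>n::nat. \<exists>y. inj y \<and> (\<forall>i j. poly p (y i) = poly p (y j)) \<and> R y = 0 \<and> norm (\<Phi> y) > of_nat n"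
      by (metis not_less)
    then obtain y where y: "\<And>n. inj (y n)" "\<And>n i j. poly p (y n i) = poly p (y n j)" "\<And>n. R (y n) = 0"
      and big: "\<And>n::nat. norm (\<Phi> (y n)) > of_nat n" by metis
    have "filterlim (\<lambda>n. y n 1) at_infinity sequentially"
      unfolding filterlim_at_infinity[OF order_refl]
    proof (intro allI impI)
      fix B :: real assume "B > 0"
      obtain M where M: "\<And>x x'. norm x \<le> B \<Longrightarrow> poly p x = poly p x' \<Longrightarrow> norm x' \<le> M"
        using fibre_bounded[OF deg] by blast
      have "\<forall>\<^sub>F n in sequentially. of_nat n > M + norm c + norm z * (B + norm c)"
        using filterlim_real_sequentially by (simp add: filterlim_at_top_dense)
      then show "\<forall>\<^sub>F n in sequentially. B \<le> norm (y n 1)"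
      proof eventually_elim
        case (elim n)
        show ?case
        proof (rule ccontr)
          assume "\<not> ?case"
          then have B: "norm (y n 1) \<le> B" by simp
          then have "norm (y n 2) \<le> M" using M y(2) by blast
          then have "norm (y n 2 - c) \<le> M + norm c" using norm_triangle_ineq4[of "y n 2" c] by linarith
          moreover have "norm (y n 1 - c) \<le> B + norm c" using B norm_triangle_ineq4[of "y n 1" c] by linarith
          then have "norm (z * (y n 1 - c)) \<le> norm z * (B + norm c)" by (simp add: norm_mult mult_left_mono)
          ultimately have "norm (\<Phi> (y n)) \<le> M + norm c + norm z * (B + norm c)"
            using norm_triangle_ineq4[of "y n 2 - c" "z * (y n 1 - c)"] by (simp add: \<Phi>_def)
          then show False using big[of n] elim by linarith
        qed
      qed
    qed
    then obtain \<phi> where \<phi>: "strict_mono (\<phi> :: nat \<Rightarrow> nat)" "(\<lambda>n. \<Phi> (y (\<phi> n))) \<longlonglongrightarrow> 0"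
      using \<Phi>_lim[of y, OF y] by blast
    then have "\<forall>\<^sub>F n in sequentially. norm (\<Phi> (y (\<phi> n))) < 1" using tendstoD[OF \<phi>(2), of 1] by (simp add: dist_norm)
    moreover have "\<forall>\<^sub>F n::nat in sequentially. n \<ge> 1" by (rule eventually_ge_at_top)
    ultimately have "\<forall>\<^sub>F n::nat in sequentially. False"
    proof eventually_elim
      case (elim n)
      then show ?case using big[of "\<phi> n"] seq_suble[OF \<phi>(1), of n] by linarith
    qed
    then show False by simp
  qed
  then obtain C where C: "\<And>y. inj y \<Longrightarrow> (\<And>i j. poly p (y i) = poly p (y j)) \<Longrightarrow> R y = 0 \<Longrightarrow> norm (\<Phi> y) \<le> C"
    by blast
  have h\<Phi>: "holomorphic_rel \<Phi>" unfolding holomorphic_rel_def \<Phi>_def by (intro allI impI holomorphic_intros) auto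
  have "\<exists>X. (\<forall>s\<in>ball b r. \<Phi> (\<lambda>i. g i s) = X) \<and>
    (\<forall>t. regular_value p t \<longrightarrow> (\<exists>y. inj y \<and> (\<forall>i. poly p (y i) = t) \<and> R y = 0 \<and> \<Phi> y = X))"
    by (rule branch_tuple_Liouville[where C = C, OF deg hR h\<Phi> _ r reg g ginj gR]) (use C in auto)
  then obtain X where X: "\<Phi> (\<lambda>i. g i s) = X"
    and Xt: "\<And>t. regular_value p t \<Longrightarrow> \<exists>y. inj y \<and> (\<forall>i. poly p (y i) = t) \<and> R y = 0 \<and> \<Phi> y = X"
    using s by blast
  \<comment> \<open>The constant is read off along regular values tending to infinity, where
    \<open>\<Phi>_lim\<close> forces it to be 0.\<close>
  obtain t where t: "\<And>n::nat. regular_value p (t n)" "filterlim t at_infinity sequentially"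
    using regular_values_unbounded[OF deg] by blast
  obtain y where y: "\<And>n. inj (y n)" "\<And>n i. poly p (y n i) = t n" "\<And>n. R (y n) = 0" "\<And>n. \<Phi> (y n) = X"
    using Xt[OF t(1)] by metis
  have "filterlim (\<lambda>n. y n 1) at_infinity sequentially"
    by (rule poly_at_infinity_imp[of p]) (use t(2) y(2) in simp)
  then obtain \<phi> where "(\<lambda>n. \<Phi> (y (\<phi> n))) \<longlonglongrightarrow> 0"
    using \<Phi>_lim[of y, OF y(1) _ y(3)] y(2) by auto
  then have "X = 0" using y(4) by (simp add: tendsto_const_iff)
  then show ?thesis using X by (simp add: \<Phi>_def)
qed

text \<open>On the unit circle conjugation is inversion, a Moebius map, and so preserves cross
  ratios: both sides acquire the same denominator abcd.\<close>

lemma cross_ratio_unit_circle: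
  fixes \<kappa> a b c d :: complex
  assumes n: "norm a = 1" "norm b = 1" "norm c = 1" "norm d = 1"
    and eq: "(a - b) * (c - d) = \<kappa> * ((a - c) * (b - d))" and ne: "a \<noteq> c" "b \<noteq> d"
  shows "cnj \<kappa> = \<kappa>"
proof -
  have u: "cnj x = inverse x" "x \<noteq> 0" if "norm x = 1" for x :: complex
  proof -
    show "x \<noteq> 0" using that by auto
    have "x * cnj x = 1" using that by (simp add: complex_norm_square[symmetric])
    then show "cnj x = inverse x" using \<open>x \<noteq> 0\<close> by (simp add: field_simps)
  qed
  have "(inverse a - inverse b) * (inverse c - inverse d) = cnj \<kappa> * ((inverse a - inverse c) * (inverse b - inverse d))"
    using arg_cong[OF eq, of cnj] n by (simp add: u)
  moreover have "(inverse a - inverse b) * (inverse c - inverse d) = ((a - b) * (c - d)) / (a * b * c * d)"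
    using u(2)[OF n(1)] u(2)[OF n(2)] u(2)[OF n(3)] u(2)[OF n(4)] by (simp add: field_simps)
  moreover have "(inverse a - inverse c) * (inverse b - inverse d) = ((a - c) * (b - d)) / (a * b * c * d)"
    using u(2)[OF n(1)] u(2)[OF n(2)] u(2)[OF n(3)] u(2)[OF n(4)] by (simp add: field_simps)
  moreover have "a * b * c * d \<noteq> 0" using n u(2) by auto
  ultimately have "\<kappa> * ((a - c) * (b - d)) = cnj \<kappa> * ((a - c) * (b - d))"
    using eq by simp
  then show ?thesis using ne by simp
qed

text \<open>A real ratio puts the three points on one line, and a line meets a circle in at most two
  points.\<close>

lemma real_ratio_unit_circle:
  fixes \<kappa> a b c :: complex
  assumes n: "norm a = 1" "norm b = 1" "norm c = 1" and \<kappa>: "cnj \<kappa> = \<kappa>"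
    and eq: "a - b = \<kappa> * (c - b)" and ne: "a \<noteq> b" "a \<noteq> c"
  shows False
proof -
  have u: "x * cnj x = 1" if "norm x = 1" for x :: complex
    using that by (simp add: complex_norm_square[symmetric])
  have "cnj a - cnj b = \<kappa> * (cnj c - cnj b)" using arg_cong[OF eq, of cnj] \<kappa> by simp
  then have "a * c * b * (cnj a - cnj b) = \<kappa> * (a * c * b * (cnj c - cnj b))" by simp
  moreover have "a * c * b * (cnj a - cnj b) = c * (b * (a * cnj a) - a * (b * cnj b))" by (simp add: algebra_simps)
  moreover have "a * c * b * (cnj c - cnj b) = a * (b * (c * cnj c) - c * (b * cnj b))" by (simp add: algebra_simps)
  ultimately have "c * (b - a) = \<kappa> * (a * (b - c))" using n u by simp
  then have "c * (a - b) = a * (\<kappa> * (c - b))" by (simp add: algebra_simps)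
  then have "c * (a - b) = a * (a - b)" by (simp only: eq[symmetric])
  then have "(c - a) * (a - b) = 0" by (simp add: algebra_simps)
  then show False using ne by auto
qed

lemma four_distinct: "(1::4) \<noteq> 2" "(1::4) \<noteq> 3" "(1::4) \<noteq> 4" "(2::4) \<noteq> 3" "(2::4) \<noteq> 4" "(3::4) \<noteq> 4"
  by simp_all

text \<open>At infinity the branches approach directions on a circle, so \<kappa> is real.  If the quotient
  (y 1 - y 3) / (y 1 - y 2) blew up, then 1, 2 and one of 3, 4 would collide at a critical point; the
  collision of 1, 2, 4 alone is impossible, because there the local branches leave in directions on a
  circle and three points of a circle have no real affine ratio.\<close>

lemma four_branches:
  fixes g :: "4 \<Rightarrow> complex \<Rightarrow> complex"
  assumes deg: "degree p > 0"
    and r: "r > 0" and reg: "\<And>s. s \<in> ball b r \<Longrightarrow> regular_value p s"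
    and g: "\<And>i. branch p (ball b r) (g i)"
    and ginj: "\<And>s. s \<in> ball b r \<Longrightarrow> inj (\<lambda>i. g i s)"
    and cr: "\<And>s. s \<in> ball b r \<Longrightarrow> (g 1 s - g 2 s) * (g 3 s - g 4 s) = \<kappa> * ((g 1 s - g 3 s) * (g 2 s - g 4 s))"
  shows "\<exists>\<mu>. \<forall>s\<in>ball b r. g 1 s - g 3 s = \<mu> * (g 1 s - g 2 s)"
proof -
  define R where "R y = (y 1 - y 2) * (y 3 - y 4) - \<kappa> * ((y 1 - y 3) * (y 2 - y 4))" for y :: "4 \<Rightarrow> complex"
  have hR: "holomorphic_rel R" unfolding holomorphic_rel_def R_def by (intro allI impI holomorphic_intros) auto
  have gR: "R (\<lambda>i. g i s) = 0" if "s \<in> ball b r" for s using cr[OF that] by (simp add: R_def)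
  have dist: "y 1 \<noteq> y 2" "y 1 \<noteq> y 3" "y 2 \<noteq> y 4" "y 3 \<noteq> y 4" "y 1 \<noteq> y 4" "y 2 \<noteq> y 3" if "inj y" for y :: "4 \<Rightarrow> complex"
    using that four_distinct by (metis injD)+
  have "b \<in> ball b r" using r by simp
  then have \<kappa>0: "\<kappa> \<noteq> 0" using cr[of b] dist[OF ginj[of b]] by auto
  have real: "cnj \<kappa> = \<kappa>"
  proof -
    \<comment> \<open>With \<open>\<Phi>\<close> taken to be \<open>R\<close> the bound is trivially
      0; the theorem serves here only to continue the relation to regular values near
      infinity.\<close>
    have "\<exists>X. (\<forall>s\<in>ball b r. R (\<lambda>i. g i s) = X) \<and>
      (\<forall>t. regular_value p t \<longrightarrow> (\<exists>y. inj y \<and> (\<forall>i. poly p (y i) = t) \<and> R y = 0 \<and> R y = X))"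
      by (rule branch_tuple_Liouville[where C = 0, OF deg hR hR _ r reg g ginj gR]) auto
    then have Xt: "\<And>t. regular_value p t \<Longrightarrow> \<exists>y. inj y \<and> (\<forall>i. poly p (y i) = t) \<and> R y = 0" by blast
    obtain t where t: "\<And>n::nat. regular_value p (t n)" "filterlim t at_infinity sequentially"
      using regular_values_unbounded[OF deg] by blast
    obtain y where y: "\<And>n. inj (y n)" "\<And>n i. poly p (y n i) = t n" "\<And>n. R (y n) = 0"
      using Xt[OF t(1)] by metis
    have inf: "filterlim (\<lambda>n. y n 1) at_infinity sequentially"
      by (rule poly_at_infinity_imp[of p]) (use t(2) y(2) in simp)
    have y2: "poly p (y n i) = poly p (y n j)" for n i j using y(2) by simp
    obtain \<phi> \<zeta> where \<phi>: "strict_mono (\<phi> :: nat \<Rightarrow> nat)" "inj \<zeta>" "\<zeta> 1 = 1" "\<And>i. norm (\<zeta> i) = 1"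
      "\<And>i. (\<lambda>n. (y (\<phi> n) i - 0) / (y (\<phi> n) 1 - 0)) \<longlonglongrightarrow> \<zeta> i"
      by (rule tuple_limit_at_infinity[OF deg y(1) y2 inf, of 0]) blast
    define u where "u n i = y (\<phi> n) i * inverse (y (\<phi> n) 1)" for n i
    have u: "(\<lambda>n. u n i) \<longlonglongrightarrow> \<zeta> i" for i using \<phi>(5)[of i] by (simp add: u_def divide_inverse)
    have "\<forall>\<^sub>F n in sequentially. (u n 1 - u n 2) * (u n 3 - u n 4) - \<kappa> * ((u n 1 - u n 3) * (u n 2 - u n 4)) = 0"
    proof (rule always_eventually, rule allI)
      fix n
      have "(u n 1 - u n 2) * (u n 3 - u n 4) - \<kappa> * ((u n 1 - u n 3) * (u n 2 - u n 4)) = R (y (\<phi> n)) * (inverse (y (\<phi> n) 1) * inverse (y (\<phi> n) 1))"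
        by (simp add: u_def R_def algebra_simps)
      then show "(u n 1 - u n 2) * (u n 3 - u n 4) - \<kappa> * ((u n 1 - u n 3) * (u n 2 - u n 4)) = 0" using y(3) by simp
    qed
    moreover have "(\<lambda>n. (u n 1 - u n 2) * (u n 3 - u n 4) - \<kappa> * ((u n 1 - u n 3) * (u n 2 - u n 4)))
        \<longlonglongrightarrow> (\<zeta> 1 - \<zeta> 2) * (\<zeta> 3 - \<zeta> 4) - \<kappa> * ((\<zeta> 1 - \<zeta> 3) * (\<zeta> 2 - \<zeta> 4))"
      by (intro tendsto_intros u)
    ultimately have "(\<zeta> 1 - \<zeta> 2) * (\<zeta> 3 - \<zeta> 4) - \<kappa> * ((\<zeta> 1 - \<zeta> 3) * (\<zeta> 2 - \<zeta> 4)) = 0"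
      using LIMSEQ_unique[OF _ tendsto_eventually] by blast
    then show ?thesis using cross_ratio_unit_circle[OF \<phi>(4) \<phi>(4) \<phi>(4) \<phi>(4)] dist[OF \<phi>(2)] by (simp add: right_minus_eq)
  qed
  define \<Phi> where "\<Phi> y = (y 1 - y 3) / (y 1 - y 2)" for y :: "4 \<Rightarrow> complex"
  define adm where "adm y \<longleftrightarrow> inj y \<and> (\<forall>i. poly p (y i) = poly p (y 1)) \<and> regular_value p (poly p (y 1)) \<and> R y = 0" for y
  \<comment> \<open>In terms of directions from \<open>c\<close> the quotient is (1 - u 3) / (1 - u
    2), which has a finite limit when \<open>\<omega> 2\<close> is not 1. The centre is a parameter
    because the argument is used at infinity, with c = 0, and at a collision point.\<close>
  have noblow: False
    if y: "\<And>n. adm (y n)" and big: "\<And>n::nat. norm (\<Phi> (y n)) > of_nat n" and \<phi>: "strict_mono \<phi>"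
      and lim: "(\<lambda>n. (y (\<phi> n) 2 - c) / (y (\<phi> n) 1 - c)) \<longlonglongrightarrow> \<omega> 2" "(\<lambda>n. (y (\<phi> n) 3 - c) / (y (\<phi> n) 1 - c)) \<longlonglongrightarrow> \<omega> 3"
      and \<omega>: "\<omega> 2 \<noteq> 1" and ne: "\<forall>\<^sub>F n in sequentially. y (\<phi> n) 1 \<noteq> c"
    for y :: "nat \<Rightarrow> 4 \<Rightarrow> complex" and \<phi> :: "nat \<Rightarrow> nat" and \<omega> :: "4 \<Rightarrow> complex" and c
  proof -
    have "(\<lambda>n. (1 - (y (\<phi> n) 3 - c) / (y (\<phi> n) 1 - c)) / (1 - (y (\<phi> n) 2 - c) / (y (\<phi> n) 1 - c))) \<longlonglongrightarrow> (1 - \<omega> 3) / (1 - \<omega> 2)"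
      using \<omega> by (intro tendsto_intros lim) auto
    moreover have "\<forall>\<^sub>F n in sequentially. (1 - (y (\<phi> n) 3 - c) / (y (\<phi> n) 1 - c)) / (1 - (y (\<phi> n) 2 - c) / (y (\<phi> n) 1 - c)) = \<Phi> (y (\<phi> n))"
      using ne
    proof eventually_elim
      case (elim n)
      have *: "1 - (x - c) / (w - c) = (w - x) / (w - c)" if "w \<noteq> c" for w x :: complex
        using that by (simp add: field_simps)
      show ?case using elim by (simp add: * \<Phi>_def)
    qed
    ultimately have "(\<lambda>n. \<Phi> (y (\<phi> n))) \<longlonglongrightarrow> (1 - \<omega> 3) / (1 - \<omega> 2)" by (rule Lim_transform_eventually)
    then have "Bseq (\<lambda>n. \<Phi> (y (\<phi> n)))" using convergent_imp_Bseq convergentI by blast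
    then obtain K where K: "\<And>n. norm (\<Phi> (y (\<phi> n))) \<le> K" by (auto simp: Bseq_def)
    obtain n :: nat where n: "K \<le> of_nat n" using real_arch_simple by blast
    have "n \<le> \<phi> n" using seq_suble[OF \<phi>] .
    then show False using K[of n] big[of "\<phi> n"] n by linarith
  qed
  have admD: "inj y" "poly p (y i) = poly p (y j)" "R y = 0" "regular_value p (poly p (y j))" if "adm y" for y i j
    using that unfolding adm_def by metis+
  have far: "\<exists>m::nat. \<forall>y. adm y \<and> norm (y 1) > of_nat m \<longrightarrow> norm (\<Phi> y) \<le> of_nat m"
  proof (rule ccontr)
    assume "\<not> ?thesis"
    then have "\<forall>n::nat. \<exists>y. adm y \<and> norm (y 1) > of_nat n \<and> norm (\<Phi> y) > of_nat n" by (metis not_less)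
    then obtain y where y: "\<And>n::nat. adm (y n)" "\<And>n. norm (y n 1) > of_nat n" and big: "\<And>n. norm (\<Phi> (y n)) > of_nat n" by metis
    have "filterlim (\<lambda>n. norm (y n 1)) at_top sequentially"
      by (rule filterlim_at_top_mono[OF filterlim_real_sequentially]) (use y(2) in \<open>simp add: less_imp_le\<close>)
    then have inf: "filterlim (\<lambda>n. y n 1) at_infinity sequentially" by (simp add: filterlim_at_infinity_conv_norm_at_top)
    obtain \<phi> \<zeta> where \<phi>: "strict_mono (\<phi> :: nat \<Rightarrow> nat)" "inj \<zeta>" "\<zeta> 1 = 1"
      "\<And>i. (\<lambda>n. (y (\<phi> n) i - 0) / (y (\<phi> n) 1 - 0)) \<longlonglongrightarrow> \<zeta> i"
      by (rule tuple_limit_at_infinity[OF deg admD(1)[OF y(1)] admD(2)[OF y(1)] inf, of 0]) blast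
    show False
    proof (rule noblow[OF y(1) big \<phi>(1) \<phi>(4) \<phi>(4)])
      show "\<zeta> 2 \<noteq> 1" using dist(1)[OF \<phi>(2)] \<phi>(3) by simp
      show "\<forall>\<^sub>F n in sequentially. y (\<phi> n) 1 \<noteq> 0"
        using filterlim_compose[OF inf filterlim_subseq[OF \<phi>(1)]] by (metis filterlim_at_infinity_imp_eventually_ne)
    qed
  qed
  have near: "\<exists>C::nat. \<forall>y. adm y \<and> norm (y 1) \<le> B \<longrightarrow> norm (\<Phi> y) \<le> of_nat C" for B :: real
  proof (rule ccontr)
    assume "\<not> ?thesis"
    then have "\<forall>n::nat. \<exists>y. adm y \<and> norm (y 1) \<le> B \<and> norm (\<Phi> y) > of_nat n" by (metis not_less)
    then obtain y0 where y0: "\<And>n::nat. adm (y0 n)" "\<And>n. norm (y0 n 1) \<le> B" and big0: "\<And>n. norm (\<Phi> (y0 n)) > of_nat n" by metis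
    obtain M where M: "\<And>x x'. norm x \<le> B \<Longrightarrow> poly p x = poly p x' \<Longrightarrow> norm x' \<le> M"
      using fibre_bounded[OF deg] by blast
    have bd: "norm (y0 n i) \<le> M" for n i using M[OF y0(2) admD(2)[OF y0(1)]] .
    obtain \<psi> l where \<psi>: "strict_mono (\<psi> :: nat \<Rightarrow> nat)" and l0: "\<And>i. (\<lambda>n. y0 (\<psi> n) i) \<longlonglongrightarrow> l i"
      using finite_index_subsequence[of y0, OF bd] by blast
    define y where "y n = y0 (\<psi> n)" for n
    have y: "\<And>n. adm (y n)" using y0 by (simp add: y_def)
    have l: "(\<lambda>n. y n i) \<longlonglongrightarrow> l i" for i using l0 by (simp add: y_def)
    have big: "norm (\<Phi> (y n)) > of_nat n" for n
      using big0[of "\<psi> n"] seq_suble[OF \<psi>, of n] by (simp add: y_def)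
    have ninj: "\<And>n. inj (y n)" and neq: "\<And>n i j. poly p (y n i) = poly p (y n j)"
      using admD(1,2)[OF y] by blast+
    \<comment> \<open>The numerator of \<open>\<Phi>\<close> is at most 2M while the quotient
      exceeds n, so the denominator must vanish in the limit.\<close>
    have "(\<lambda>n. y n 1 - y n 2) \<longlonglongrightarrow> 0"
    proof (rule Lim_null_comparison)
      show "\<forall>\<^sub>F n in sequentially. norm (y n 1 - y n 2) \<le> 2 * M / of_nat n"
        using eventually_gt_at_top[of "0::nat"]
      proof eventually_elim
        case (elim n)
        have "norm (y n 1 - y n 2) > 0" using dist[OF ninj] by simp
        moreover have "of_nat n < norm (y n 1 - y n 3) / norm (y n 1 - y n 2)" using big[of n] by (simp add: \<Phi>_def norm_divide)
        ultimately have "of_nat n * norm (y n 1 - y n 2) < norm (y n 1 - y n 3)" by (simp add: field_simps)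
        also have "\<dots> \<le> norm (y n 1) + norm (y n 3)" by (rule norm_triangle_ineq4)
        also have "\<dots> \<le> 2 * M" using bd[of "\<psi> n" 1] bd[of "\<psi> n" 3] by (simp add: y_def)
        finally show ?case using elim by (simp add: field_simps)
      qed
      show "(\<lambda>n. 2 * M / of_nat n) \<longlonglongrightarrow> 0" by (rule lim_const_over_n)
    qed
    moreover have "(\<lambda>n. y n 1 - y n 2) \<longlonglongrightarrow> l 1 - l 2" by (intro tendsto_intros l)
    ultimately have l12: "l 2 = l 1" using LIMSEQ_unique by fastforce
    define c where "c = l 1"
    have "(\<lambda>n. R (y n)) \<longlonglongrightarrow> (l 1 - l 2) * (l 3 - l 4) - \<kappa> * ((l 1 - l 3) * (l 2 - l 4))"
      unfolding R_def by (intro tendsto_intros l)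
    moreover have "(\<lambda>n. R (y n)) = (\<lambda>n. 0)" using admD(3)[OF y] by auto
    ultimately have "(l 1 - l 2) * (l 3 - l 4) - \<kappa> * ((l 1 - l 3) * (l 2 - l 4)) = 0"
      by (simp add: LIMSEQ_const_iff)
    then have l34: "l 3 = c \<or> l 4 = c" using l12 \<kappa>0 by (auto simp: c_def)
    \<comment> \<open>Two distinct points of one fibre converge to c, so p is injective on no
      neighbourhood of c. Admissible tuples lie over regular values and hence never meet c, so that
      directions from c make sense.\<close>
    have crit: "poly (pderiv p) c = 0"
    proof (rule ccontr)
      assume "poly (pderiv p) c \<noteq> 0"
      then obtain e where e: "e > 0" "inj_on (poly p) (ball c e)" using poly_locally_inj by blast
      have "\<forall>\<^sub>F n in sequentially. dist (y n 1) c < e" "\<forall>\<^sub>F n in sequentially. dist (y n 2) c < e"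
        using tendstoD[OF l e(1)] l12 unfolding c_def by metis+
      then have "\<forall>\<^sub>F n::nat in sequentially. False"
      proof eventually_elim
        case (elim n)
        then have "y n 1 = y n 2" using inj_onD[OF e(2) neq[of n 1 2]] by (simp add: dist_commute)
        then show ?case using dist[OF ninj] by blast
      qed
      then show False by simp
    qed
    have nec: "y n i \<noteq> c" for n i
      using admD(4)[OF y, of n i] crit unfolding regular_value_def by auto
    define J where "J = {i. l i = c}"
    have J: "1 \<in> J" "2 \<in> J" "3 \<in> J \<or> 4 \<in> J" using l12 l34 by (auto simp: J_def c_def)
    have lJ: "(\<lambda>n. y n i) \<longlonglongrightarrow> c" if "i \<in> J" for i using l[of i] that by (simp add: J_def)
    obtain \<phi> \<omega> where \<phi>: "strict_mono (\<phi> :: nat \<Rightarrow> nat)" "inj_on \<omega> J" "\<omega> 1 = 1" "\<And>i. i \<in> J \<Longrightarrow> norm (\<omega> i) = 1"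
      "\<And>i. i \<in> J \<Longrightarrow> (\<lambda>n. (y (\<phi> n) i - c) / (y (\<phi> n) 1 - c)) \<longlonglongrightarrow> \<omega> i"
      by (rule tuple_limit_local[OF deg ninj neq J(1) lJ nec]) (assumption | (rule that; assumption))+
    have \<omega>2: "\<omega> 2 \<noteq> 1" using inj_onD[OF \<phi>(2), of 1 2] J \<phi>(3) four_distinct(1) by metis
    show False
    proof (cases "3 \<in> J")
      case True
      show False by (rule noblow[OF y big \<phi>(1) \<phi>(5)[OF J(2)] \<phi>(5)[OF True] \<omega>2]) (use nec in simp)
    next
      case False
      then have J4: "4 \<in> J" and l3: "l 3 \<noteq> c" using J by (auto simp: J_def)
      define u where "u n i = (y (\<phi> n) i - c) / (y (\<phi> n) 1 - c)" for n i
      have u: "(\<lambda>n. u n i) \<longlonglongrightarrow> \<omega> i" if "i \<in> J" for i using \<phi>(5)[OF that] by (simp add: u_def)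
      have yl: "(\<lambda>n. y (\<phi> n) i) \<longlonglongrightarrow> l i" for i using filterlim_compose[OF l filterlim_subseq[OF \<phi>(1)]] .
      \<comment> \<open>Each side of the cross ratio relation contains one factor that vanishes in
        the limit, y 1 - y 2 and y 2 - y 4; dividing once by y 1 - c turns these two into
        differences of directions.\<close>
      have "(1 - u n 2) * (y (\<phi> n) 3 - y (\<phi> n) 4) - \<kappa> * ((y (\<phi> n) 1 - y (\<phi> n) 3) * (u n 2 - u n 4)) = 0" for n
      proof -
        let ?D = "y (\<phi> n) 1 - c"
        have D: "?D \<noteq> 0" using nec by simp
        have e1: "?D * u n i = y (\<phi> n) i - c" for i using D by (simp add: u_def)
        have 1: "?D * (1 - u n 2) = y (\<phi> n) 1 - y (\<phi> n) 2" "?D * (u n 2 - u n 4) = y (\<phi> n) 2 - y (\<phi> n) 4"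
          using e1 by (simp_all add: right_diff_distrib)
        have "?D * ((1 - u n 2) * (y (\<phi> n) 3 - y (\<phi> n) 4) - \<kappa> * ((y (\<phi> n) 1 - y (\<phi> n) 3) * (u n 2 - u n 4)))
          = (?D * (1 - u n 2)) * (y (\<phi> n) 3 - y (\<phi> n) 4) - \<kappa> * ((y (\<phi> n) 1 - y (\<phi> n) 3) * (?D * (u n 2 - u n 4)))"
          by (simp add: algebra_simps)
        also have "\<dots> = R (y (\<phi> n))" unfolding 1 by (simp add: R_def)
        finally show ?thesis using admD(3)[OF y] D by simp
      qed
      moreover have "(\<lambda>n. (1 - u n 2) * (y (\<phi> n) 3 - y (\<phi> n) 4) - \<kappa> * ((y (\<phi> n) 1 - y (\<phi> n) 3) * (u n 2 - u n 4)))
          \<longlonglongrightarrow> (1 - \<omega> 2) * (l 3 - l 4) - \<kappa> * ((l 1 - l 3) * (\<omega> 2 - \<omega> 4))"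
        by (intro tendsto_intros u yl J J4)
      ultimately have "(1 - \<omega> 2) * (l 3 - l 4) - \<kappa> * ((l 1 - l 3) * (\<omega> 2 - \<omega> 4)) = 0"
        by (simp add: LIMSEQ_const_iff)
      then have "(1 - \<omega> 2) * (l 3 - c) - \<kappa> * ((c - l 3) * (\<omega> 2 - \<omega> 4)) = 0"
        using J4 by (simp add: J_def c_def)
      then have "(l 3 - c) * ((1 - \<omega> 2) - \<kappa> * (\<omega> 4 - \<omega> 2)) = 0" by (simp add: algebra_simps)
      then have e: "1 - \<omega> 2 = \<kappa> * (\<omega> 4 - \<omega> 2)" using l3 by simp
      have \<omega>4: "\<omega> 4 \<noteq> 1" using inj_onD[OF \<phi>(2), of 1 4] J J4 \<phi>(3) four_distinct(3) by metis
      show False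
        by (rule real_ratio_unit_circle[OF _ _ _ real e]) (use \<phi>(4) J J4 \<omega>2 \<omega>4 in auto)
    qed
  qed
  obtain m :: nat where m: "\<And>y. adm y \<Longrightarrow> norm (y 1) > of_nat m \<Longrightarrow> norm (\<Phi> y) \<le> of_nat m" using far by blast
  obtain C :: nat where C: "\<And>y. adm y \<Longrightarrow> norm (y 1) \<le> of_nat m \<Longrightarrow> norm (\<Phi> y) \<le> of_nat C" using near by blast
  have bd: "norm (\<Phi> y) \<le> of_nat (m + C)" if "adm y" for y
    using m[OF that] C[OF that] by (cases "norm (y 1) > of_nat m") auto
  have h\<Phi>: "holomorphic_rel \<Phi>"
    unfolding holomorphic_rel_def \<Phi>_def
  proof (intro allI impI holomorphic_intros)
    fix S :: "complex set" and h :: "4 \<Rightarrow> complex \<Rightarrow> complex" and s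
    assume "\<forall>s\<in>S. inj (\<lambda>i. h i s)" "s \<in> S"
    then show "h 1 s - h 2 s \<noteq> 0" using dist(1)[of "\<lambda>i. h i s"] by auto
  qed auto
  have "\<exists>X. (\<forall>s\<in>ball b r. \<Phi> (\<lambda>i. g i s) = X) \<and>
    (\<forall>t. regular_value p t \<longrightarrow> (\<exists>y. inj y \<and> (\<forall>i. poly p (y i) = t) \<and> R y = 0 \<and> \<Phi> y = X))"
    by (rule branch_tuple_Liouville[where C = "of_nat (m + C)", OF deg hR h\<Phi> _ r reg g ginj gR]) (use bd in \<open>auto simp: adm_def\<close>)
  then obtain X where X: "\<And>s. s \<in> ball b r \<Longrightarrow> \<Phi> (\<lambda>i. g i s) = X" by blast
  have "g 1 s - g 3 s = X * (g 1 s - g 2 s)" if "s \<in> ball b r" for s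
    using X[OF that] dist(1)[OF ginj[OF that]] by (auto simp: \<Phi>_def field_simps)
  then show ?thesis by blast
qed

section \<open>Relations and symmetries coming from a Moebius map\<close>

lemma affine_relation:
  fixes \<alpha> \<beta> \<delta> :: complex
  assumes "\<alpha> * \<delta> \<noteq> 0"
    and "v1 * \<delta> = \<alpha> * w1 + \<beta>" "v2 * \<delta> = \<alpha> * w2 + \<beta>" "v3 * \<delta> = \<alpha> * w3 + \<beta>"
  shows "(v1 - v3) * (w1 - w2) = (v1 - v2) * (w1 - w3)"
proof -
  have 1: "(v1 - v3) * \<delta> = \<alpha> * (w1 - w3)" "(v1 - v2) * \<delta> = \<alpha> * (w1 - w2)"
    using assms by (simp_all add: left_diff_distrib right_diff_distrib)
  have "(\<alpha> * \<delta>) * ((v1 - v3) * (w1 - w2)) = ((v1 - v3) * \<delta>) * (\<alpha> * (w1 - w2))" by simp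
  also have "\<dots> = (\<alpha> * (w1 - w3)) * ((v1 - v2) * \<delta>)" using 1 by simp
  also have "\<dots> = (\<alpha> * \<delta>) * ((v1 - v2) * (w1 - w3))" by simp
  finally show ?thesis using assms(1) by simp
qed

text \<open>A difference of images, multiplied by the denominators of its two points, is the
  determinant times the difference of the points. Each of the four denominators occurs once on
  either side, so everything can be stated without division.\<close>

lemma cross_ratio_relation:
  fixes \<alpha> \<beta> \<gamma> \<delta> :: complex
  assumes det: "\<alpha> * \<delta> - \<beta> * \<gamma> \<noteq> 0"
    and nz: "\<gamma> * w1 + \<delta> \<noteq> 0" "\<gamma> * w2 + \<delta> \<noteq> 0" "\<gamma> * w3 + \<delta> \<noteq> 0" "\<gamma> * w4 + \<delta> \<noteq> 0"
    and v: "v1 * (\<gamma> * w1 + \<delta>) = \<alpha> * w1 + \<beta>" "v2 * (\<gamma> * w2 + \<delta>) = \<alpha> * w2 + \<beta>"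
      "v3 * (\<gamma> * w3 + \<delta>) = \<alpha> * w3 + \<beta>" "v4 * (\<gamma> * w4 + \<delta>) = \<alpha> * w4 + \<beta>"
  shows "(v1 - v2) * (v3 - v4) * ((w1 - w3) * (w2 - w4)) = (v1 - v3) * (v2 - v4) * ((w1 - w2) * (w3 - w4))"
proof -
  define \<Delta> where "\<Delta> = \<alpha> * \<delta> - \<beta> * \<gamma>"
  have d: "(v - v') * ((\<gamma> * w + \<delta>) * (\<gamma> * w' + \<delta>)) = \<Delta> * (w - w')"
    if "v * (\<gamma> * w + \<delta>) = \<alpha> * w + \<beta>" "v' * (\<gamma> * w' + \<delta>) = \<alpha> * w' + \<beta>" for v v' w w'
  proof -
    have "(v - v') * ((\<gamma> * w + \<delta>) * (\<gamma> * w' + \<delta>)) =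
        (v * (\<gamma> * w + \<delta>)) * (\<gamma> * w' + \<delta>) - (v' * (\<gamma> * w' + \<delta>)) * (\<gamma> * w + \<delta>)"
      by (simp add: algebra_simps)
    also have "\<dots> = \<Delta> * (w - w')" unfolding that \<Delta>_def by (simp add: algebra_simps)
    finally show ?thesis .
  qed
  define D where "D = (\<gamma> * w1 + \<delta>) * (\<gamma> * w2 + \<delta>) * (\<gamma> * w3 + \<delta>) * (\<gamma> * w4 + \<delta>)"
  have D: "D \<noteq> 0" using nz by (simp add: D_def)
  have "D * ((v1 - v2) * (v3 - v4) * ((w1 - w3) * (w2 - w4))) =
      ((v1 - v2) * ((\<gamma> * w1 + \<delta>) * (\<gamma> * w2 + \<delta>))) * ((v3 - v4) * ((\<gamma> * w3 + \<delta>) * (\<gamma> * w4 + \<delta>))) * ((w1 - w3) * (w2 - w4))"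
    by (simp add: D_def)
  also have "\<dots> = (\<Delta> * (w1 - w2)) * (\<Delta> * (w3 - w4)) * ((w1 - w3) * (w2 - w4))"
    unfolding d[OF v(1,2)] d[OF v(3,4)] ..
  also have "\<dots> = (\<Delta> * (w1 - w3)) * (\<Delta> * (w2 - w4)) * ((w1 - w2) * (w3 - w4))" by simp
  also have "\<dots> = ((v1 - v3) * ((\<gamma> * w1 + \<delta>) * (\<gamma> * w3 + \<delta>))) * ((v2 - v4) * ((\<gamma> * w2 + \<delta>) * (\<gamma> * w4 + \<delta>))) * ((w1 - w2) * (w3 - w4))"
    unfolding d[OF v(1,3)] d[OF v(2,4)] ..
  also have "\<dots> = D * ((v1 - v3) * (v2 - v4) * ((w1 - w2) * (w3 - w4)))" by (simp add: D_def)
  finally show ?thesis using D by simp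
qed

lemma branch_infinite_range:
  assumes "branch p (ball b r) g" "r > 0"
  shows "infinite (g ` ball b r)"
proof
  assume "finite (g ` ball b r)"
  then have "finite (poly p ` g ` ball b r)" by simp
  moreover have "poly p ` g ` ball b r = ball b r" using assms by (force simp: branch_def)
  moreover have "infinite (ball b r)" using assms(2) uncountable_ball countable_finite by blast
  ultimately show False by simp
qed

lemma poly_eq_on_infinite:
  fixes P Q :: "complex poly"
  assumes "infinite S" "\<And>z. z \<in> S \<Longrightarrow> poly P z = poly Q z"
  shows "P = Q"
proof (rule ccontr)
  assume "P \<noteq> Q"
  then have "finite {z. poly (P - Q) z = 0}" by (intro poly_roots_finite) simp
  moreover have "S \<subseteq> {z. poly (P - Q) z = 0}" using assms(2) by auto
  ultimately show False using assms(1) finite_subset by blast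
qed

text \<open>The identity p(c + \<kappa>(w - c)) = p(w) holds for the infinitely many values w of
  \<open>g1\<close>, hence as an identity of polynomials.\<close>

lemma rotation_symmetry:
  assumes "branch p (ball b r) g1" "branch p (ball b r) g2" "r > 0"
    and lin: "\<And>s. s \<in> ball b r \<Longrightarrow> g2 s - c = \<kappa> * (g1 s - c)"
  shows "poly p (c + \<kappa> * z) = poly p (c + z)"
proof -
  have "pcompose p [:c - \<kappa> * c, \<kappa>:] = p"
  proof (rule poly_eq_on_infinite[OF branch_infinite_range[OF assms(1,3)]])
    fix w assume "w \<in> g1 ` ball b r"
    then obtain s where s: "s \<in> ball b r" "w = g1 s" by auto
    have "g2 s = c - \<kappa> * c + w * \<kappa>" using lin[OF s(1)] s(2) by (simp add: algebra_simps)
    then have "poly p (c - \<kappa> * c + w * \<kappa>) = s" using assms(2) s(1) by (metis branch_def)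
    moreover have "poly p w = s" using assms(1) s by (simp add: branch_def)
    ultimately show "poly (pcompose p [:c - \<kappa> * c, \<kappa>:]) w = poly p w" by (simp add: poly_pcompose)
  qed
  then have "poly (pcompose p [:c - \<kappa> * c, \<kappa>:]) (c + z) = poly p (c + z)" by simp
  moreover have "c - \<kappa> * c + (c + z) * \<kappa> = c + \<kappa> * z" by (simp add: algebra_simps)
  ultimately show ?thesis by (simp add: poly_pcompose)
qed

text \<open>The Moebius symmetry would have a finite pole z (where D vanishes), and the polynomial p would
  have to be infinite there.\<close>

lemma no_moebius_symmetry:
  assumes deg: "degree p > 0" and g: "branch p (ball b r) g1" "branch p (ball b r) g2" "r > 0"
    and rel: "\<And>s. s \<in> ball b r \<Longrightarrow> (g2 s - q1) * (g1 s - q2) = \<kappa> * ((g2 s - q2) * (g1 s - q1))"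
    and ne: "q1 \<noteq> q2" "\<kappa> \<noteq> 0" "\<kappa> \<noteq> 1"
  shows False
proof -
  \<comment> \<open>Solving the relation for \<open>g2\<close> gives the Moebius map g2 = N(g1) /
    D(g1).\<close>
  define D where "D = [:\<kappa> * q1 - q2, 1 - \<kappa>:]"
  define N where "N = [:\<kappa> * q2 * q1 - q1 * q2, q1 - \<kappa> * q2:]"
  let ?d = "degree p"
  have DN: "g2 s * poly D (g1 s) = poly N (g1 s)" if "s \<in> ball b r" for s
    using rel[OF that] by (simp add: D_def N_def algebra_simps)
  \<comment> \<open>\<open>H\<close> is p(N/D) with denominators cleared by D^d; at a root of D only
    its top term remains.\<close>
  define H where "H = (\<Sum>j\<le>?d. Polynomial.smult (poly.coeff p j) (N ^ j * D ^ (?d - j)))"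
  have "H = p * D ^ ?d"
  proof (rule poly_eq_on_infinite[OF branch_infinite_range[OF g(1,3)]])
    fix w assume "w \<in> g1 ` ball b r"
    then obtain s where s: "s \<in> ball b r" "w = g1 s" by auto
    have "poly H w = (\<Sum>j\<le>?d. poly.coeff p j * ((g2 s * poly D w) ^ j * poly D w ^ (?d - j)))"
      by (simp add: H_def poly_sum DN[OF s(1)] s(2))
    also have "\<dots> = (\<Sum>j\<le>?d. poly.coeff p j * g2 s ^ j * poly D w ^ ?d)"
      by (intro sum.cong) (auto simp: power_mult_distrib power_add[symmetric])
    also have "\<dots> = poly p (g2 s) * poly D w ^ ?d" by (simp add: poly_altdef sum_distrib_right)
    also have "poly p (g2 s) = poly p w" using g(1,2) s by (simp add: branch_def)
    finally show "poly H w = poly (p * D ^ ?d) w" by simp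
  qed
  define z where "z = (q2 - \<kappa> * q1) / (1 - \<kappa>)"
  have z: "(1 - \<kappa>) * z = q2 - \<kappa> * q1" using ne by (simp add: z_def)
  have Dz: "poly D z = 0" using z by (simp add: D_def algebra_simps)
  have "poly H z = poly.coeff p ?d * poly N z ^ ?d"
  proof -
    have "poly H z = (\<Sum>j\<le>?d. poly.coeff p j * (poly N z ^ j * 0 ^ (?d - j)))"
      by (simp add: H_def poly_sum Dz)
    also have "\<dots> = (\<Sum>j\<le>?d. if j = ?d then poly.coeff p ?d * poly N z ^ ?d else 0)"
      by (intro sum.cong) (auto simp: power_0_left)
    finally show ?thesis by simp
  qed
  moreover have "poly H z = 0" using \<open>H = p * D ^ ?d\<close> Dz deg by simp
  moreover have "poly.coeff p ?d \<noteq> 0" using deg by (metis degree_0 leading_coeff_0_iff less_numeral_extra(3))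
  ultimately have "poly N z = 0" by simp
  \<comment> \<open>Now N and D share the root z, so the determinant \<kappa> (q1 - q2)^2 of the
    Moebius map would have to vanish.\<close>
  then have "(1 - \<kappa>) * (\<kappa> * q2 * q1 - q1 * q2 + (q1 - \<kappa> * q2) * z) = 0" by (simp add: N_def algebra_simps)
  then have "(1 - \<kappa>) * (\<kappa> * q2 * q1 - q1 * q2) + (q1 - \<kappa> * q2) * ((1 - \<kappa>) * z) = 0" by (simp add: algebra_simps)
  then have "\<kappa> * (q1 - q2) * (q2 - q1) = 0" unfolding z by (simp add: algebra_simps)
  then show False using ne by simp
qed

section \<open>Three branches with an affine relation or a relation through a fixed point\<close>

definition tup3 :: "'a \<Rightarrow> 'a \<Rightarrow> 'a \<Rightarrow> 3 \<Rightarrow> 'a" where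
  "tup3 x y z i = (if i = 1 then x else if i = 2 then y else z)"

definition tup4 :: "'a \<Rightarrow> 'a \<Rightarrow> 'a \<Rightarrow> 'a \<Rightarrow> 4 \<Rightarrow> 'a" where
  "tup4 x y z w i = (if i = 1 then x else if i = 2 then y else if i = 3 then z else w)"

lemma tup3_simps [simp]: "tup3 x y z 1 = x" "tup3 x y z 2 = y" "tup3 x y z 3 = z"
  by (simp_all add: tup3_def)

lemma tup4_simps [simp]: "tup4 x y z w 1 = x" "tup4 x y z w 2 = y" "tup4 x y z w 3 = z" "tup4 x y z w 4 = w"
  by (simp_all add: tup4_def)

lemma tup3_apply: "tup3 f g h i s = tup3 (f s) (g s) (h s) i"
  by (simp add: tup3_def)

lemma tup4_apply: "tup4 f g h k i s = tup4 (f s) (g s) (h s) (k s) i"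
  by (simp add: tup4_def)

lemma inj_tup3: "x \<noteq> y \<Longrightarrow> x \<noteq> z \<Longrightarrow> y \<noteq> z \<Longrightarrow> inj (\<lambda>i. tup3 x y z i)"
  unfolding inj_def forall_3 by auto

lemma inj_tup4: "x \<noteq> y \<Longrightarrow> x \<noteq> z \<Longrightarrow> x \<noteq> w \<Longrightarrow> y \<noteq> z \<Longrightarrow> y \<noteq> w \<Longrightarrow> z \<noteq> w \<Longrightarrow> inj (\<lambda>i. tup4 x y z w i)"
  unfolding inj_def forall_4 by auto

text \<open>The relation is homogeneous and invariant under translation, so it passes unchanged to
  the limiting directions, as \<open>three_branches\<close> requires.\<close>

lemma triple_affine:
  assumes deg: "degree p > 0"
    and r: "r > 0" and reg: "\<And>s. s \<in> ball b r \<Longrightarrow> regular_value p s"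
    and g: "branch p (ball b r) g1" "branch p (ball b r) g2" "branch p (ball b r) g3"
    and dist: "\<And>s. s \<in> ball b r \<Longrightarrow> g1 s \<noteq> g2 s \<and> g1 s \<noteq> g3 s \<and> g2 s \<noteq> g3 s"
    and rel: "\<And>s. s \<in> ball b r \<Longrightarrow> g1 s - g3 s = \<mu> * (g1 s - g2 s)"
  shows "\<exists>z. \<forall>s\<in>ball b r. g2 s - poly_center p = z * (g1 s - poly_center p)"
proof -
  define R where "R y = (y 1 - y 3) - \<mu> * (y 1 - y 2)" for y :: "3 \<Rightarrow> complex"
  have hR: "holomorphic_rel R" unfolding holomorphic_rel_def R_def by (intro allI impI holomorphic_intros) auto
  have "g2 s - poly_center p = (1 - \<mu>) * cnj \<mu> / (\<mu> * (1 - cnj \<mu>)) * (g1 s - poly_center p)" if "s \<in> ball b r" for s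
  proof -
    have "tup3 g1 g2 g3 2 s - poly_center p = (1 - \<mu>) * cnj \<mu> / (\<mu> * (1 - cnj \<mu>)) * (tup3 g1 g2 g3 1 s - poly_center p)"
    proof (rule three_branches[OF deg hR r reg _ _ _ _ that])
      show "branch p (ball b r) (tup3 g1 g2 g3 i)" for i using g by (simp add: tup3_def)
      show "inj (\<lambda>i. tup3 g1 g2 g3 i s)" if "s \<in> ball b r" for s
        unfolding tup3_apply using dist[OF that] by (intro inj_tup3) auto
      show "R (\<lambda>i. tup3 g1 g2 g3 i s) = 0" if "s \<in> ball b r" for s
        using rel[OF that] by (simp add: R_def)
      fix y :: "nat \<Rightarrow> 3 \<Rightarrow> complex" and c \<zeta>
      assume y: "\<And>n. R (y n) = 0" "\<And>i. (\<lambda>n. (y n i - c) / (y n 1 - c)) \<longlonglongrightarrow> \<zeta> i" and \<zeta>: "\<zeta> 1 = 1"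
      define u where "u n i = (y n i - c) * inverse (y n 1 - c)" for n i
      have u: "(\<lambda>n. u n i) \<longlonglongrightarrow> \<zeta> i" for i using y(2)[of i] by (simp add: u_def divide_inverse)
      have "(u n 1 - u n 3) - \<mu> * (u n 1 - u n 2) = R (y n) * inverse (y n 1 - c)" for n
        by (simp add: u_def R_def algebra_simps)
      then have "(u n 1 - u n 3) - \<mu> * (u n 1 - u n 2) = 0" for n using y(1) by simp
      moreover have "(\<lambda>n. (u n 1 - u n 3) - \<mu> * (u n 1 - u n 2)) \<longlonglongrightarrow> (\<zeta> 1 - \<zeta> 3) - \<mu> * (\<zeta> 1 - \<zeta> 2)"
        by (intro tendsto_intros u)
      ultimately show "1 - \<zeta> 3 = \<mu> * (1 - \<zeta> 2)" using \<zeta> by (simp add: LIMSEQ_const_iff)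
    qed
    then show ?thesis by simp
  qed
  then show ?thesis by blast
qed

text \<open>The point q stays put while the branches escape, so in the limit it merges with the
  centre. The resulting relation between directions is not affine, but its conjugate multiplied by
  \<zeta> 2 and \<zeta> 3 is; hence the conjugate ratio \<open>\<nu>\<close>.\<close>

lemma triple_pointed:
  assumes deg: "degree p > 0"
    and r: "r > 0" and reg: "\<And>s. s \<in> ball b r \<Longrightarrow> regular_value p s"
    and g: "branch p (ball b r) g1" "branch p (ball b r) g2" "branch p (ball b r) g3"
    and dist: "\<And>s. s \<in> ball b r \<Longrightarrow> g1 s \<noteq> g2 s \<and> g1 s \<noteq> g3 s \<and> g2 s \<noteq> g3 s"
    and rel: "\<And>s. s \<in> ball b r \<Longrightarrow> (g1 s - g3 s) * (g2 s - q) = \<mu> * ((g1 s - g2 s) * (g3 s - q))"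
  shows "\<exists>z. \<forall>s\<in>ball b r. g2 s - poly_center p = z * (g1 s - poly_center p)"
proof -
  define R where "R y = (y 1 - y 3) * (y 2 - q) - \<mu> * ((y 1 - y 2) * (y 3 - q))" for y :: "3 \<Rightarrow> complex"
  define \<nu> where "\<nu> = cnj \<mu>"
  have hR: "holomorphic_rel R" unfolding holomorphic_rel_def R_def by (intro allI impI holomorphic_intros) auto
  have "g2 s - poly_center p = (1 - \<nu>) * cnj \<nu> / (\<nu> * (1 - cnj \<nu>)) * (g1 s - poly_center p)" if "s \<in> ball b r" for s
  proof -
    have "tup3 g1 g2 g3 2 s - poly_center p = (1 - \<nu>) * cnj \<nu> / (\<nu> * (1 - cnj \<nu>)) * (tup3 g1 g2 g3 1 s - poly_center p)"
    proof (rule three_branches[OF deg hR r reg _ _ _ _ that])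
      show "branch p (ball b r) (tup3 g1 g2 g3 i)" for i using g by (simp add: tup3_def)
      show "inj (\<lambda>i. tup3 g1 g2 g3 i s)" if "s \<in> ball b r" for s
        unfolding tup3_apply using dist[OF that] by (intro inj_tup3) auto
      show "R (\<lambda>i. tup3 g1 g2 g3 i s) = 0" if "s \<in> ball b r" for s
        using rel[OF that] by (simp add: R_def)
      fix y :: "nat \<Rightarrow> 3 \<Rightarrow> complex" and c \<zeta>
      assume y: "\<And>n. R (y n) = 0" "\<And>i. (\<lambda>n. (y n i - c) / (y n 1 - c)) \<longlonglongrightarrow> \<zeta> i" and \<zeta>: "\<zeta> 1 = 1" "\<And>i. norm (\<zeta> i) = 1"
        and inf: "filterlim (\<lambda>n. y n 1) at_infinity sequentially"
      define w where "w n = inverse (y n 1 - c)" for n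
      define u where "u n i = (y n i - c) * w n" for n i
      have u: "(\<lambda>n. u n i) \<longlonglongrightarrow> \<zeta> i" for i using y(2)[of i] by (simp add: u_def w_def divide_inverse)
      have w: "w \<longlonglongrightarrow> 0"
        using filterlim_compose[OF tendsto_inverse_0 filterlim_shift_at_infinity[OF inf, of c]] by (simp add: w_def[abs_def])
      have "(u n 1 - u n 3) * (u n 2 + (c - q) * w n) - \<mu> * ((u n 1 - u n 2) * (u n 3 + (c - q) * w n)) = R (y n) * (w n * w n)" for n
        by (simp add: u_def R_def algebra_simps)
      then have "(u n 1 - u n 3) * (u n 2 + (c - q) * w n) - \<mu> * ((u n 1 - u n 2) * (u n 3 + (c - q) * w n)) = 0" for n using y(1) by simp
      moreover have "(\<lambda>n. (u n 1 - u n 3) * (u n 2 + (c - q) * w n) - \<mu> * ((u n 1 - u n 2) * (u n 3 + (c - q) * w n)))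
          \<longlonglongrightarrow> (\<zeta> 1 - \<zeta> 3) * (\<zeta> 2 + (c - q) * 0) - \<mu> * ((\<zeta> 1 - \<zeta> 2) * (\<zeta> 3 + (c - q) * 0))"
        by (intro tendsto_intros u w)
      ultimately have e: "(1 - \<zeta> 3) * \<zeta> 2 = \<mu> * ((1 - \<zeta> 2) * \<zeta> 3)" using \<zeta> by (simp add: LIMSEQ_const_iff)
      have n: "\<zeta> i * cnj (\<zeta> i) = 1" for i using \<zeta>(2)[of i] by (simp add: complex_norm_square[symmetric])
      have "(1 - cnj (\<zeta> 3)) * cnj (\<zeta> 2) = \<nu> * ((1 - cnj (\<zeta> 2)) * cnj (\<zeta> 3))"
        using arg_cong[OF e, of cnj] by (simp add: \<nu>_def)
      then have "\<zeta> 2 * \<zeta> 3 * ((1 - cnj (\<zeta> 3)) * cnj (\<zeta> 2)) = \<zeta> 2 * \<zeta> 3 * (\<nu> * ((1 - cnj (\<zeta> 2)) * cnj (\<zeta> 3)))"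
        by simp
      moreover have "\<zeta> 2 * \<zeta> 3 * ((1 - cnj (\<zeta> 3)) * cnj (\<zeta> 2)) = (\<zeta> 2 * cnj (\<zeta> 2)) * (\<zeta> 3 - \<zeta> 3 * cnj (\<zeta> 3))"
        by (simp add: algebra_simps)
      moreover have "\<zeta> 2 * \<zeta> 3 * (\<nu> * ((1 - cnj (\<zeta> 2)) * cnj (\<zeta> 3))) = \<nu> * ((\<zeta> 3 * cnj (\<zeta> 3)) * (\<zeta> 2 - \<zeta> 2 * cnj (\<zeta> 2)))"
        by (simp add: algebra_simps)
      ultimately have "(\<zeta> 2 * cnj (\<zeta> 2)) * (\<zeta> 3 - \<zeta> 3 * cnj (\<zeta> 3)) = \<nu> * ((\<zeta> 3 * cnj (\<zeta> 3)) * (\<zeta> 2 - \<zeta> 2 * cnj (\<zeta> 2)))"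
        by simp
      then have "\<zeta> 3 - 1 = \<nu> * (\<zeta> 2 - 1)" unfolding n by simp
      then show "1 - \<zeta> 3 = \<nu> * (1 - \<zeta> 2)" by (simp add: algebra_simps)
    qed
    then show ?thesis by simp
  qed
  then show ?thesis by blast
qed

section \<open>Constant cross ratios force rotational symmetry\<close>

lemma fresh_element:
  assumes "finite A" "card A < card E"
  shows "\<exists>x\<in>E. x \<notin> A"
  using assms by (meson card_mono not_less subsetI)

lemma mult_eq_imp_quotient:
  fixes a b :: "'a::field"
  assumes "a * X = b * Y" "a \<noteq> 0"
  shows "X = (b / a) * Y"
  using assms by (simp add: field_simps)

text \<open>The points of \<open>E\<close> move with \<open>s\<close>, those of \<open>Q\<close> and
  possibly infinity stay, and the map in \<open>mob\<close> undoes the motion. Each fixed point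
  replaces one branch in a cross ratio, so \<open>count\<close> leaves enough branches: four if
  nothing is fixed, three with one fixed point, two with two.\<close>

lemma moebius_fixed_branches:
  fixes p :: "complex poly" and E Q :: "complex set" and br :: "complex \<Rightarrow> complex \<Rightarrow> complex"
  assumes deg: "degree p > 0" and r: "r > 0" and reg: "\<And>s. s \<in> ball b r \<Longrightarrow> regular_value p s"
    and br: "\<And>x. x \<in> E \<Longrightarrow> branch p (ball b r) (br x)"
    and brb: "\<And>x. x \<in> E \<Longrightarrow> br x b = x"
    and dist: "\<And>s x x'. s \<in> ball b r \<Longrightarrow> x \<in> E \<Longrightarrow> x' \<in> E \<Longrightarrow> br x s = br x' s \<Longrightarrow> x = x'"
    and fin: "finite E" "E \<noteq> {}" "finite Q" and Q: "\<And>q. q \<in> Q \<Longrightarrow> poly p q \<noteq> b"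
    and count: "card E + card Q + (if fixinf then 1 else 0) \<ge> 4"
    and mob: "\<And>s. s \<in> ball b r \<Longrightarrow> \<exists>\<alpha> \<beta> \<gamma> \<delta>. \<alpha> * \<delta> - \<beta> * \<gamma> \<noteq> 0 \<and>
      (\<forall>x\<in>E. \<gamma> * br x s + \<delta> \<noteq> 0 \<and> x * (\<gamma> * br x s + \<delta>) = \<alpha> * br x s + \<beta>) \<and>
      (\<forall>q\<in>Q. \<gamma> * q + \<delta> \<noteq> 0 \<and> q * (\<gamma> * q + \<delta>) = \<alpha> * q + \<beta>) \<and> (fixinf \<longrightarrow> \<gamma> = 0)"
  shows "\<exists>c. Q \<subseteq> {c} \<and> (\<forall>x\<in>E. \<forall>x'\<in>E. \<exists>\<kappa>. x' - c = \<kappa> * (x - c) \<and> (\<forall>z. poly p (c + \<kappa> * z) = poly p (c + z)))"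
proof -
  have bb: "b \<in> ball b r" using r by simp
  have pE: "poly p x = b" if "x \<in> E" for x using br[OF that] brb[OF that] bb by (metis branch_def)
  have EQ: "x \<noteq> q" if "x \<in> E" "q \<in> Q" for x q using pE[OF that(1)] Q[OF that(2)] by auto
  \<comment> \<open>A single motion, trivial on \<open>Q\<close>, lets one identity cover every
    mixture of moving and fixed points.\<close>
  define m where "m x s = (if x \<in> E then br x s else x)" for x s
  have mE: "m x s = br x s" if "x \<in> E" for x s using that by (simp add: m_def)
  have mQ: "m q s = q" if "q \<in> Q" for q s using EQ that by (auto simp: m_def)
  have mob': "\<exists>\<alpha> \<beta> \<gamma> \<delta>. \<alpha> * \<delta> - \<beta> * \<gamma> \<noteq> 0 \<and>
      (\<forall>x\<in>E \<union> Q. \<gamma> * m x s + \<delta> \<noteq> 0 \<and> x * (\<gamma> * m x s + \<delta>) = \<alpha> * m x s + \<beta>) \<and> (fixinf \<longrightarrow> \<gamma> = 0)"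
    if "s \<in> ball b r" for s
    using mob[OF that] mE mQ by (metis UnE)
  have cross: "(v1 - v2) * (v3 - v4) * ((m v1 s - m v3 s) * (m v2 s - m v4 s)) =
      (v1 - v3) * (v2 - v4) * ((m v1 s - m v2 s) * (m v3 s - m v4 s))"
    if s: "s \<in> ball b r" and v: "v1 \<in> E \<union> Q" "v2 \<in> E \<union> Q" "v3 \<in> E \<union> Q" "v4 \<in> E \<union> Q" for s v1 v2 v3 v4
  proof -
    obtain \<alpha> \<beta> \<gamma> \<delta> where det: "\<alpha> * \<delta> - \<beta> * \<gamma> \<noteq> 0"
      and *: "\<And>x. x \<in> E \<union> Q \<Longrightarrow> \<gamma> * m x s + \<delta> \<noteq> 0" "\<And>x. x \<in> E \<union> Q \<Longrightarrow> x * (\<gamma> * m x s + \<delta>) = \<alpha> * m x s + \<beta>"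
      using mob'[OF s] by blast
    show ?thesis by (rule cross_ratio_relation[OF det]) (use * v in auto)
  qed
  have aff: "(v1 - v3) * (m v1 s - m v2 s) = (v1 - v2) * (m v1 s - m v3 s)"
    if s: "s \<in> ball b r" and v: "v1 \<in> E \<union> Q" "v2 \<in> E \<union> Q" "v3 \<in> E \<union> Q" and fixinf for s v1 v2 v3
  proof -
    obtain \<alpha> \<beta> \<gamma> \<delta> where det: "\<alpha> * \<delta> - \<beta> * \<gamma> \<noteq> 0" and \<gamma>: "\<gamma> = 0"
      and *: "\<And>x. x \<in> E \<union> Q \<Longrightarrow> x * (\<gamma> * m x s + \<delta>) = \<alpha> * m x s + \<beta>"
      using mob'[OF s] \<open>fixinf\<close> by blast
    show ?thesis
      by (rule affine_relation[of \<alpha> \<delta> _ _ \<beta>]) (use det \<gamma> *[OF v(1)] *[OF v(2)] *[OF v(3)] in auto)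
  qed
  have moving: "\<exists>s\<in>ball b r. br x s \<noteq> x" if "x \<in> E" for x
  proof (rule ccontr)
    assume "\<not> ?thesis"
    then have "br x ` ball b r \<subseteq> {x}" by auto
    then show False using branch_infinite_range[OF br[OF that] r] finite_subset by blast
  qed
  obtain x0 where x0: "x0 \<in> E" using fin(2) by blast
  \<comment> \<open>Every surviving case ends here: a linear relation between branches about c is a
    symmetry of p, and evaluating it at \<open>b\<close> relates the points of \<open>E\<close>
    themselves.\<close>
  have finish: ?thesis
    if Qc: "Q \<subseteq> {c}" and lin: "\<And>x x'. x \<in> E \<Longrightarrow> x' \<in> E \<Longrightarrow> x \<noteq> x' \<Longrightarrow>
      \<exists>z. \<forall>s\<in>ball b r. br x' s - c = z * (br x s - c)" for c
  proof (rule exI[of _ c], intro conjI ballI Qc)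
    fix x x' assume x: "x \<in> E" "x' \<in> E"
    show "\<exists>\<kappa>. x' - c = \<kappa> * (x - c) \<and> (\<forall>z. poly p (c + \<kappa> * z) = poly p (c + z))"
    proof (cases "x = x'")
      case False
      then obtain \<kappa> where \<kappa>: "\<And>s. s \<in> ball b r \<Longrightarrow> br x' s - c = \<kappa> * (br x s - c)" using lin[OF x] by blast
      have "poly p (c + \<kappa> * z) = poly p (c + z)" for z
        by (rule rotation_symmetry[OF br[OF x(1)] br[OF x(2)] r \<kappa>])
      then show ?thesis using \<kappa>[OF bb] brb x by auto
    qed (auto intro: exI[of _ 1])
  qed
  \<comment> \<open>A Moebius map with three fixed points is the identity, whereas by
    \<open>moving\<close> the point \<open>x0\<close> is really displaced for some
    \<open>s\<close>.\<close>
  have Q2: "card Q \<le> 2"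
  proof (rule ccontr)
    assume c: "\<not> card Q \<le> 2"
    obtain q1 where q1: "q1 \<in> Q" using fresh_element[of "{}" Q] c by auto
    obtain q2 where q2: "q2 \<in> Q" "q2 \<noteq> q1" using fresh_element[of "{q1}" Q] c by auto
    obtain q3 where q3: "q3 \<in> Q" "q3 \<noteq> q1" "q3 \<noteq> q2" using fresh_element[of "{q1, q2}" Q] c q2 by auto
    obtain s where s: "s \<in> ball b r" "br x0 s \<noteq> x0" using moving[OF x0] by blast
    let ?w = "br x0 s"
    have "(q1 - q2) * (q3 - x0) * ((q1 - q3) * (q2 - ?w)) = (q1 - q3) * (q2 - x0) * ((q1 - q2) * (q3 - ?w))"
      using cross[OF s(1), of q1 q2 q3 x0] q1 q2 q3 x0 by (simp add: mE mQ)
    then have "((q1 - q2) * (q1 - q3)) * ((q3 - x0) * (q2 - ?w) - (q2 - x0) * (q3 - ?w)) = 0" by (simp add: algebra_simps)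
    then have "(q3 - x0) * (q2 - ?w) - (q2 - x0) * (q3 - ?w) = 0" using q2 q3 by auto
    then have "(q2 - q3) * (?w - x0) = 0" by (simp add: algebra_simps)
    then show False using q3 s by auto
  qed
  have Q1: "card Q \<le> 1" if fi: fixinf
  proof (rule ccontr)
    assume c: "\<not> card Q \<le> 1"
    obtain q1 where q1: "q1 \<in> Q" using fresh_element[of "{}" Q] c by auto
    obtain q2 where q2: "q2 \<in> Q" "q2 \<noteq> q1" using fresh_element[of "{q1}" Q] c by auto
    obtain s where s: "s \<in> ball b r" "br x0 s \<noteq> x0" using moving[OF x0] by blast
    have "(q1 - x0) * (q1 - q2) = (q1 - q2) * (q1 - br x0 s)"
      using aff[OF s(1), of q1 q2 x0] q1 q2 x0 fi by (simp add: mE mQ)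
    then have "(q1 - q2) * (br x0 s - x0) = 0" by (simp add: algebra_simps)
    then show False using q2 s by auto
  qed
  have distE: "br x s \<noteq> br x' s" if "x \<in> E" "x' \<in> E" "x \<noteq> x'" "s \<in> ball b r" for x x' s
    using dist that by blast
  consider (two) "card Q = 2" "\<not> fixinf" | (one) q where "Q = {q}" | (none) "Q = {}"
    using Q2 Q1 fin(3) by (metis One_nat_def card_0_eq card_1_singletonE le_Suc_eq le_zero_eq numeral_2_eq_2 not_less_eq_eq)
  then show ?thesis
  proof cases
    case two
    obtain q1 q2 where q: "q1 \<in> Q" "q2 \<in> Q" "q1 \<noteq> q2" using two(1) by (auto simp: card_2_iff)
    have c2: "card E \<ge> 2" using count two by simp
    obtain x where x: "x \<in> E" "x \<noteq> x0" using fresh_element[of "{x0}" E] c2 by auto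
    \<comment> \<open>In the coordinate (w - q1) / (w - q2) a Moebius map fixing both points is a
      multiplication. Thus the ratio of the coordinates of two branches is independent of
      \<open>s\<close>, and \<open>\<kappa>\<close> is its value at \<open>b\<close>.\<close>
    define \<kappa> where "\<kappa> = (x - q1) * (q2 - x0) / ((x - q2) * (q1 - x0))"
    have nz: "x - q1 \<noteq> 0" "q2 - x0 \<noteq> 0" "x - q2 \<noteq> 0" "q1 - x0 \<noteq> 0" using EQ x x0 q by auto
    have False
    proof (rule no_moebius_symmetry[OF deg br[OF x0] br[OF x(1)] r _ q(3), of \<kappa>])
      fix s assume s: "s \<in> ball b r"
      have "(x - q1) * (q2 - x0) * ((br x s - q2) * (q1 - br x0 s)) = (x - q2) * (q1 - x0) * ((br x s - q1) * (q2 - br x0 s))"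
        using cross[OF s, of x q1 q2 x0] x x0 q by (simp add: mE mQ)
      from mult_eq_imp_quotient[OF this[symmetric]]
      have "(br x s - q1) * (q2 - br x0 s) = \<kappa> * ((br x s - q2) * (q1 - br x0 s))"
        using nz by (simp add: \<kappa>_def)
      then show "(br x s - q1) * (br x0 s - q2) = \<kappa> * ((br x s - q2) * (br x0 s - q1))"
        by (simp add: algebra_simps)
    next
      show "\<kappa> \<noteq> 0" using nz by (simp add: \<kappa>_def)
      show "\<kappa> \<noteq> 1"
      proof
        assume "\<kappa> = 1"
        then have "(x - q1) * (q2 - x0) = (x - q2) * (q1 - x0)" using nz by (simp add: \<kappa>_def)
        then have "(q2 - q1) * (x - x0) = 0" by (simp add: algebra_simps)
        then show False using q x by auto
      qed
    qed
    then show ?thesis ..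
  next
    case (one q)
    show ?thesis
    proof (cases fixinf)
      case True
      \<comment> \<open>A Moebius map fixing q and infinity is a scaling about q, so q itself is the
        centre and no limit at infinity is needed.\<close>
      show ?thesis
      proof (rule finish[of q])
        fix x x' assume x: "x \<in> E" "x' \<in> E"
        have nz: "q - x \<noteq> 0" using EQ[OF x(1), of q] one by simp
        have "br x' s - q = ((q - x') / (q - x)) * (br x s - q)" if s: "s \<in> ball b r" for s
        proof -
          have "(q - x') * (q - br x s) = (q - x) * (q - br x' s)"
            using aff[OF s, of q x x'] x one True by (simp add: mE mQ)
          then show ?thesis using nz by (simp add: field_simps)
        qed
        then show "\<exists>z. \<forall>s\<in>ball b r. br x' s - q = z * (br x s - q)" by blast
      qed (simp add: one)
    next
      case False
      let ?c = "poly_center p"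
      have c3: "card E \<ge> 3" using count False one by simp
      have rel: "\<exists>\<mu>. \<forall>s\<in>ball b r. (br x1 s - br x3 s) * (br x2 s - q) = \<mu> * ((br x1 s - br x2 s) * (br x3 s - q))"
        if x: "x1 \<in> E" "x2 \<in> E" "x3 \<in> E" "x1 \<noteq> x2" "x1 \<noteq> x3" "x2 \<noteq> x3" for x1 x2 x3
      proof (intro exI ballI)
        fix s assume s: "s \<in> ball b r"
        have nz: "x1 - x2 \<noteq> 0" "x3 - q \<noteq> 0" using x EQ[OF x(3), of q] one by auto
        have "(x1 - x2) * (x3 - q) * ((br x1 s - br x3 s) * (br x2 s - q)) = (x1 - x3) * (x2 - q) * ((br x1 s - br x2 s) * (br x3 s - q))"
          using cross[OF s, of x1 x2 x3 q] x one by (simp add: mE mQ)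
        then show "(br x1 s - br x3 s) * (br x2 s - q) = ((x1 - x3) * (x2 - q) / ((x1 - x2) * (x3 - q))) * ((br x1 s - br x2 s) * (br x3 s - q))"
          by (rule mult_eq_imp_quotient) (use nz in simp)
      qed
      have lin: "\<exists>z. \<forall>s\<in>ball b r. br x2 s - ?c = z * (br x1 s - ?c)" if x: "x1 \<in> E" "x2 \<in> E" "x1 \<noteq> x2" for x1 x2
      proof -
        obtain x3 where x3: "x3 \<in> E" "x3 \<noteq> x1" "x3 \<noteq> x2" using fresh_element[of "{x1, x2}" E] c3 x(3) by auto
        obtain \<mu> where \<mu>: "\<And>s. s \<in> ball b r \<Longrightarrow> (br x1 s - br x3 s) * (br x2 s - q) = \<mu> * ((br x1 s - br x2 s) * (br x3 s - q))"
          using rel[of x1 x2 x3] x x3 by metis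
        show ?thesis
          by (rule triple_pointed[OF deg r reg br[OF x(1)] br[OF x(2)] br[OF x3(1)] _ \<mu>]) (use distE x x3 in auto)
      qed
      have "q = ?c"
      proof (rule ccontr)
        assume qc: "q \<noteq> ?c"
        define e where "e = ?c - q"
        have e: "e \<noteq> 0" using qc by (simp add: e_def)
        obtain x2 where x2: "x2 \<in> E" "x2 \<noteq> x0" using fresh_element[of "{x0}" E] c3 by auto
        obtain x3 where x3: "x3 \<in> E" "x3 \<noteq> x0" "x3 \<noteq> x2" using fresh_element[of "{x0, x2}" E] c3 x2(2) by auto
        obtain z2 where z2: "\<And>s. s \<in> ball b r \<Longrightarrow> br x2 s - ?c = z2 * (br x0 s - ?c)" using lin[of x0 x2] x0 x2 by metis
        obtain z3 where z3: "\<And>s. s \<in> ball b r \<Longrightarrow> br x3 s - ?c = z3 * (br x0 s - ?c)" using lin[of x0 x3] x0 x3 by metis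
        obtain \<mu> where \<mu>: "\<And>s. s \<in> ball b r \<Longrightarrow> (br x0 s - br x3 s) * (br x2 s - q) = \<mu> * ((br x0 s - br x2 s) * (br x3 s - q))"
          using rel[of x0 x2 x3] x0 x2 x3 by metis
        have z31: "z3 \<noteq> 1" using z3[OF bb] distE[OF x3(1) x0 x3(2) bb] by auto
        have z32: "z3 \<noteq> z2" using z3[OF bb] z2[OF bb] distE[OF x3(1) x2(1) x3(3) bb] by (metis diff_add_cancel)
        \<comment> \<open>With the linear formulas for the branches inserted, \<open>P\<close> is
          the difference of the two sides of the relation as a polynomial in A = br x0 s - c. Its
          vanishing coefficients give first 1 - z3 = \<mu> (1 - z2), as e is nonzero, and then z2 =
          z3.\<close>
        define P where "P = [:0, (1 - z3) * e - \<mu> * ((1 - z2) * e), (1 - z3) * z2 - \<mu> * ((1 - z2) * z3):]"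
        have "P = 0"
        proof (rule poly_eq_on_infinite)
          have "(\<lambda>w. w + ?c) ` (\<lambda>s. br x0 s - ?c) ` ball b r = br x0 ` ball b r" by (auto simp: image_image)
          then show "infinite ((\<lambda>s. br x0 s - ?c) ` ball b r)"
            using branch_infinite_range[OF br[OF x0] r] by (metis finite_imageI)
          fix A assume "A \<in> (\<lambda>s. br x0 s - ?c) ` ball b r"
          then obtain s where s: "s \<in> ball b r" "A = br x0 s - ?c" by auto
          have 1: "br x0 s = ?c + A" "br x2 s = ?c + z2 * A" "br x3 s = ?c + z3 * A"
            using s(2) z2[OF s(1), folded s(2)] z3[OF s(1), folded s(2)] by (simp_all add: diff_eq_eq add.commute)
          have "(?c + A - (?c + z3 * A)) * (?c + z2 * A - q) = \<mu> * ((?c + A - (?c + z2 * A)) * (?c + z3 * A - q))"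
            using \<mu>[OF s(1)] unfolding 1 .
          then have "((1 - z3) * A) * (z2 * A + e) = \<mu> * (((1 - z2) * A) * (z3 * A + e))"
            by (simp add: e_def algebra_simps)
          then show "poly P A = poly 0 A" by (simp add: P_def algebra_simps)
        qed
        then have 2: "(1 - z3) * e = \<mu> * ((1 - z2) * e)" "(1 - z3) * z2 = \<mu> * ((1 - z2) * z3)" by (auto simp: P_def)
        then have 3: "1 - z3 = \<mu> * (1 - z2)" using e by simp
        have "(1 - z3) * z2 = (1 - z3) * z3" using 2(2) unfolding 3 by simp
        then show False using z31 z32 by simp
      qed
      then show ?thesis using finish[of ?c] lin one by blast
    qed
  next
    case none
    let ?c = "poly_center p"
    show ?thesis
    proof (rule finish[of ?c])
      fix x1 x2 assume x: "x1 \<in> E" "x2 \<in> E" "x1 \<noteq> x2"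
      have "\<exists>x3\<in>E. x3 \<noteq> x1 \<and> x3 \<noteq> x2 \<and> (\<exists>\<mu>. \<forall>s\<in>ball b r. br x1 s - br x3 s = \<mu> * (br x1 s - br x2 s))"
      proof (cases fixinf)
        case True
        have c3: "card E \<ge> 3" using count True none by simp
        obtain x3 where x3: "x3 \<in> E" "x3 \<noteq> x1" "x3 \<noteq> x2" using fresh_element[of "{x1, x2}" E] c3 x(3) by auto
        have "br x1 s - br x3 s = ((x1 - x3) / (x1 - x2)) * (br x1 s - br x2 s)" if s: "s \<in> ball b r" for s
          using aff[OF s, of x1 x2 x3] x x3 True by (simp add: mE field_simps)
        then show ?thesis using x3 by blast
      next
        case False
        have c4: "card E \<ge> 4" using count False none by simp
        obtain x3 where x3: "x3 \<in> E" "x3 \<noteq> x1" "x3 \<noteq> x2" using fresh_element[of "{x1, x2}" E] c4 x(3) by auto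
        obtain x4 where x4: "x4 \<in> E" "x4 \<noteq> x1" "x4 \<noteq> x2" "x4 \<noteq> x3"
          using fresh_element[of "{x1, x2, x3}" E] c4 x(3) x3 by auto
        \<comment> \<open>Without a fixed point only the cross ratio of four branches is available;
          \<open>four_branches\<close> improves it to an affine ratio of three.\<close>
        define \<kappa> where "\<kappa> = (x1 - x2) * (x3 - x4) / ((x1 - x3) * (x2 - x4))"
        have nz: "x1 - x3 \<noteq> 0" "x2 - x4 \<noteq> 0" using x x3 x4 by auto
        have "\<exists>\<mu>. \<forall>s\<in>ball b r. tup4 (br x1) (br x2) (br x3) (br x4) 1 s - tup4 (br x1) (br x2) (br x3) (br x4) 3 s
            = \<mu> * (tup4 (br x1) (br x2) (br x3) (br x4) 1 s - tup4 (br x1) (br x2) (br x3) (br x4) 2 s)"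
        proof (rule four_branches[OF deg r reg, where \<kappa> = \<kappa>])
          show "branch p (ball b r) (tup4 (br x1) (br x2) (br x3) (br x4) i)" for i
            using br x x3 x4 by (simp add: tup4_def)
          show "inj (\<lambda>i. tup4 (br x1) (br x2) (br x3) (br x4) i s)" if "s \<in> ball b r" for s
            unfolding tup4_apply using distE[OF _ _ _ that] x x3 x4 by (intro inj_tup4) auto
          fix s assume s: "s \<in> ball b r"
          have "(x1 - x2) * (x3 - x4) * ((br x1 s - br x3 s) * (br x2 s - br x4 s)) =
            (x1 - x3) * (x2 - x4) * ((br x1 s - br x2 s) * (br x3 s - br x4 s))"
            using cross[OF s, of x1 x2 x3 x4] x x3 x4 by (simp add: mE)
          then have "(br x1 s - br x2 s) * (br x3 s - br x4 s) = \<kappa> * ((br x1 s - br x3 s) * (br x2 s - br x4 s))"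
            unfolding \<kappa>_def by (intro mult_eq_imp_quotient[OF sym]) (use nz in auto)
          then show "(tup4 (br x1) (br x2) (br x3) (br x4) 1 s - tup4 (br x1) (br x2) (br x3) (br x4) 2 s) *
            (tup4 (br x1) (br x2) (br x3) (br x4) 3 s - tup4 (br x1) (br x2) (br x3) (br x4) 4 s) =
            \<kappa> * ((tup4 (br x1) (br x2) (br x3) (br x4) 1 s - tup4 (br x1) (br x2) (br x3) (br x4) 3 s) *
            (tup4 (br x1) (br x2) (br x3) (br x4) 2 s - tup4 (br x1) (br x2) (br x3) (br x4) 4 s))" by simp
        qed
        then show ?thesis using x3 by (auto simp del: mem_ball)
      qed
      then obtain x3 \<mu> where x3: "x3 \<in> E" "x3 \<noteq> x1" "x3 \<noteq> x2"
        and \<mu>: "\<And>s. s \<in> ball b r \<Longrightarrow> br x1 s - br x3 s = \<mu> * (br x1 s - br x2 s)" by blast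
      show "\<exists>z. \<forall>s\<in>ball b r. br x2 s - ?c = z * (br x1 s - ?c)"
        by (rule triple_affine[OF deg r reg br[OF x(1)] br[OF x(2)] br[OF x3(1)] _ \<mu>]) (use distE x x3 in auto)
    qed (simp add: none)
  qed
qed

section \<open>Lifting plane homeomorphisms to the sphere\<close>

text \<open>\<open>map_option\<close> keeps infinity fixed, so this extends a plane map by infinity.
  It serves for polynomials as well as for homeomorphisms of bounded support.\<close>

definition sphere_lift :: "(complex \<Rightarrow> complex) \<Rightarrow> (nat \<Rightarrow> real) \<Rightarrow> (nat \<Rightarrow> real)" where
  "sphere_lift h x = from_C (map_option h (to_C x))"

lemma topspace_S2: "topspace S2 = {x. (x 0)\<^sup>2 + (x 1)\<^sup>2 + (x 2)\<^sup>2 = 1 \<and> (\<forall>i>2. x i = 0)}"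
  by (simp add: nsphere numeral_2_eq_2)

lemma S2_eq: "S2 = top_of_set (topspace S2)"
  by (simp add: nsphere euclidean_product_topology)

lemma S2_D: "x \<in> topspace S2 \<Longrightarrow> (x 0)\<^sup>2 + (x 1)\<^sup>2 + (x 2)\<^sup>2 = 1"
  by (simp add: topspace_S2)

lemma from_C_in_S2: "from_C w \<in> topspace S2"
proof (cases w)
  case (Some z)
  define N where "N = (cmod z)\<^sup>2"
  have N: "N = (Re z)\<^sup>2 + (Im z)\<^sup>2" "N \<ge> 0" by (simp_all add: N_def cmod_power2)
  have "(2 * Re z / (1 + N))\<^sup>2 + (2 * Im z / (1 + N))\<^sup>2 + ((N - 1) / (N + 1))\<^sup>2
      = (4 * ((Re z)\<^sup>2 + (Im z)\<^sup>2) + (N - 1)\<^sup>2) / (1 + N)\<^sup>2"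
    by (simp add: power_divide power_mult_distrib add_divide_distrib add.commute)
  also have "4 * ((Re z)\<^sup>2 + (Im z)\<^sup>2) + (N - 1)\<^sup>2 = (1 + N)\<^sup>2"
    unfolding N(1)[symmetric] by (simp add: power2_eq_square algebra_simps)
  also have "(1 + N)\<^sup>2 / (1 + N)\<^sup>2 = 1" using N(2) by simp
  finally show ?thesis by (simp add: topspace_S2 from_C_def Some N_def)
qed (simp add: topspace_S2 from_C_def)

lemma to_C_from_C [simp]: "to_C (from_C w) = w"
proof (cases w)
  case (Some z)
  define N where "N = (cmod z)\<^sup>2"
  have N: "N \<ge> 0" by (simp add: N_def)
  have 2: "1 - (N - 1) / (N + 1) = 2 / (1 + N)" using N by (simp add: field_simps)
  then have ne: "(N - 1) / (N + 1) \<noteq> 1" using N by (simp add: field_simps)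
  have "Complex (2 * Re z / (1 + N)) (2 * Im z / (1 + N)) / complex_of_real (2 / (1 + N)) = z"
    using N by (simp add: complex_eq_iff Re_divide_of_real Im_divide_of_real)
  then show ?thesis using ne by (simp add: to_C_def from_C_def Some N_def[symmetric] 2)
qed (simp add: to_C_def from_C_def)

lemma norm_stereographic:
  assumes "x \<in> topspace S2" "x 2 \<noteq> 1"
  shows "(cmod (Complex (x 0) (x 1) / complex_of_real (1 - x 2)))\<^sup>2 = (1 + x 2) / (1 - x 2)"
proof -
  have "(cmod (Complex (x 0) (x 1) / complex_of_real (1 - x 2)))\<^sup>2 = ((x 0)\<^sup>2 + (x 1)\<^sup>2) / (1 - x 2)\<^sup>2"
    by (simp add: cmod_power2 Re_divide_of_real Im_divide_of_real power_divide add_divide_distrib del: of_real_diff)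
  also have "(x 0)\<^sup>2 + (x 1)\<^sup>2 = (1 + x 2) * (1 - x 2)"
    using S2_D[OF assms(1)] by (simp add: power2_eq_square algebra_simps)
  finally show ?thesis using assms(2) by (simp add: power2_eq_square)
qed

lemma from_C_to_C:
  assumes "x \<in> topspace S2"
  shows "from_C (to_C x) = x"
proof (cases "x 2 = 1")
  case True
  then have "(x 0)\<^sup>2 + (x 1)\<^sup>2 = 0" using S2_D[OF assms] by simp
  then have "x 0 = 0" "x 1 = 0" by (simp_all add: sum_power2_eq_zero_iff)
  moreover have "x i = 0" if "i > 2" for i using assms that by (simp add: topspace_S2)
  moreover have "i = 0 \<or> i = 1 \<or> i = 2 \<or> i > 2" for i :: nat by arith
  ultimately show ?thesis using True by (auto simp: from_C_def to_C_def fun_eq_iff) (metis)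
next
  case False
  define z where "z = Complex (x 0) (x 1) / complex_of_real (1 - x 2)"
  have N: "(cmod z)\<^sup>2 = (1 + x 2) / (1 - x 2)" unfolding z_def by (rule norm_stereographic[OF assms False])
  have d: "1 - x 2 \<noteq> 0" using False by simp
  have 1: "1 + (cmod z)\<^sup>2 = 2 / (1 - x 2)" "(cmod z)\<^sup>2 - 1 = 2 * x 2 / (1 - x 2)" "(cmod z)\<^sup>2 + 1 = 2 / (1 - x 2)"
    unfolding N using d by (simp_all add: field_simps)
  have 2: "Re z = x 0 / (1 - x 2)" "Im z = x 1 / (1 - x 2)"
    by (simp_all add: z_def Re_divide_of_real Im_divide_of_real del: of_real_diff)
  have "from_C (Some z) i = x i" for i
  proof -
    consider "i = 0" | "i = 1" | "i = 2" | "i > 2" by arith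
    then show ?thesis
    proof cases
      case 4
      then show ?thesis using assms by (simp add: from_C_def topspace_S2)
    qed (use d in \<open>simp_all add: from_C_def 1 2\<close>)
  qed
  then show ?thesis using False by (auto simp: to_C_def z_def)
qed

lemma from_C_inj: "from_C v = from_C w \<longleftrightarrow> v = w"
  using to_C_from_C by metis

lemma continuous_on_coord: "continuous_on S (\<lambda>x::nat \<Rightarrow> real. x i)"
  by (rule continuous_on_product_then_coordinatewise) (rule continuous_on_id)

lemma continuous_on_from_C: "continuous_on S (\<lambda>z. from_C (Some z))"
proof (rule continuous_on_coordinatewise_then_product)
  fix i :: nat
  have nz: "1 + (cmod z)\<^sup>2 \<noteq> 0" "(cmod z)\<^sup>2 + 1 \<noteq> 0" for z
    by (metis add.commute less_irrefl zero_le_power2 zero_less_one add_pos_nonneg)+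
  consider "i = 0" | "i = 1" | "i = 2" | "i > 2" by arith
  then show "continuous_on S (\<lambda>z. from_C (Some z) i)"
    by cases (use nz in \<open>auto simp: from_C_def intro!: continuous_intros\<close>)
qed

lemma continuous_on_stereographic:
  "continuous_on {x::nat \<Rightarrow> real. x 2 \<noteq> 1} (\<lambda>x. Complex (x 0) (x 1) / complex_of_real (1 - x 2))"
proof -
  have "continuous_on {x::nat \<Rightarrow> real. x 2 \<noteq> 1} (\<lambda>x. (complex_of_real (x 0) + \<i> * complex_of_real (x 1)) / complex_of_real (1 - x 2))"
    by (intro continuous_intros continuous_on_coord) (auto simp del: of_real_diff)
  then show ?thesis by (simp add: Complex_eq)
qed

text \<open>The parameter set \<open>T\<close> allows whole homotopies to be lifted. Two open pieces
  suffice: off the pole the plane map is read in the chart, and on a cap around the pole the lift is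
  the identity.\<close>

lemma continuous_on_sphere_lift:
  fixes F :: "'a::topological_space \<Rightarrow> complex \<Rightarrow> complex"
  assumes cont: "continuous_on (T \<times> UNIV) (\<lambda>(s, z). F s z)"
    and supp: "\<And>s z. s \<in> T \<Longrightarrow> cmod z > K \<Longrightarrow> F s z = z"
  shows "continuous_on (T \<times> topspace S2) (\<lambda>(s, x). sphere_lift (F s) x)"
proof -
  define L where "L = \<bar>K\<bar>"
  \<comment> \<open>\<open>h\<close> is the height on the sphere of the circle of radius
    \<open>L\<close>; points above it correspond to larger modulus.\<close>
  define h where "h = (L\<^sup>2 - 1) / (L\<^sup>2 + 1)"
  have L1: "L\<^sup>2 + 1 > 0" by (metis add_nonneg_pos zero_le_power2 zero_less_one)
  have h1: "h < 1" using L1 by (simp add: h_def field_simps)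
  define \<sigma> where "\<sigma> x = Complex (x 0) (x 1) / complex_of_real (1 - x 2)" for x :: "nat \<Rightarrow> real"
  have \<sigma>c: "continuous_on {x. x 2 \<noteq> 1} \<sigma>"
    using continuous_on_stereographic by (simp add: \<sigma>_def[abs_def])
  define U where "U = T \<times> {x \<in> topspace S2. x 2 \<noteq> 1}"
  define V where "V = T \<times> {x \<in> topspace S2. x 2 > h}"
  have UV: "U \<union> V = T \<times> topspace S2" using h1 by (auto simp: U_def V_def)
  have opU: "openin (top_of_set (U \<union> V)) U"
  proof -
    have "open (UNIV \<times> {x::nat \<Rightarrow> real. x 2 \<noteq> 1} :: ('a \<times> _) set)"
      by (intro open_Times open_UNIV open_Collect_neq continuous_on_coord continuous_on_const)
    moreover have "U = (U \<union> V) \<inter> (UNIV \<times> {x. x 2 \<noteq> 1})" unfolding UV by (auto simp: U_def)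
    ultimately show ?thesis unfolding openin_open by blast
  qed
  have opV: "openin (top_of_set (U \<union> V)) V"
  proof -
    have "open (UNIV \<times> {x::nat \<Rightarrow> real. h < x 2} :: ('a \<times> _) set)"
      by (intro open_Times open_UNIV open_Collect_less continuous_on_coord continuous_on_const)
    moreover have "V = (U \<union> V) \<inter> (UNIV \<times> {x. h < x 2})" unfolding UV by (auto simp: V_def)
    ultimately show ?thesis unfolding openin_open by blast
  qed
  have "continuous_on U (\<lambda>y. from_C (Some (case (fst y, \<sigma> (snd y)) of (s, z) \<Rightarrow> F s z)))"
  proof (intro continuous_on_compose2[OF continuous_on_from_C[of UNIV]] continuous_on_compose2[OF cont])
    have "continuous_on U (\<lambda>y. \<sigma> (snd y))"
      by (rule continuous_on_compose2[OF \<sigma>c continuous_on_snd[OF continuous_on_id]]) (auto simp: U_def)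
    then show "continuous_on U (\<lambda>y. (fst y, \<sigma> (snd y)))" by (intro continuous_intros)
  qed (auto simp: U_def)
  then have cU: "continuous_on U (\<lambda>(s, x). sphere_lift (F s) x)"
    by (rule continuous_on_eq) (auto simp: U_def sphere_lift_def to_C_def \<sigma>_def)
  have id: "sphere_lift (F s) x = x" if "(s, x) \<in> V" for s x
  proof (cases "x 2 = 1")
    case True
    then show ?thesis using that from_C_to_C[of x] by (auto simp: sphere_lift_def to_C_def V_def)
  next
    case False
    have x: "x \<in> topspace S2" "h < x 2" "s \<in> T" using that by (auto simp: V_def)
    have "(x 2)\<^sup>2 \<le> 1" using S2_D[OF x(1)] by (smt (verit) zero_le_power2)
    then have "\<bar>x 2\<bar> \<le> 1" by (simp add: abs_square_le_1)
    then have "x 2 < 1" using False by linarith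
    then have "L\<^sup>2 < (1 + x 2) / (1 - x 2)" using x(2) L1 by (simp add: h_def field_simps)
    then have "L\<^sup>2 < (cmod (\<sigma> x))\<^sup>2" unfolding \<sigma>_def norm_stereographic[OF x(1) False] .
    then have "L < cmod (\<sigma> x)" by (metis norm_ge_zero power2_less_imp_less)
    then have "F s (\<sigma> x) = \<sigma> x" using supp x(3) by (simp add: L_def)
    then show ?thesis using from_C_to_C[OF x(1)] False by (simp add: sphere_lift_def to_C_def \<sigma>_def)
  qed
  have "continuous_on V snd" by (intro continuous_intros)
  then have cV: "continuous_on V (\<lambda>(s, x). sphere_lift (F s) x)"
    by (rule continuous_on_eq) (use id in auto)
  show ?thesis using continuous_on_Un_local_open[OF opU opV cU cV] by (simp add: UV)
qed

lemma sphere_lift_in_S2: "sphere_lift h x \<in> topspace S2"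
  by (simp add: sphere_lift_def from_C_in_S2)

lemma sphere_lift_id: "x \<in> topspace S2 \<Longrightarrow> sphere_lift (\<lambda>z. z) x = x"
  by (simp add: sphere_lift_def option.map_ident from_C_to_C)

lemma sphere_lift_compose: "sphere_lift g (sphere_lift f x) = sphere_lift (\<lambda>z. g (f z)) x"
  by (simp add: sphere_lift_def option.map_comp o_def)

lemma continuous_map_sphere_lift:
  assumes "continuous_on UNIV f" "\<And>z. cmod z > K \<Longrightarrow> f z = z"
  shows "continuous_map S2 S2 (sphere_lift f)"
proof -
  have "continuous_on ({0::real} \<times> topspace S2) (\<lambda>(s, x). sphere_lift f x)"
  proof (rule continuous_on_sphere_lift[OF _ assms(2)])
    show "continuous_on ({0::real} \<times> UNIV) (\<lambda>(s, z). f z)"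
      unfolding case_prod_unfold
      by (rule continuous_on_compose2[OF assms(1) continuous_on_snd[OF continuous_on_id]]) auto
  qed
  then have "continuous_on (topspace S2) (\<lambda>x. case (0::real, x) of (s, x) \<Rightarrow> sphere_lift f x)"
    by (rule continuous_on_compose2) (auto intro!: continuous_intros)
  then have "continuous_map (top_of_set (topspace S2)) (top_of_set (topspace S2)) (sphere_lift f)"
    using sphere_lift_in_S2 by auto
  then show ?thesis using S2_eq by metis
qed

text \<open>The straight-line homotopy to the identity stays the identity outside the support of f,
  so it lifts to the sphere and gives Brouwer degree 1. Its stages need not be injective, since the
  degree is a homotopy invariant.\<close>

lemma opres_homeo_sphere_lift:
  assumes f: "continuous_on UNIV f" and g: "continuous_on UNIV g"
    and gf: "\<And>z. g (f z) = z" and fg: "\<And>z. f (g z) = z" and supp: "\<And>z. cmod z > K \<Longrightarrow> f z = z"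
  shows "opres_homeo (sphere_lift f)"
proof -
  have suppg: "g z = z" if "cmod z > K" for z using gf[of z] supp[OF that] by simp
  have "homeomorphic_maps S2 S2 (sphere_lift f) (sphere_lift g)"
    unfolding homeomorphic_maps_def
    using continuous_map_sphere_lift[OF f supp] continuous_map_sphere_lift[OF g suppg]
    by (simp add: sphere_lift_compose gf fg sphere_lift_id)
  then have hom: "homeomorphic_map S2 S2 (sphere_lift f)" using homeomorphic_map_maps by blast
  have c: "continuous_on ({0..1} \<times> topspace S2) (\<lambda>(s, x). sphere_lift (\<lambda>z. (1 - s) *\<^sub>R f z + s *\<^sub>R z) x)"
  proof (rule continuous_on_sphere_lift)
    have "continuous_on ({0..1} \<times> UNIV) (\<lambda>y::real \<times> complex. (1 - fst y) *\<^sub>R f (snd y) + fst y *\<^sub>R snd y)"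
      by (intro continuous_intros continuous_on_compose2[OF f continuous_on_snd[OF continuous_on_id]]) auto
    then show "continuous_on ({0..1} \<times> UNIV) (\<lambda>(s::real, z). (1 - s) *\<^sub>R f z + s *\<^sub>R z)"
      by (simp add: case_prod_unfold)
    show "(1 - s) *\<^sub>R f z + s *\<^sub>R z = z" if "cmod z > K" for s :: real and z
      using supp[OF that] by (simp add: scaleR_left_distrib[symmetric])
  qed
  have "continuous_map (top_of_set ({0..1} \<times> topspace S2)) (top_of_set (topspace S2))
      (\<lambda>(s, x). sphere_lift (\<lambda>z. (1 - s) *\<^sub>R f z + s *\<^sub>R z) x)"
    using c sphere_lift_in_S2 by auto
  then have c2: "continuous_map (top_of_set ({0..1} \<times> topspace S2)) S2
      (\<lambda>(s::real, x). sphere_lift (\<lambda>z. (1 - s) *\<^sub>R f z + s *\<^sub>R z) x)"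
    using S2_eq by metis
  have "prod_topology (top_of_set {0..1::real}) S2 = top_of_set ({0..1} \<times> topspace S2)"
    by (subst S2_eq) (simp only: prod_topology_subtopology_eu)
  with c2 have "continuous_map (prod_topology (top_of_set {0..1}) S2) S2
      (\<lambda>(s::real, x). sphere_lift (\<lambda>z. (1 - s) *\<^sub>R f z + s *\<^sub>R z) x)"
    by simp
  then have "homotopic_with (\<lambda>x. True) S2 S2 (sphere_lift f) id"
    by (subst homotopic_with) (auto intro!: exI simp: sphere_lift_id)
  then have "Brouwer_degree2 2 (sphere_lift f) = 1"
    using Brouwer_degree2_homotopic Brouwer_degree2_id by metis
  with hom show ?thesis by (simp add: opres_homeo_def)
qed

lemma opres_homeo_id: "opres_homeo id"
  by (simp add: opres_homeo_def)

text \<open>The formula is kept in cleared form and concerns finite points with finite images only,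
  since the map may have a pole; if infinity is fixed the map is affine.\<close>

lemma mobius_finite:
  assumes "mobius M"
  obtains \<alpha> \<beta> \<gamma> \<delta> where "\<alpha> * \<delta> - \<beta> * \<gamma> \<noteq> 0"
    "\<And>w v. M (from_C (Some w)) = from_C (Some v) \<Longrightarrow> \<gamma> * w + \<delta> \<noteq> 0 \<and> v * (\<gamma> * w + \<delta>) = \<alpha> * w + \<beta>"
    "M (from_C None) = from_C None \<Longrightarrow> \<gamma> = 0"
proof -
  obtain p q where q: "q \<noteq> 0" and cop: "coprime p q" and deg: "max (degree p) (degree q) = 1"
    and M: "\<And>x. x \<in> topspace S2 \<Longrightarrow> M x = from_C (rat_fun p q (to_C x))"
    using assms unfolding mobius_def rational_map_def by blast
  define \<alpha> \<beta> \<gamma> \<delta> where "\<alpha> = poly.coeff p 1" "\<beta> = poly.coeff p 0" "\<gamma> = poly.coeff q 1" "\<delta> = poly.coeff q 0"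
  have pp: "poly P w = poly.coeff P 1 * w + poly.coeff P 0" if "degree P \<le> 1" for P :: "complex poly" and w
  proof -
    consider "degree P = 0" | "degree P = 1" using \<open>degree P \<le> 1\<close> by linarith
    then show ?thesis by cases (auto simp: poly_altdef coeff_eq_0)
  qed
  have p: "poly p w = \<alpha> * w + \<beta>" and qw: "poly q w = \<gamma> * w + \<delta>" for w
    using pp[of p w] pp[of q w] deg by (auto simp: \<alpha>_\<beta>_\<gamma>_\<delta>_def)
  \<comment> \<open>For nonzero \<gamma> a vanishing determinant makes -\<delta>/\<gamma> a common
    root of p and q. For \<gamma> = 0 the polynomial q is a nonzero constant, and p would be
    constant too, against degree 1.\<close>
  have det: "\<alpha> * \<delta> - \<beta> * \<gamma> \<noteq> 0"
  proof
    assume d: "\<alpha> * \<delta> - \<beta> * \<gamma> = 0"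
    show False
    proof (cases "\<gamma> = 0")
      case False
      have "poly q (- \<delta> / \<gamma>) = 0" using False by (simp add: qw)
      moreover have "poly p (- \<delta> / \<gamma>) = 0" using False d by (simp add: p field_simps)
      ultimately show False using coprime_poly_0[OF cop] by blast
    next
      case True
      have "degree q = 0" using True deg by (metis \<alpha>_\<beta>_\<gamma>_\<delta>_def(3) leading_coeff_0_iff le_antisym max.cobounded2 le_SucE One_nat_def le_zero_eq q)
      then have "\<delta> \<noteq> 0" using q by (metis \<alpha>_\<beta>_\<gamma>_\<delta>_def(4) leading_coeff_0_iff)
      then have "\<alpha> = 0" using d True by simp
      moreover have "degree p = 1" using deg \<open>degree q = 0\<close> by simp
      ultimately show False by (metis \<alpha>_\<beta>_\<gamma>_\<delta>_def(1) degree_0 leading_coeff_0_iff zero_neq_one)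
    qed
  qed
  show ?thesis
  proof (rule that[OF det])
    fix w v assume "M (from_C (Some w)) = from_C (Some v)"
    then have "rat_fun p q (Some w) = Some v" using M[OF from_C_in_S2, of "Some w"] by (simp add: from_C_inj)
    then have "poly q w \<noteq> 0" "poly p w / poly q w = v" by (auto simp: rat_fun_def split: if_splits)
    then show "\<gamma> * w + \<delta> \<noteq> 0 \<and> v * (\<gamma> * w + \<delta>) = \<alpha> * w + \<beta>" unfolding p qw by (auto simp: field_simps)
  next
    assume "M (from_C None) = from_C None"
    then have "rat_fun p q None = None" using M[OF from_C_in_S2, of None] by (simp add: from_C_inj)
    then have "degree p > degree q" by (auto simp: rat_fun_def split: if_splits)
    then have "degree q = 0" using deg by simp
    then show "\<gamma> = 0" by (simp add: \<alpha>_\<beta>_\<gamma>_\<delta>_def coeff_eq_0)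
  qed
qed

section \<open>Pushing a regular value\<close>

lemma openin_S2_disc: "openin S2 ((\<lambda>z. from_C (Some z)) ` ball z e)"
proof -
  define \<sigma> where "\<sigma> x = Complex (x 0) (x 1) / complex_of_real (1 - x 2)" for x :: "nat \<Rightarrow> real"
  have \<sigma>c: "continuous_on {x. x 2 \<noteq> 1} \<sigma>"
    using continuous_on_stereographic by (simp add: \<sigma>_def[abs_def])
  have "open {x::nat \<Rightarrow> real. x 2 \<noteq> 1}" by (intro open_Collect_neq continuous_on_coord continuous_on_const)
  then have op: "open ({x. x 2 \<noteq> 1} \<inter> \<sigma> -` ball z e)" by (rule continuous_open_preimage[OF \<sigma>c _ open_ball])
  have "(\<lambda>z. from_C (Some z)) ` ball z e = topspace S2 \<inter> ({x. x 2 \<noteq> 1} \<inter> \<sigma> -` ball z e)"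
  proof (intro equalityI subsetI)
    fix x assume "x \<in> (\<lambda>z. from_C (Some z)) ` ball z e"
    then obtain w where w: "w \<in> ball z e" "x = from_C (Some w)" by auto
    then have "to_C x = Some w" by simp
    then have "x 2 \<noteq> 1" "\<sigma> x = w" by (auto simp: to_C_def \<sigma>_def split: if_splits)
    then show "x \<in> topspace S2 \<inter> ({x. x 2 \<noteq> 1} \<inter> \<sigma> -` ball z e)" using w from_C_in_S2 by auto
  next
    fix x assume x: "x \<in> topspace S2 \<inter> ({x. x 2 \<noteq> 1} \<inter> \<sigma> -` ball z e)"
    then have "to_C x = Some (\<sigma> x)" by (simp add: to_C_def \<sigma>_def)
    then have "x = from_C (Some (\<sigma> x))" using from_C_to_C[of x] x by simp
    then show "x \<in> (\<lambda>z. from_C (Some z)) ` ball z e" using x by auto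
  qed
  then show ?thesis using op S2_eq openin_open by metis
qed

lemma openin_S2_preimage:
  assumes "openin S2 U" "continuous_on UNIV h" "\<And>z::complex. h z \<in> topspace S2"
  shows "open {z. h z \<in> U}"
proof -
  obtain O' where O: "open O'" "U = topspace S2 \<inter> O'" using assms(1) S2_eq openin_open by metis
  have "{z. h z \<in> U} = h -` O'" using assms(3) O by auto
  then show ?thesis using open_vimage[OF O(1) assms(2)] by simp
qed

text \<open>The chart w = 1/z around the north pole.\<close>

definition inverse_chart :: "complex \<Rightarrow> nat \<Rightarrow> real" where
  "inverse_chart w i = (if i = 0 then 2 * Re w / (1 + (cmod w)\<^sup>2)
     else if i = 1 then - (2 * Im w / (1 + (cmod w)\<^sup>2))
     else if i = 2 then (1 - (cmod w)\<^sup>2) / (1 + (cmod w)\<^sup>2) else 0)"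

lemma inverse_chart: "inverse_chart w = (if w = 0 then from_C None else from_C (Some (inverse w)))"
proof (cases "w = 0")
  case False
  define N where "N = (cmod w)\<^sup>2"
  have N: "N > 0" using False by (simp add: N_def)
  define v where "v = inverse w"
  have c: "(cmod v)\<^sup>2 = 1 / N" by (simp add: v_def N_def norm_divide power_divide inverse_eq_divide)
  have ri: "Re v = Re w / N" "Im v = - Im w / N" by (simp_all add: v_def N_def cmod_power2)
  have e: "1 + 1 / N = (1 + N) / N" "1 / N - 1 = (1 - N) / N" "1 / N + 1 = (1 + N) / N"
    using N by (simp_all add: field_simps)
  have "from_C (Some v) i = inverse_chart w i" for i
    using N unfolding from_C_def inverse_chart_def N_def[symmetric] by (simp add: c ri e)
  then have "inverse_chart w = from_C (Some v)" by auto
  then show ?thesis using False by (simp add: v_def)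
qed (auto simp: inverse_chart_def from_C_def)

lemma continuous_on_inverse_chart: "continuous_on S inverse_chart"
proof (rule continuous_on_coordinatewise_then_product)
  fix i :: nat
  have nz: "1 + (cmod z)\<^sup>2 \<noteq> 0" for z
    by (metis add.commute less_irrefl zero_le_power2 zero_less_one add_pos_nonneg)
  consider "i = 0" | "i = 1" | "i = 2" | "i > 2" by arith
  then show "continuous_on S (\<lambda>z. inverse_chart z i)"
    by cases (use nz in \<open>auto simp: inverse_chart_def intro!: continuous_intros\<close>)
qed

text \<open>Critical points are defined topologically, so the derivative test must be derived: a
  nonzero derivative gives local injectivity, and an injective holomorphic map has nonzero
  derivative. At infinity every neighbourhood contains whole fibres over large regular values, each
  with at least two points.\<close>

lemma crit_points_poly:
  assumes deg: "degree p \<ge> 2" and F: "\<And>x. x \<in> topspace S2 \<Longrightarrow> F x = sphere_lift (poly p) x"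
  shows "from_C None \<in> crit_points F"
    and "from_C (Some z) \<in> crit_points F \<longleftrightarrow> poly (pderiv p) z = 0"
proof -
  have Fz: "F (from_C (Some z)) = from_C (Some (poly p z))" for z
    using F[OF from_C_in_S2] by (simp add: sphere_lift_def)
  have "\<not> inj_on F U" if U: "openin S2 U" "from_C None \<in> U" for U
  proof
    assume inj: "inj_on F U"
    have "inverse_chart w \<in> topspace S2" for w using from_C_in_S2 by (simp add: inverse_chart)
    then have "open {w. inverse_chart w \<in> U}"
      using openin_S2_preimage[OF U(1) continuous_on_inverse_chart] by blast
    moreover have "0 \<in> {w. inverse_chart w \<in> U}" using U(2) by (simp add: inverse_chart)
    ultimately obtain e where e: "e > 0" "ball 0 e \<subseteq> {w. inverse_chart w \<in> U}" using open_contains_ball by blast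
    have inU: "from_C (Some z) \<in> U" if "cmod z > inverse e" for z
    proof -
      have z0: "z \<noteq> 0" "cmod z > 0" using that e(1) by (auto simp: order.strict_trans[of 0 "inverse e"])
      then have "inverse (cmod z) < e" using that e(1) by (metis inverse_inverse_eq inverse_less_iff_less positive_imp_inverse_positive)
      then have "inverse z \<in> ball 0 e" by (simp add: norm_inverse)
      then have "inverse_chart (inverse z) \<in> U" using e(2) by blast
      then show ?thesis using z0 by (simp add: inverse_chart)
    qed
    \<comment> \<open>A value beyond the maximum of |p| on the disc of radius 1/e has all its
      preimages outside that disc, hence in \<open>U\<close>.\<close>
    obtain M where M: "\<And>z. cmod z \<le> inverse e \<Longrightarrow> cmod (poly p z) \<le> M" by (rule poly_bounded_on_cball) blast
    obtain t where t: "\<And>n::nat. regular_value p (t n)" "filterlim t at_infinity sequentially"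
      using regular_values_unbounded[of p] deg by auto
    have "\<forall>\<^sub>F n in sequentially. cmod (t n) \<ge> \<bar>M\<bar> + 1"
      using t(2) unfolding filterlim_at_infinity[OF order_refl] by simp
    then obtain n where n: "cmod (t n) > M" using eventually_happens'[OF sequentially_bot]
      by (smt (verit, ccfv_threshold) eventually_sequentially order_refl)
    have c2: "card {y. poly p y = t n} \<ge> 2" using card_fibre_regular[OF _ t(1)] deg by simp
    then obtain y1 where y1: "poly p y1 = t n" using c2 fresh_element[of "{}" "{y. poly p y = t n}"] by auto
    obtain y2 where y2: "poly p y2 = t n" "y2 \<noteq> y1"
      using fresh_element[of "{y1}" "{y. poly p y = t n}"] c2 by auto
    have "cmod y > inverse e" if "poly p y = t n" for y using M[of y] n that by (cases "cmod y \<le> inverse e") auto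
    then have "from_C (Some y1) \<in> U" "from_C (Some y2) \<in> U" using inU y1 y2 by blast+
    then have "from_C (Some y1) = from_C (Some y2)" using inj_onD[OF inj] y1 y2 by (simp add: Fz)
    then show False using y2 by (simp add: from_C_inj)
  qed
  then show "from_C None \<in> crit_points F" using from_C_in_S2 by (auto simp: crit_points_def)
  show "from_C (Some z) \<in> crit_points F \<longleftrightarrow> poly (pderiv p) z = 0"
  proof
    assume c: "from_C (Some z) \<in> crit_points F"
    show "poly (pderiv p) z = 0"
    proof (rule ccontr)
      assume "poly (pderiv p) z \<noteq> 0"
      then obtain e where e: "e > 0" "inj_on (poly p) (ball z e)" using poly_locally_inj by blast
      have "inj_on F ((\<lambda>z. from_C (Some z)) ` ball z e)"
        using e(2) by (auto simp: inj_on_def Fz from_C_inj)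
      moreover have "from_C (Some z) \<in> (\<lambda>z. from_C (Some z)) ` ball z e" using e(1) by auto
      ultimately show False using c openin_S2_disc[of z e] unfolding crit_points_def by blast
    qed
  next
    assume z: "poly (pderiv p) z = 0"
    have "\<not> inj_on F U" if U: "openin S2 U" "from_C (Some z) \<in> U" for U
    proof
      assume inj: "inj_on F U"
      have "open {w. from_C (Some w) \<in> U}"
        by (rule openin_S2_preimage[OF U(1) continuous_on_from_C from_C_in_S2])
      then obtain e where e: "e > 0" "ball z e \<subseteq> {w. from_C (Some w) \<in> U}" using U(2) open_contains_ball by blast
      have "inj_on (poly p) (ball z e)"
      proof (rule inj_onI)
        fix u v assume uv: "u \<in> ball z e" "v \<in> ball z e" "poly p u = poly p v"
        then have "from_C (Some u) \<in> U" "from_C (Some v) \<in> U" using e(2) by auto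
        then have "from_C (Some u) = from_C (Some v)" using inj_onD[OF inj] uv(3) by (simp add: Fz)
        then show "u = v" by (simp add: from_C_inj)
      qed
      then have "deriv (poly p) z \<noteq> 0"
        using holomorphic_injective_imp_regular[OF holomorphic_on_poly open_ball, of p z e z] e(1) by simp
      then show False using z by (simp add: deriv_poly_eq)
    qed
    then show "from_C (Some z) \<in> crit_points F" using from_C_in_S2 by (auto simp: crit_points_def)
  qed
qed

text \<open>The lift of \<open>h\<close> through p that keeps every point on its own sheet. The
  description operator names the sheet through \<open>z\<close>, which is unique over an evenly
  covered disc.\<close>

definition branch_lift :: "complex poly \<Rightarrow> complex \<Rightarrow> real \<Rightarrow> (complex \<Rightarrow> complex \<Rightarrow> complex) \<Rightarrow>
    (complex \<Rightarrow> complex) \<Rightarrow> complex \<Rightarrow> complex" where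
  "branch_lift p b r br h z = (if poly p z \<in> ball b r
     then br (THE x. poly p x = b \<and> z = br x (poly p z)) (h (poly p z)) else z)"

locale even_cover_disc =
  fixes p :: "complex poly" and b :: complex and r :: real and br :: "complex \<Rightarrow> complex \<Rightarrow> complex"
  assumes deg: "degree p > 0" and r: "r > 0"
    and br: "\<And>x. poly p x = b \<Longrightarrow> branch p (ball b r) (br x)"
    and brb: "\<And>x. poly p x = b \<Longrightarrow> br x b = x"
    and surj: "\<And>s y. s \<in> ball b r \<Longrightarrow> poly p y = s \<Longrightarrow> \<exists>x. poly p x = b \<and> y = br x s"
    and dist: "\<And>s x x'. s \<in> ball b r \<Longrightarrow> poly p x = b \<Longrightarrow> poly p x' = b \<Longrightarrow> br x s = br x' s \<Longrightarrow> x = x'"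
begin

lemma poly_br: "poly p x = b \<Longrightarrow> s \<in> ball b r \<Longrightarrow> poly p (br x s) = s"
  using br by (auto simp: branch_def)

lemma regular: "s \<in> ball b r \<Longrightarrow> regular_value p s"
  unfolding regular_value_def using surj branch_deriv[OF br open_ball] by metis

lemma branch_lift_br:
  assumes "poly p x = b" "s \<in> ball b r"
  shows "branch_lift p b r br h (br x s) = br x (h s)"
proof -
  have "(THE x'. poly p x' = b \<and> br x s = br x' s) = x"
    by (rule the_equality) (use assms dist in blast)+
  then show ?thesis using assms by (simp add: branch_lift_def poly_br)
qed

lemma branch_lift_outside: "poly p z \<notin> ball b r \<Longrightarrow> branch_lift p b r br h z = z"
  by (simp add: branch_lift_def)

text \<open>Continuity is checked on an open cover: on each sheet over the disc the lift is a
  composition, and over the complement of the closed half-size disc it is the identity. The gap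
  between the two radii makes these sets cover the plane.\<close>

lemma continuous_on_branch_lift:
  assumes h: "continuous_on UNIV h" and hid: "\<And>w. w \<notin> ball b (r/2) \<Longrightarrow> h w = w"
    and hb: "\<And>w. w \<in> ball b r \<Longrightarrow> h w \<in> ball b r"
  shows "continuous_on UNIV (branch_lift p b r br h)"
proof -
  define S where "S = insert {z. poly p z \<notin> cball b (r/2)} ((\<lambda>x. br x ` ball b r) ` {x. poly p x = b})"
  have "continuous_on (\<Union>S) (branch_lift p b r br h)"
  proof (rule continuous_on_open_Union)
    have op: "open {z. poly p z \<notin> cball b (r/2)}"
      using open_vimage[OF open_Compl[OF closed_cball[of b "r/2"]] continuous_on_poly[OF continuous_on_id, of UNIV p]]
      by (simp add: vimage_def)
    have opx: "open (br x ` ball b r)" if "poly p x = b" for x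
    proof (rule open_mapping_thm3)
      show "br x holomorphic_on ball b r" using br[OF that] by (simp add: branch_def)
      show "inj_on (br x) (ball b r)" using poly_br[OF that] by (metis inj_onI)
    qed simp
    show "open s" if "s \<in> S" for s using that op opx by (auto simp: S_def)
    show "continuous_on s (branch_lift p b r br h)" if sS: "s \<in> S" for s
    proof -
      consider "s = {z. poly p z \<notin> cball b (r/2)}" | x where "poly p x = b" "s = br x ` ball b r"
        using sS unfolding S_def by blast
      then show ?thesis
      proof cases
        case 1
        have "branch_lift p b r br h z = z" if "z \<in> s" for z
        proof (cases "poly p z \<in> ball b r")
          case True
          then obtain x where x: "poly p x = b" "z = br x (poly p z)" using surj by blast
          have "h (poly p z) = poly p z" using that 1 by (intro hid) auto
          then show ?thesis using branch_lift_br[OF x(1) True, of h] x(2) by simp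
        qed (rule branch_lift_outside)
        then show ?thesis using continuous_on_eq[OF continuous_on_id] by (metis (no_types, lifting))
      next
        case 2
        have "continuous_on s (\<lambda>z. br x (h (poly p z)))"
        proof (rule continuous_on_compose2[of "ball b r" "br x"])
          show "continuous_on (ball b r) (br x)"
            using br[OF 2(1)] by (simp add: branch_def holomorphic_on_imp_continuous_on)
          show "continuous_on s (\<lambda>z. h (poly p z))"
            by (intro continuous_on_compose2[OF h] continuous_intros) auto
          show "(\<lambda>z. h (poly p z)) ` s \<subseteq> ball b r" using 2 hb poly_br by auto
        qed
        then show ?thesis
          by (rule continuous_on_eq) (use 2 poly_br branch_lift_br in auto)
      qed
    qed
  qed
  moreover have "\<Union>S = UNIV"
  proof -
    have "z \<in> \<Union>S" for z
    proof (cases "poly p z \<in> ball b r")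
      case True
      then obtain x where "poly p x = b" "z = br x (poly p z)" using surj by blast
      then show ?thesis using True by (auto simp: S_def)
    next
      case False
      then have "poly p z \<notin> cball b (r/2)" using r by auto
      then show ?thesis by (auto simp: S_def)
    qed
    then show ?thesis by blast
  qed
  ultimately show ?thesis by simp
qed

lemma poly_branch_lift:
  assumes hid: "\<And>w. w \<notin> ball b (r/2) \<Longrightarrow> h w = w" and hb: "\<And>w. w \<in> ball b r \<Longrightarrow> h w \<in> ball b r"
  shows "poly p (branch_lift p b r br h z) = h (poly p z)"
proof (cases "poly p z \<in> ball b r")
  case True
  then obtain x where x: "poly p x = b" "z = br x (poly p z)" using surj by blast
  then show ?thesis using branch_lift_br[OF x(1) True, of h] poly_br[OF x(1) hb[OF True]] by simp
next
  case False
  then have "poly p z \<notin> ball b (r/2)" using r by auto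
  then show ?thesis using hid False by (simp add: branch_lift_outside del: mem_ball)
qed

lemma branch_lift_inverse:
  assumes hb: "\<And>w. w \<in> ball b r \<Longrightarrow> h w \<in> ball b r" and kh: "\<And>w. k (h w) = w"
  shows "branch_lift p b r br k (branch_lift p b r br h z) = z"
proof (cases "poly p z \<in> ball b r")
  case True
  then obtain x where x: "poly p x = b" "z = br x (poly p z)" using surj by blast
  then show ?thesis using branch_lift_br[OF x(1) True, of h] branch_lift_br[OF x(1) hb[OF True], of k] kh by simp
qed (simp add: branch_lift_outside del: mem_ball)

text \<open>A homeomorphism moving b to t inside the half-size disc lifts through p, and its lift
  moves the points of A over b along their branches. Constancy of the pullback map compares this
  lift with the identity.\<close>

lemma pushed_moebius:
  assumes F: "\<And>x. x \<in> topspace S2 \<Longrightarrow> f x = sphere_lift (poly p) x" and rat: "is_rational f"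
    and A: "A \<subseteq> topspace S2" and CTP: "CTP f A" and t: "t \<in> ball b (r/2)"
  obtains M where "mobius M" "\<And>x. from_C (Some x) \<in> A \<Longrightarrow> poly p x = b \<Longrightarrow> M (from_C (Some (br x t))) = from_C (Some x)"
    "\<And>q. from_C (Some q) \<in> A \<Longrightarrow> poly p q \<notin> ball b r \<Longrightarrow> M (from_C (Some q)) = from_C (Some q)"
    "from_C None \<in> A \<Longrightarrow> M (from_C None) = from_C None"
proof -
  obtain h k where hk: "homeomorphism UNIV UNIV h k" and hb: "h b = t"
    and supp: "{x. \<not> (h x = x \<and> k x = x)} \<subseteq> ball b (r/2) \<inter> UNIV"
    using homeomorphism_moving_point_3[of UNIV b "r/2" UNIV b t] t r by auto
  have kh: "k (h w) = w" and hkw: "h (k w) = w" for w using hk by (auto simp: homeomorphism_def)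
  have hc: "continuous_on UNIV h" and kc: "continuous_on UNIV k" using hk by (auto simp: homeomorphism_def)
  have hid: "h w = w" and kid: "k w = w" if "w \<notin> ball b (r/2)" for w using supp that by blast+
  have half: "w \<notin> ball b (r/2)" if "w \<notin> ball b r" for w using that r by auto
  have hB: "h w \<in> ball b r" if "w \<in> ball b r" for w
    using kid[OF half, of "h w"] kh[of w] that by metis
  have kB: "k w \<in> ball b r" if "w \<in> ball b r" for w
    using hid[OF half, of "k w"] hkw[of w] that by metis
  let ?u = "branch_lift p b r br h" and ?v = "branch_lift p b r br k"
  \<comment> \<open>Since p tends to infinity at infinity, the preimage of the disc is bounded, so
    the lift has bounded support and extends to the sphere.\<close>
  have "filterlim (poly p) at_infinity at_infinity" by (rule filterlim_poly_at_infinity[OF deg])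
  then have "\<forall>\<^sub>F z in at_infinity. cmod (poly p z) \<ge> cmod b + r"
    using r unfolding filterlim_at_infinity[OF order_refl] by (simp add: add_nonneg_pos)
  then obtain K where K: "\<And>z. cmod z \<ge> K \<Longrightarrow> cmod (poly p z) \<ge> cmod b + r" unfolding eventually_at_infinity by blast
  have usupp: "?u z = z" if "cmod z > K" for z
  proof (rule branch_lift_outside)
    have "cmod (poly p z) \<ge> cmod b + r" using K that by simp
    then have "dist b (poly p z) \<ge> r" using norm_triangle_ineq2[of "poly p z" b] by (simp add: dist_norm norm_minus_commute)
    then show "poly p z \<notin> ball b r" by simp
  qed
  have hsupp: "h z = z" if "cmod z > cmod b + r" for z
  proof (rule hid)
    have "dist b z \<ge> r" using that norm_triangle_ineq2[of z b] by (simp add: dist_norm norm_minus_commute)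
    then show "z \<notin> ball b (r/2)" using r by simp
  qed
  have op0: "opres_homeo (sphere_lift h)" by (rule opres_homeo_sphere_lift[OF hc kc kh hkw hsupp])
  have op1: "opres_homeo (sphere_lift ?u)"
    by (rule opres_homeo_sphere_lift[OF continuous_on_branch_lift[OF hc hid hB] continuous_on_branch_lift[OF kc kid kB]
          branch_lift_inverse[OF hB kh] branch_lift_inverse[OF kB hkw] usupp])
  have "pullback f (sphere_lift h) (sphere_lift ?u)"
    unfolding pullback_def
  proof (intro conjI op0 op1 exI[of _ f] rat ballI)
    fix x assume "x \<in> topspace S2"
    moreover have "poly p (?u z) = h (poly p z)" for z by (rule poly_branch_lift[OF hid hB])
    ultimately show "f (sphere_lift ?u x) = sphere_lift h (f x)"
      using F sphere_lift_in_S2 by (simp add: sphere_lift_compose)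
  qed
  \<comment> \<open>The identity pulls back to itself, with f as the rational map; this is the
    reference point of Teichmueller space.\<close>
  moreover have "pullback f id id"
    unfolding pullback_def using opres_homeo_id rat by auto
  ultimately have "teich_equiv A (sphere_lift ?u) id" using CTP unfolding CTP_def by blast
  then obtain M where M: "mobius M"
    and hom: "homotopic_with (\<lambda>g. homeomorphic_map S2 S2 g \<and>
        (\<forall>y\<in>sphere_lift ?u ` A. g y = id (inv_into (topspace S2) (sphere_lift ?u) y)))
        S2 S2 (id \<circ> inv_into (topspace S2) (sphere_lift ?u)) M"
    unfolding teich_equiv_def by blast
  \<comment> \<open>The isotopy is relative to the image of A, so already its prescribed values
    determine its endpoint \<open>M\<close> there: it agrees with the inverse of the lift and
    carries the moved points back.\<close>
  have Mv: "M (sphere_lift ?u a) = a" if "a \<in> A" for a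
  proof -
    have "inj_on (sphere_lift ?u) (topspace S2)"
      using op1 unfolding opres_homeo_def homeomorphic_map_def by (meson homeomorphic_imp_injective_map op1 opres_homeo_def)
    then have "inv_into (topspace S2) (sphere_lift ?u) (sphere_lift ?u a) = a"
      using that A by (intro inv_into_f_f) auto
    then show ?thesis using homotopic_with_imp_property[OF hom] that by auto
  qed
  show ?thesis
  proof (rule that[OF M])
    show "M (from_C (Some (br x t))) = from_C (Some x)" if "from_C (Some x) \<in> A" "poly p x = b" for x
    proof -
      have "?u (br x b) = br x (h b)" using that r by (intro branch_lift_br) auto
      then have "?u x = br x t" using brb[OF that(2)] hb by simp
      then show ?thesis using Mv[OF that(1)] by (simp add: sphere_lift_def)
    qed
    show "M (from_C (Some q)) = from_C (Some q)" if "from_C (Some q) \<in> A" "poly p q \<notin> ball b r" for q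
      using Mv[OF that(1)] branch_lift_outside[OF that(2)] by (simp add: sphere_lift_def)
    show "M (from_C None) = from_C None" if "from_C None \<in> A"
      using Mv[OF that] by (simp add: sphere_lift_def)
  qed
qed

end

section \<open>Polynomials invariant under rotations\<close>

lemma rat_fun_poly: "degree p > 0 \<Longrightarrow> rat_fun p 1 w = map_option (poly p) w"
  by (cases w) (simp_all add: rat_fun_def)

lemma rational_map_sphere_lift:
  assumes "degree p > 0" "\<And>x. x \<in> topspace S2 \<Longrightarrow> F x = sphere_lift (poly p) x"
  shows "rational_map (degree p) F"
  unfolding rational_map_def
  by (rule exI[of _ p], rule exI[of _ 1]) (use assms in \<open>auto simp: rat_fun_poly sphere_lift_def\<close>)

text \<open>The degree \<open>d\<close> belongs to a possibly different quotient P/Q representing f.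
  As f is finite on the plane, Q has no zero there, hence is constant, and the degrees
  agree.\<close>

lemma polynomial_map_sphere_lift:
  assumes rat: "rational_map d f" and d: "d \<ge> 2" and pol: "polynomial_map f"
  obtains p where "degree p = d" "\<And>x. x \<in> topspace S2 \<Longrightarrow> f x = sphere_lift (poly p) x"
proof -
  obtain p where p: "\<And>x. x \<in> topspace S2 \<Longrightarrow> f x = from_C (rat_fun p 1 (to_C x))"
    using pol by (auto simp: polynomial_map_def)
  obtain P Q where Q: "Q \<noteq> 0" and deg: "max (degree P) (degree Q) = d"
    and PQ: "\<And>x. x \<in> topspace S2 \<Longrightarrow> f x = from_C (rat_fun P Q (to_C x))"
    using rat by (auto simp: rational_map_def)
  have eq: "rat_fun P Q (Some z) = rat_fun p 1 (Some z)" for z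
    using p[OF from_C_in_S2, of "Some z"] PQ[OF from_C_in_S2, of "Some z"] by (simp add: from_C_inj)
  have Qz: "poly Q z \<noteq> 0" "poly P z / poly Q z = poly p z" for z
    using eq[of z] by (auto simp: rat_fun_def split: if_splits)
  have "degree Q = 0"
    using fundamental_theorem_of_algebra[of Q] Qz(1) constant_degree[of Q] by blast
  then obtain a where a: "Q = [:a:]" by (metis degree_eq_zeroE)
  have a0: "a \<noteq> 0" using Q a by auto
  have "poly P z = poly (Polynomial.smult a p) z" for z using Qz(2)[of z] a a0 by (simp add: field_simps)
  then have "P = Polynomial.smult a p" by (metis poly_eq_poly_eq_iff ext)
  then have "degree P = degree p" using a0 by simp
  then have "degree p = d" using deg \<open>degree Q = 0\<close> by simp
  moreover have "f x = sphere_lift (poly p) x" if "x \<in> topspace S2" for x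
    using p[OF that] \<open>degree p = d\<close> d by (simp add: rat_fun_poly sphere_lift_def)
  ultimately show ?thesis using that by blast
qed

lemma power_gcd_eq_1:
  fixes \<kappa> :: "'a::field"
  assumes "\<kappa> ^ a = 1" "\<kappa> ^ b = 1"
  shows "\<kappa> ^ gcd a b = 1"
proof (cases "a = 0")
  case False
  obtain x y where "a * x = b * y + gcd a b" using bezout_nat[OF False] by blast
  then have "\<kappa> ^ (a * x) = \<kappa> ^ (b * y) * \<kappa> ^ gcd a b" by (simp add: power_add)
  then show ?thesis using assms by (simp add: power_mult)
qed (use assms in simp)

lemma power_Gcd_eq_1:
  fixes \<kappa> :: "'a::field"
  assumes "finite J" "\<And>j. j \<in> J \<Longrightarrow> \<kappa> ^ j = 1"
  shows "\<kappa> ^ Gcd J = 1"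
  using assms by (induction J rule: finite_induct) (simp_all add: power_gcd_eq_1)

text \<open>Comparing coefficients in the expansion at c multiplies the j-th one by \<kappa>^j, so
  every exponent that occurs constrains \<kappa>.\<close>

lemma rotation_coeff:
  assumes "\<And>z. poly p (c + \<kappa> * z) = poly p (c + z)" "poly.coeff (shift_poly c p) j \<noteq> 0"
  shows "\<kappa> ^ j = 1"
proof -
  have "poly (pcompose (shift_poly c p) [:0, \<kappa>:]) z = poly (shift_poly c p) z" for z
    using assms(1)[of z] by (simp add: poly_pcompose mult.commute)
  then have "pcompose (shift_poly c p) [:0, \<kappa>:] = shift_poly c p" by (metis poly_eq_poly_eq_iff ext)
  then have "\<kappa> ^ j * poly.coeff (shift_poly c p) j = poly.coeff (shift_poly c p) j"
    by (metis coeff_pcompose_linear)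
  then show ?thesis using assms(2) by simp
qed

lemma poly_factor_power:
  fixes q :: "complex poly"
  assumes "\<And>j. poly.coeff q j \<noteq> 0 \<Longrightarrow> n dvd j"
  shows "\<exists>G. \<forall>z. poly q z = poly G (z ^ n)"
proof -
  define G where "G = (\<Sum>j\<le>degree q. Polynomial.monom (poly.coeff q j) (j div n))"
  have "poly q z = poly G (z ^ n)" for z
  proof -
    have "poly q z = (\<Sum>j\<le>degree q. poly.coeff q j * z ^ j)" by (rule poly_altdef)
    also have "\<dots> = (\<Sum>j\<le>degree q. poly.coeff q j * (z ^ n) ^ (j div n))"
    proof (rule sum.cong[OF refl])
      fix j show "poly.coeff q j * z ^ j = poly.coeff q j * (z ^ n) ^ (j div n)"
        using assms[of j] by (cases "poly.coeff q j = 0") (simp_all add: power_mult[symmetric])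
    qed
    finally show ?thesis by (simp add: G_def poly_sum poly_monom)
  qed
  then show ?thesis by blast
qed

text \<open>Shrinking the disc away from the finitely many values p(q) guarantees that the points of
  \<open>Q\<close> stay fixed under the pushes.\<close>

lemma even_cover_avoiding:
  fixes p :: "complex poly"
  assumes deg: "degree p > 0" and reg: "regular_value p b" and Q: "finite Q" "\<And>q. q \<in> Q \<Longrightarrow> poly p q \<noteq> b"
  obtains r br where "even_cover_disc p b r br" "\<And>q. q \<in> Q \<Longrightarrow> poly p q \<notin> ball b r"
proof -
  obtain r0 br where r0: "r0 > 0"
    and br: "\<And>x. poly p x = b \<Longrightarrow> branch p (ball b r0) (br x)"
    and brb: "\<And>x. poly p x = b \<Longrightarrow> br x b = x"
    and surj: "\<And>s y. s \<in> ball b r0 \<Longrightarrow> poly p y = s \<Longrightarrow> \<exists>x. poly p x = b \<and> y = br x s"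
    and inj: "\<And>s x x'. s \<in> ball b r0 \<Longrightarrow> poly p x = b \<Longrightarrow> poly p x' = b \<Longrightarrow> br x s = br x' s \<Longrightarrow> x = x'"
    by (rule even_cover[OF deg reg]) (rule that; assumption)
  obtain d where d: "d > 0" "\<And>w. w \<in> poly p ` Q \<Longrightarrow> w \<noteq> b \<Longrightarrow> d \<le> dist b w"
    using finite_set_avoid[of "poly p ` Q" b] Q(1) by auto
  define r where "r = min r0 d"
  have sub: "ball b r \<subseteq> ball b r0" by (simp add: r_def subset_ball)
  show ?thesis
  proof (rule that[of r br])
    show "even_cover_disc p b r br"
    proof
      show "r > 0" using r0 d(1) by (simp add: r_def)
      show "branch p (ball b r) (br x)" if "poly p x = b" for x using branch_subset[OF br[OF that] sub] .
      show "\<exists>x. poly p x = b \<and> y = br x s" if "s \<in> ball b r" "poly p y = s" for s y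
        using surj that sub by blast
      show "x = x'" if "s \<in> ball b r" "poly p x = b" "poly p x' = b" "br x s = br x' s" for s x x'
        using inj that sub by blast
    qed (use deg brb in auto)
    show "poly p q \<notin> ball b r" if "q \<in> Q" for q using d(2)[of "poly p q"] Q(2)[OF that] that by (auto simp: r_def)
  qed
qed

section \<open>Factoring f through a power map about the common centre\<close>

theorem theorem2p2:
  fixes f :: "(nat \<Rightarrow> real) \<Rightarrow> (nat \<Rightarrow> real)" and A :: "(nat \<Rightarrow> real) set" and d :: nat
  assumes "rational_map d f" and "d \<ge> 2" and "polynomial_map f"
    and "A \<subseteq> topspace S2" and "finite A" and "card A \<ge> 4"
    and "card (f ` A \<union> crit_values f) \<ge> 3"
    and "CTP f A"
    and "A - f -` crit_values f \<noteq> {}"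
  shows "\<exists>s g. belyi_map s \<and> is_rational g \<and> (\<forall>x\<in>topspace S2. f x = g (s x)) \<and>
           card (s ` A \<union> crit_values s) = 3"
proof -
  obtain p where dp: "degree p = d" and f: "\<And>x. x \<in> topspace S2 \<Longrightarrow> f x = sphere_lift (poly p) x"
    using polynomial_map_sphere_lift[OF assms(1-3)] by blast
  have pdeg: "degree p \<ge> 2" "degree p > 0" using dp assms(2) by auto
  have fN: "f (from_C None) = from_C None" and fS: "f (from_C (Some z)) = from_C (Some (poly p z))" for z
    using f[OF from_C_in_S2] by (simp_all add: sphere_lift_def)
  obtain a where a: "a \<in> A" "f a \<notin> crit_values f" using assms(9) by auto
  have "from_C None \<in> crit_values f" using crit_points_poly(1)[OF pdeg(1) f] fN unfolding crit_values_def by force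
  then have "to_C a \<noteq> None" using a fN from_C_to_C[of a] assms(4) by (metis subsetD)
  then obtain xa where xa: "to_C a = Some xa" by auto
  then have xaA: "from_C (Some xa) \<in> A" "a = from_C (Some xa)" using a from_C_to_C[of a] assms(4) by auto
  define b where "b = poly p xa"
  have reg: "regular_value p b"
    unfolding regular_value_def
  proof (intro allI impI notI)
    fix y assume y: "poly p y = b" "poly (pderiv p) y = 0"
    then have "from_C (Some y) \<in> crit_points f" using crit_points_poly(2)[OF pdeg(1) f] by blast
    then have "f (from_C (Some y)) \<in> crit_values f" unfolding crit_values_def by blast
    then show False using a(2) y(1) xaA(2) by (simp add: fS b_def)
  qed
  \<comment> \<open>All points of A over \<open>b\<close> move together with the chosen regular one;
    every other finite point of A, regular or not, goes into \<open>Q\<close>.\<close>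
  define E where "E = {x. from_C (Some x) \<in> A \<and> poly p x = b}"
  define Q where "Q = {q. from_C (Some q) \<in> A \<and> poly p q \<noteq> b}"
  define fixinf where "fixinf \<longleftrightarrow> from_C None \<in> A"
  have injS: "inj (\<lambda>z. from_C (Some z))" by (simp add: inj_def from_C_inj)
  have Aeq: "A = (\<lambda>z. from_C (Some z)) ` E \<union> (\<lambda>z. from_C (Some z)) ` Q \<union> (if fixinf then {from_C None} else {})"
  proof (intro equalityI subsetI)
    fix y assume y: "y \<in> A"
    then have "y = from_C (to_C y)" using from_C_to_C assms(4) by auto
    then show "y \<in> (\<lambda>z. from_C (Some z)) ` E \<union> (\<lambda>z. from_C (Some z)) ` Q \<union> (if fixinf then {from_C None} else {})"
      using y by (cases "to_C y") (auto simp: E_def Q_def fixinf_def)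
  qed (auto simp: E_def Q_def fixinf_def split: if_splits)
  have "finite ((\<lambda>z. from_C (Some z)) ` E)" "finite ((\<lambda>z. from_C (Some z)) ` Q)"
    using assms(5) by (rule finite_subset[rotated], auto simp: E_def Q_def)+
  then have fin: "finite E" "finite Q"
    using injS by (meson finite_imageD inj_on_subset subset_UNIV)+
  have count: "card E + card Q + (if fixinf then 1 else 0) \<ge> 4"
  proof -
    have "card A \<le> card ((\<lambda>z. from_C (Some z)) ` E \<union> (\<lambda>z. from_C (Some z)) ` Q) + card (if fixinf then {from_C None} else {})"
      by (subst Aeq) (rule card_Un_le)
    also have "\<dots> \<le> card ((\<lambda>z. from_C (Some z)) ` E) + card ((\<lambda>z. from_C (Some z)) ` Q) + (if fixinf then 1 else 0)"
      using card_Un_le by (intro add_mono) auto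
    also have "\<dots> \<le> card E + card Q + (if fixinf then 1 else 0)"
      using card_image_le[OF fin(1)] card_image_le[OF fin(2)] by (intro add_mono) auto
    finally show ?thesis using assms(6) by simp
  qed
  have xaE: "xa \<in> E" using xaA by (simp add: E_def b_def)
  obtain r br where ec: "even_cover_disc p b r br" and avoid: "\<And>q. q \<in> Q \<Longrightarrow> poly p q \<notin> ball b r"
    using even_cover_avoiding[OF pdeg(2) reg fin(2)] by (auto simp: Q_def)
  interpret even_cover_disc p b r br by (rule ec)
  have ratf: "is_rational f" using assms(1) by (auto simp: is_rational_def)
  have half: "ball b (r/2) \<subseteq> ball b r" using r by (simp add: subset_ball)
  \<comment> \<open>The pushes are supported in the disc of half the radius, so they reach exactly
    the values t in \<open>ball b (r/2)\<close>; the branches are restricted accordingly.\<close>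
  have "\<exists>c. Q \<subseteq> {c} \<and> (\<forall>x\<in>E. \<forall>x'\<in>E. \<exists>\<kappa>. x' - c = \<kappa> * (x - c) \<and> (\<forall>z. poly p (c + \<kappa> * z) = poly p (c + z)))"
  proof (rule moebius_fixed_branches[where fixinf = fixinf and r = "r/2" and b = b and br = br, OF pdeg(2)])
    fix s assume s: "s \<in> ball b (r/2)"
    obtain M where M: "mobius M" and ME: "\<And>x. from_C (Some x) \<in> A \<Longrightarrow> poly p x = b \<Longrightarrow> M (from_C (Some (br x s))) = from_C (Some x)"
      and MQ: "\<And>q. from_C (Some q) \<in> A \<Longrightarrow> poly p q \<notin> ball b r \<Longrightarrow> M (from_C (Some q)) = from_C (Some q)"
      and MN: "from_C None \<in> A \<Longrightarrow> M (from_C None) = from_C None"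
      by (rule pushed_moebius[OF f ratf assms(4,8) s]) (assumption | (rule that; assumption))+
    obtain \<alpha> \<beta> \<gamma> \<delta> where det: "\<alpha> * \<delta> - \<beta> * \<gamma> \<noteq> 0"
      and fin: "\<And>w v. M (from_C (Some w)) = from_C (Some v) \<Longrightarrow> \<gamma> * w + \<delta> \<noteq> 0 \<and> v * (\<gamma> * w + \<delta>) = \<alpha> * w + \<beta>"
      and inf: "M (from_C None) = from_C None \<Longrightarrow> \<gamma> = 0"
      by (rule mobius_finite[OF M]) (rule that; assumption)
    show "\<exists>\<alpha> \<beta> \<gamma> \<delta>. \<alpha> * \<delta> - \<beta> * \<gamma> \<noteq> 0 \<and>
      (\<forall>x\<in>E. \<gamma> * br x s + \<delta> \<noteq> 0 \<and> x * (\<gamma> * br x s + \<delta>) = \<alpha> * br x s + \<beta>) \<and>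
      (\<forall>q\<in>Q. \<gamma> * q + \<delta> \<noteq> 0 \<and> q * (\<gamma> * q + \<delta>) = \<alpha> * q + \<beta>) \<and> (fixinf \<longrightarrow> \<gamma> = 0)"
    proof (rule exI[of _ \<alpha>], rule exI[of _ \<beta>], rule exI[of _ \<gamma>], rule exI[of _ \<delta>], intro conjI ballI impI det)
      fix x assume "x \<in> E"
      then have "M (from_C (Some (br x s))) = from_C (Some x)" using ME by (simp add: E_def)
      from fin[OF this] show "\<gamma> * br x s + \<delta> \<noteq> 0" "x * (\<gamma> * br x s + \<delta>) = \<alpha> * br x s + \<beta>" by auto
    next
      fix q assume "q \<in> Q"
      then have "M (from_C (Some q)) = from_C (Some q)" using MQ avoid[of q] by (simp add: Q_def)
      from fin[OF this] show "\<gamma> * q + \<delta> \<noteq> 0" "q * (\<gamma> * q + \<delta>) = \<alpha> * q + \<beta>" by auto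
    next
      assume fixinf
      then show "\<gamma> = 0" using MN inf by (simp add: fixinf_def)
    qed
  next
    show "r/2 > 0" using r by simp
    show "regular_value p s" if "s \<in> ball b (r/2)" for s using regular that half by blast
    show "branch p (ball b (r/2)) (br x)" if "x \<in> E" for x
      using br that by (intro branch_subset[OF _ half]) (simp add: E_def)
    show "br x b = x" if "x \<in> E" for x using brb that by (simp add: E_def)
    show "x = x'" if "s \<in> ball b (r/2)" "x \<in> E" "x' \<in> E" "br x s = br x' s" for s x x'
      using dist[of s x x'] that(2-4) subsetD[OF half that(1)] by (simp add: E_def del: mem_ball)
    show "finite E" "finite Q" by (fact fin)+
    show "E \<noteq> {}" using xaE by auto
    show "poly p q \<noteq> b" if "q \<in> Q" for q using that by (simp add: Q_def)
    show "4 \<le> card E + card Q + (if fixinf then 1 else 0)" by (rule count)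
  qed
  then obtain c where Qc: "Q \<subseteq> {c}"
    and rot: "\<And>x x'. x \<in> E \<Longrightarrow> x' \<in> E \<Longrightarrow> \<exists>\<kappa>. x' - c = \<kappa> * (x - c) \<and> (\<forall>z. poly p (c + \<kappa> * z) = poly p (c + z))"
    by blast
  \<comment> \<open>At most one finite point and infinity lie outside \<open>E\<close>, so a second
    point of \<open>E\<close> remains and provides a nontrivial rotation.\<close>
  have "card Q \<le> 1" using card_mono[OF _ Qc] by simp
  then have "card E \<ge> 2" using count by (cases fixinf) auto
  then obtain x' where x': "x' \<in> E" "x' \<noteq> xa" using fresh_element[of "{xa}" E] by auto
  define q where "q = shift_poly c p"
  \<comment> \<open>The rotations about c preserving p are those with \<kappa>^j = 1 for all
    exponents j in \<open>J\<close>, so their number is the gcd \<open>n\<close> of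
    \<open>J\<close>. It is nonzero because \<open>J\<close> contains the degree, and not 1 because
    a nontrivial rotation exists.\<close>
  define J where "J = {j. 0 < j \<and> poly.coeff q j \<noteq> 0}"
  define n where "n = Gcd J"
  have finJ: "finite J"
    by (rule finite_subset[of _ "{..degree q}"]) (auto simp: J_def le_degree)
  have dJ: "degree p \<in> J"
  proof -
    have "degree q = degree p" by (simp add: q_def)
    then have "poly.coeff q (degree p) \<noteq> 0" using pdeg by (metis degree_0 leading_coeff_0_iff less_numeral_extra(3))
    then show ?thesis using pdeg by (simp add: J_def)
  qed
  have rotn: "\<kappa> ^ n = 1" if "\<And>z. poly p (c + \<kappa> * z) = poly p (c + z)" for \<kappa>
    unfolding n_def by (rule power_Gcd_eq_1[OF finJ]) (use rotation_coeff[OF that] in \<open>auto simp: J_def q_def\<close>)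
  obtain \<kappa> where \<kappa>: "x' - c = \<kappa> * (xa - c)" "\<And>z. poly p (c + \<kappa> * z) = poly p (c + z)"
    using rot[OF xaE x'(1)] by blast
  have "\<kappa> \<noteq> 1" using \<kappa>(1) x'(2) by auto
  then have "n \<noteq> 1" using rotn[OF \<kappa>(2)] by auto
  moreover have "n \<noteq> 0" using dJ pdeg unfolding n_def by (auto simp: Gcd_0_iff)
  ultimately have n: "n \<ge> 2" by simp
  \<comment> \<open>A point at the centre would be fixed by the rotation that takes it to
    \<open>x'\<close>. This keeps the third value \<open>w\<close> below different from 0.\<close>
  have xac: "xa \<noteq> c" using \<kappa>(1) x'(2) by auto
  have "n dvd j" if "poly.coeff q j \<noteq> 0" for j
    using that Gcd_dvd[of j J] unfolding n_def by (cases "j = 0") (auto simp: J_def)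
  then obtain G where G: "\<And>z. poly q z = poly G (z ^ n)" using poly_factor_power by metis
  have Gp: "poly p z = poly G ((z - c) ^ n)" for z using G[of "z - c"] by (simp add: q_def)
  have degG: "degree G > 0"
  proof (rule ccontr)
    assume "\<not> degree G > 0"
    then obtain k where "G = [:k:]" by (metis degree_eq_zeroE gr0I)
    then have "poly p z = poly [:k:] z" for z using Gp by simp
    then have "p = [:k:]" by (metis poly_eq_poly_eq_iff ext)
    then show False using pdeg by simp
  qed
  define S where "S = [:-c, 1:] ^ n"
  have Sz: "poly S z = (z - c) ^ n" for z by (simp add: S_def)
  have degS: "degree S = n" by (simp add: S_def degree_linear_power)
  have "pderiv S = Polynomial.smult (of_nat n) ([:-c, 1:] ^ (n - 1))"
    by (simp add: S_def pderiv_power pderiv_pCons)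
  then have dS: "poly (pderiv S) z = 0 \<longleftrightarrow> z = c" for z using n by auto
  let ?s = "sphere_lift (poly S)" and ?g = "sphere_lift (poly G)"
  have crit: "crit_points ?s = {from_C None, from_C (Some c)}"
  proof (intro equalityI subsetI)
    fix x assume x: "x \<in> crit_points ?s"
    then have xe: "x = from_C (to_C x)" using from_C_to_C by (simp add: crit_points_def)
    show "x \<in> {from_C None, from_C (Some c)}"
    proof (cases "to_C x")
      case (Some z)
      then have "from_C (Some z) \<in> crit_points ?s" using x xe by simp
      then show ?thesis using crit_points_poly(2)[of S ?s z] degS n dS xe Some by auto
    qed (use xe in simp)
  next
    fix x assume "x \<in> {from_C None, from_C (Some c)}"
    then show "x \<in> crit_points ?s"
      using crit_points_poly(1)[of S ?s] crit_points_poly(2)[of S ?s c] degS n dS by auto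
  qed
  have critv: "crit_values ?s = {from_C None, from_C (Some 0)}"
    unfolding crit_values_def crit using n by (simp add: sphere_lift_def Sz power_0_left)
  define w where "w = (xa - c) ^ n"
  have w0: "w \<noteq> 0" using xac by (simp add: w_def)
  \<comment> \<open>The points of \<open>E\<close> differ by symmetries, whose n-th powers are 1, so
    they share the image \<open>w\<close>. Points of \<open>Q\<close> and infinity land on the
    critical values 0 and infinity, and no fourth value appears.\<close>
  have sE: "?s (from_C (Some x)) = from_C (Some w)" if x: "x \<in> E" for x
  proof -
    obtain \<mu> where \<mu>: "x - c = \<mu> * (xa - c)" "\<And>z. poly p (c + \<mu> * z) = poly p (c + z)"
      using rot[OF xaE x] by blast
    have "(x - c) ^ n = w" unfolding \<mu>(1) w_def power_mult_distrib rotn[OF \<mu>(2)] by simp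
    then show ?thesis by (simp add: sphere_lift_def Sz)
  qed
  have sQ: "?s (from_C (Some x)) = from_C (Some 0)" if "x \<in> Q" for x
    using that Qc n by (auto simp: sphere_lift_def Sz power_0_left)
  have "?s ` A \<union> crit_values ?s = {from_C None, from_C (Some 0), from_C (Some w)}"
  proof
    have "?s (from_C None) = from_C None" by (simp add: sphere_lift_def)
    then show "?s ` A \<union> crit_values ?s \<subseteq> {from_C None, from_C (Some 0), from_C (Some w)}"
      unfolding critv by (subst Aeq) (auto simp: sE sQ split: if_splits)
    show "{from_C None, from_C (Some 0), from_C (Some w)} \<subseteq> ?s ` A \<union> crit_values ?s"
      using sE[OF xaE] xaA(1) unfolding critv by force
  qed
  moreover have "card {from_C None, from_C (Some 0), from_C (Some w)} = 3"
    using w0 by (simp add: from_C_inj)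
  ultimately have "card (?s ` A \<union> crit_values ?s) = 3" by simp
  moreover have "belyi_map ?s"
    unfolding belyi_map_def
  proof
    show "\<exists>d\<ge>2. rational_map d ?s" using rational_map_sphere_lift[of S ?s] degS n by (intro exI[of _ n]) auto
    show "card (crit_values ?s) \<le> 3" unfolding critv by (simp add: card_insert_if)
  qed
  moreover have "is_rational ?g"
    unfolding is_rational_def using rational_map_sphere_lift[OF degG] by blast
  moreover have "f x = ?g (?s x)" if "x \<in> topspace S2" for x
  proof -
    have "poly p = (\<lambda>z. poly G ((z - c) ^ n))" using Gp by auto
    then show ?thesis using f[OF that] by (simp add: sphere_lift_compose Sz)
  qed
  ultimately show ?thesis by blast
qed

end
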